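(* Let $V=H^0(\mathbb P^2,\mathcal O(2))^*$, so $\mathbb P V\simeq\mathbb P^5$, and for $\vec a\in\Delta(2)$ let $X_{\vec a}\in V^*\subset S(V^* )$ denote the monomial $x^{\vec a}\in H^0(\mathbb P^2,\mathcal O(2))=V^*$ regarded as a linear generator of the polynomial algebra $S(V^* )=\mathbb C[X_{\vec a}\mid \vec a\in\Delta(2)]$ in $6$ variables. For $\vec a,\vec b\in\Delta(2)$ and $\vec c\in\Delta(3)$ put $$\{X_{\vec a},X_{\vec b}\}_{x^{\vec c}}:=\sum_{\vec a',\vec b'\in\Delta(2)}\Big[\sum_{\sigma}-\operatorname{sgn}(\sigma)\,\tilde\rho\big(\sigma\vec a,\sigma\vec b,\sigma\vec c,\vec a',\vec b'\big)\Big]X_{\vec a'}X_{\vec b'},$$ where the outer sum is over ordered pairs, the inner sum is over the symmetric group on the letters $\{a,b,c\}$ (with $(\sigma\vec a,\sigma\vec b,\sigma\vec c)$ the correspondingly permuted triple), and, for vectors $\vec a,\vec b,\vec c,\vec a',\vec b'\in\mathbb Z_{\ge0}^3$ with components $a_i,b_i,c_i,a_i',b_i'$ ($i=0,1,2$), $\tilde\rho(\vec a,\vec b,\vec c,\vec a',\vec b')$ equals $1$ if all of the conditions $$a_0'\le a_0-1,\quad a_1'>a_1-1,\quad a_1'\le a_1+b_1-1,\quad a_2+b_2<a_2'+1,\quad c_2+a_2+b_2\ge a_2'+1,$$ $$a_0'+b_0'=a_0+b_0+c_0-1,\quad a_1'+b_1'=a_1+b_1+c_1-1$$ hold, and equals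 $0$ otherwise. For a cubic form $F=\sum_{\vec c\in\Delta(3)}f_{\vec c}\,x^{\vec c}$ set $\{\cdot,\cdot\}_F=\sum_{\vec c}f_{\vec c}\{\cdot,\cdot\}_{x^{\vec c}}$, extended to $S(V^* )$ as a skew-symmetric biderivation. Then for every cubic form $F\in H^0(\mathbb P^2,\mathcal O(3))$ the bracket $\{\cdot,\cdot\}_F$ on $S(V^* )$ induces on $\mathbb P V\simeq\mathbb P^5$ the Poisson bivector $\Pi_F$ (the member attached to $F$ of the linear family of compatible Poisson brackets on $\mathbb P^5$ whose member for a smooth cubic $F$ is the Feigin--Odesskii bracket associated with the elliptic curve $C=(F=0)$ and the line bundle $\mathcal O(2)|_C$).
   Context: The base field is $\mathbb C$. Index sets: $\Delta(n)=\{(a_0,a_1,a_2)\in\mathbb Z^3: a_0+a_1+a_2=n,\ a_i\ge 0\}$ for $n\ge0$, and $\Delta(n)=\{(\alpha_0,\alpha_1,\alpha_2)\in\mathbb Z^3:\alpha_0+\alpha_1+\alpha_2=n,\ \alpha_i<0\}$ for $n<0$. Write $x^{\vec e}=x_0^{e_0}x_1^{e_1}x_2^{e_2}$. The monomials $x^{\vec e}$, $\vec e\in\Delta(n)$, form a basis of $H^0(\mathbb P^2,\mathcal O(n))$ for $n\ge0$; for $n<0$ the Laurent monomials $x^{\vec e}$, $\vec e\in\Delta(n)$, viewed as Čech $2$-cochains for the standard covering $U_i=(x_i\ne0)$, give a basis $x^{\vec e}_{\{0,1,2\}}$ of $H^2(\mathbb P^2,\mathcal O(n))$. Serre duality identifies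 $V=H^0(\mathbb P^2,\mathcal O(2))^*$ with $H^2(\mathbb P^2,\mathcal O(-5))$ via $\langle x^{\vec a},x^{\vec\alpha}_{\{0,1,2\}}\rangle=1$ if $\vec a+\vec\alpha=(-1,-1,-1)$ and $0$ otherwise. Compatible: two Poisson brackets are compatible if all their linear combinations are Poisson brackets. Induced bivector on $\mathbb P V$: a skew-symmetric biderivation on $S(V^* )$ for which the bracket of two linear forms is a quadratic form is the same as a skew-symmetric pairing $b:V^*\times V^*\to S^2(V^* )$. It induces the bivector $\Pi$ on $\mathbb P V$ given, at the point $\langle v\rangle$, under the identification $T_v^*\mathbb P V=\langle v\rangle^\perp\subset V^*$, by $\Pi_v(s_1\wedge s_2)=b(s_1,s_2)(v)$ for $s_1,s_2\in\langle v\rangle^\perp$. (The bracket on $S(V^* )$ itself is not required to satisfy the Jacobi identity.) Feigin--Odesskii (FO) bracket: for a line bundle $\xi$ of degree $n$ on an elliptic curve $C$ with a trivialization $\omega_C\simeq\mathcal O_C$, it is the Poisson bivector on $\mathbb P H^1(C,\xi^{-1})\simeq\mathbb P H^0(C,\xi)^*$ given by $\Pi_\phi(s_1\wedge s_2)=\langle\phi,\mathrm{MP}(s_1,\phi,s_2)\rangle$, for $\phi\in H^1(C,\xi^{-1})=\operatorname{Ext}^1(\xi,\mathcal O_C)$ and $s_1,s_2\in\langle\phi\rangle^\perp\subset H^0(C,\xi)$, where $\mathrm{MP}$ is the triple Massey product of $\mathcal O_C\xrightarrow{s_2}\xi\xrightarrow{\phi}\mathcal O_C[1]\xrightarrow{s_1}\xi[1]$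 and $\langle\cdot,\cdot\rangle$ is Serre duality. It is defined up to rescaling (choice of trivialization). The family $\Pi_F$: $F\mapsto\Pi_F$ is the linear map from $H^0(\mathbb P^2,\mathcal O(3))$ to bivectors on $\mathbb P V$ such that, for $F$ defining a smooth cubic $C$, $\Pi_F$ is the FO bracket of $(C,\mathcal O(2)|_C)$, where $H^0(C,\mathcal O(2)|_C)\simeq H^0(\mathbb P^2,\mathcal O(2))$ by restriction. Its normalization is as follows: for $e\in H^2(\mathbb P^2,\mathcal O(-5))\simeq V$ and $s_1,s_2\in\langle e\rangle^\perp\subset H^0(\mathbb P^2,\mathcal O(2))$, $$\Pi_F|_e(s_1\wedge s_2)=\langle m_4(F,s_1,e,s_2)-m_4(s_1,F,e,s_2),e\rangle .$$ Here $m_4$ is the $A_\infty$-product on $\bigoplus_{p,q}H^p(\mathbb P^2,\mathcal O(q))$ obtained by homological perturbation from the Čech dg-algebra $A=\bigoplus_{p,q}C^p(\mathbb P^2,\mathcal O(q))$ of the standard covering, with product $(\alpha\beta)_{i_0\dots i_{p+p'}}=\alpha_{i_0\dots i_p}\beta_{i_p\dots i_{p+p'}}$, using the following data. The inclusion $\iota$ is $\iota(f)_k=f$ for all $k$ in degree $0$, and $\iota(g)_{012}=g$ in degree $2$. The projection $\pi$ is $\pi(\gamma)=\gamma_2$ if $\gamma_2$ is a polynomial and $0$ otherwise (on cochains with monomial components) in degree $0$; in degree $2$ it is the projection onto the span of Laurent monomials with all exponents negative. The homotopy $Q$ is defined on cochains $\gamma\in A^p$ whose components are multiples of $x^{\vec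 e}$ by $Q(\gamma)_{i_0\dots i_{p-1}}=\gamma_{k\,i_0\dots i_{p-1}}$ with $k=\max\{i:e_i\ge0\}$, and $Q(\gamma)=0$ if all $e_i<0$. When one argument has degree $2$ and the other three have degree $0$, $m_4=-\sum_T\epsilon(T)m_T$, the sum being over the binary bracketings $T$ of four arguments. Here $m_T$ applies $\iota$ to the inputs, multiplies at vertices, applies $Q$ on interior edges and $\pi$ at the root. The signs are $\epsilon=+1$ for $((12)3)4$, $-1$ for $(1(23))4$, $+1$ for $1((23)4)$, $-1$ for $1(2(34))$; the bracketing $(12)(34)$ contributes $0$ in this case. *)

theory Defs
  imports "HOL-Analysis.Analysis" "HOL-Library.Poly_Mapping"
begin

section \<open>Laurent polynomials in three variables and the cohomology of the projective plane\<close>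

text \<open>Exponent vectors are indexed by the type 3, whose elements are 0, 1, 2 (in this order);
  the product of \<open>laurent\<close> is the usual (convolution) product.\<close>

type_synonym exps = "int^3"
type_synonym laurent = "exps \<Rightarrow>\<^sub>0 complex"

definition const :: "complex \<Rightarrow> ('a::zero \<Rightarrow>\<^sub>0 complex)" where
  "const c = Poly_Mapping.single 0 c"

definition xmon :: "exps \<Rightarrow> laurent" where
  "xmon e = Poly_Mapping.single e 1"

definition minus_one_vec :: exps where
  "minus_one_vec = (\<chi> i. - 1)"

definition Delta :: "int \<Rightarrow> exps set" where
  "Delta n = {e. (\<Sum>i\<in>UNIV. e $ i) = n \<and> (if n \<ge> 0 then \<forall>i. e $ i \<ge> 0 else \<forall>i. e $ i < 0)}"

text \<open>\<open>Hspace n\<close> is the 0-th cohomology of \<open>O(n)\<close> if \<open>n \<ge> 0\<close> and its second cohomology if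
  \<open>n < 0\<close>; in both cases it has the basis of monomials with exponents in \<open>Delta n\<close>.\<close>

definition Hspace :: "int \<Rightarrow> laurent set" where
  "Hspace n = {f. Poly_Mapping.keys f \<subseteq> Delta n}"

definition serre_pairing :: "laurent \<Rightarrow> laurent \<Rightarrow> complex" where
  "serre_pairing f g = (\<Sum>a\<in>Poly_Mapping.keys f. \<Sum>\<alpha>\<in>Poly_Mapping.keys g.
     Poly_Mapping.lookup f a * Poly_Mapping.lookup g \<alpha> * (if a + \<alpha> = minus_one_vec then 1 else 0))"

text \<open>The space \<open>V\<close>, the dual of \<open>Hspace 2\<close>, is realised as \<open>Hspace (-5)\<close> by means of
  \<open>serre_pairing\<close>, so that a nonzero \<open>e \<in> V\<close> represents a point of \<open>PV\<close>, whose cotangent space is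
  \<open>perp e\<close>.\<close>

abbreviation V :: "laurent set" where
  "V \<equiv> Hspace (- 5)"

definition perp :: "laurent \<Rightarrow> laurent set" where
  "perp e = {s \<in> Hspace 2. serre_pairing s e = 0}"


section \<open>The Cech algebra\<close>

text \<open>A cochain is given by its components on strictly increasing index tuples, and is 0 on all
  other lists.  A cochain need not be homogeneous in the Cech degree.\<close>

type_synonym cochain = "3 list \<Rightarrow> laurent"

abbreviation increasing :: "3 list \<Rightarrow> bool" where
  "increasing I \<equiv> I \<noteq> [] \<and> sorted_wrt (<) I"

definition cochains :: "nat \<Rightarrow> int \<Rightarrow> cochain set" where
  "cochains p n = {\<gamma>. (\<forall>I. \<not> (increasing I \<and> length I = p + 1) \<longrightarrow> \<gamma> I = 0) \<and>
     (\<forall>I. \<forall>e\<in>Poly_Mapping.keys (\<gamma> I). (\<Sum>i\<in>UNIV. e $ i) = n \<and> (\<forall>i. i \<notin> set I \<longrightarrow> e $ i \<ge> 0))}"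

definition cech_diff :: "cochain \<Rightarrow> cochain" where
  "cech_diff \<gamma> I = (if increasing I \<and> length I \<ge> 2
     then \<Sum>j<length I. (- 1) ^ j * \<gamma> (take j I @ drop (Suc j) I) else 0)"

definition cup :: "cochain \<Rightarrow> cochain \<Rightarrow> cochain" where
  "cup \<alpha> \<beta> I = (\<Sum>j<length I. \<alpha> (take (Suc j) I) * \<beta> (drop j I))"

text \<open>The component of a cochain on an arbitrary tuple, by the alternating convention.\<close>

definition alt_component :: "cochain \<Rightarrow> 3 list \<Rightarrow> laurent" where
  "alt_component \<gamma> I = (if distinct I
     then (- 1) ^ card {(r, s). r < s \<and> s < length I \<and> I ! r > I ! s} * \<gamma> (sort I) else 0)"

definition restrict_exps :: "(exps \<Rightarrow> bool) \<Rightarrow> laurent \<Rightarrow> laurent" where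
  "restrict_exps P f =
     (\<Sum>e\<in>{e \<in> Poly_Mapping.keys f. P e}. Poly_Mapping.single e (Poly_Mapping.lookup f e))"

definition nonneg_part :: "laurent \<Rightarrow> laurent" where
  "nonneg_part = restrict_exps (\<lambda>e. \<forall>i. e $ i \<ge> 0)"

definition neg_part :: "laurent \<Rightarrow> laurent" where
  "neg_part = restrict_exps (\<lambda>e. \<forall>i. e $ i < 0)"

text \<open>The homotopy: the summand for \<open>k\<close> collects the monomials \<open>x^e\<close> for which \<open>k\<close> is the
  largest index with \<open>e $ k \<ge> 0\<close>.\<close>

definition homotopy :: "cochain \<Rightarrow> cochain" where
  "homotopy \<gamma> I = (if increasing I then \<Sum>k\<in>UNIV.
     restrict_exps (\<lambda>e. (\<exists>i. e $ i \<ge> 0) \<and> k = Max {i. e $ i \<ge> 0}) (alt_component \<gamma> (k # I)) else 0)"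

text \<open>The total cohomology is the span of the monomials with exponents in the sets \<open>Delta n\<close>: those
  with nonnegative exponents lie in degree 0, those with negative exponents in degree 2.\<close>

definition incl :: "laurent \<Rightarrow> cochain" where
  "incl f I = (if length I = 1 then nonneg_part f else if I = [0, 1, 2] then neg_part f else 0)"

definition proj :: "cochain \<Rightarrow> laurent" where
  "proj \<gamma> = nonneg_part (\<gamma> [2]) + neg_part (\<gamma> [0, 1, 2])"

text \<open>This is only \<open>m\<^sub>4\<close> for one argument of degree 2 and three arguments of degree 0: the missing bracketing (12)(34) contributes 0 in that case.\<close>

definition m4 :: "laurent \<Rightarrow> laurent \<Rightarrow> laurent \<Rightarrow> laurent \<Rightarrow> laurent" where
  "m4 x y z w = - (
      proj (cup (homotopy (cup (homotopy (cup (incl x) (incl y))) (incl z))) (incl w))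
    - proj (cup (homotopy (cup (incl x) (homotopy (cup (incl y) (incl z))))) (incl w))
    + proj (cup (incl x) (homotopy (cup (homotopy (cup (incl y) (incl z))) (incl w))))
    - proj (cup (incl x) (homotopy (cup (incl y) (homotopy (cup (incl z) (incl w)))))))"


section \<open>Bivectors on \<open>PV\<close>\<close>

lemma finite_Delta_2: "finite (Delta 2)"
proof -
  have "e \<in> vec_lambda ` (UNIV \<rightarrow>\<^sub>E {0..2})" if e: "e \<in> Delta 2" for e :: exps
  proof -
    from e have nn: "\<And>i. e $ i \<ge> 0" and s: "(\<Sum>i\<in>UNIV. e $ i) = 2"
      by (auto simp: Delta_def)
    have "e $ i \<le> 2" for i
      using member_le_sum[of i UNIV "\<lambda>i. e $ i"] nn s by auto
    with nn have "(\<lambda>i. e $ i) \<in> UNIV \<rightarrow>\<^sub>E {0..2}" by auto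
    then show ?thesis by (metis image_eqI vec_nth_inverse)
  qed
  then have "Delta 2 \<subseteq> vec_lambda ` (UNIV \<rightarrow>\<^sub>E {0..2})" by blast
  moreover have "finite (vec_lambda ` (UNIV \<rightarrow>\<^sub>E {0..2}) :: exps set)"
    by (intro finite_imageI finite_PiE) auto
  ultimately show ?thesis by (rule finite_subset)
qed

typedef quad = "Delta 2"
  by (rule exI[of _ "\<chi> i. if i = 0 then 2 else 0"]) (auto simp: Delta_def)

instance quad :: finite
proof
  have "finite (Abs_quad ` Delta 2)"
    using finite_Delta_2 by (rule finite_imageI)
  then show "finite (UNIV :: quad set)"
    by (simp only: type_definition.Abs_image[OF type_definition_quad])
qed

text \<open>The symmetric algebra \<open>S(V\<^sup>*)\<close> as polynomials (finitely supported functions on multi-exponents)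
  in the variables \<open>X a\<close>.\<close>

type_synonym sym_alg = "(quad \<Rightarrow>\<^sub>0 nat) \<Rightarrow>\<^sub>0 complex"

definition X :: "quad \<Rightarrow> sym_alg" where
  "X a = Poly_Mapping.single (Poly_Mapping.single a 1) 1"

definition homogeneous :: "nat \<Rightarrow> sym_alg \<Rightarrow> bool" where
  "homogeneous k P \<longleftrightarrow> (\<forall>m\<in>Poly_Mapping.keys P. (\<Sum>a\<in>UNIV. Poly_Mapping.lookup m a) = k)"

definition lin_form :: "laurent \<Rightarrow> sym_alg" where
  "lin_form s = (\<Sum>a\<in>UNIV. const (Poly_Mapping.lookup s (Rep_quad a)) * X a)"

definition coord :: "quad \<Rightarrow> laurent \<Rightarrow> complex" where
  "coord a v = serre_pairing (xmon (Rep_quad a)) v"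

definition eval :: "sym_alg \<Rightarrow> laurent \<Rightarrow> complex" where
  "eval P v = (\<Sum>m\<in>Poly_Mapping.keys P.
     Poly_Mapping.lookup P m * (\<Prod>a\<in>UNIV. coord a v ^ Poly_Mapping.lookup m a))"

definition skew_biderivation :: "(sym_alg \<Rightarrow> sym_alg \<Rightarrow> sym_alg) \<Rightarrow> bool" where
  "skew_biderivation br \<longleftrightarrow>
     (\<forall>p q r. br (p + q) r = br p r + br q r) \<and>
     (\<forall>c p q. br (const c * p) q = const c * br p q) \<and>
     (\<forall>p q. br p q = - br q p) \<and>
     (\<forall>p q r. br (p * q) r = p * br q r + br p r * q)"

text \<open>A bivector on \<open>PV\<close> is a family of forms: its value at \<open>e\<close> is only relevant for nonzero
  \<open>e \<in> V\<close> and for arguments in \<open>perp e\<close>.\<close>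

type_synonym bivec = "laurent \<Rightarrow> laurent \<Rightarrow> laurent \<Rightarrow> complex"

definition bivec_eq :: "bivec \<Rightarrow> bivec \<Rightarrow> bool" where
  "bivec_eq B B' \<longleftrightarrow> (\<forall>e\<in>V - {0}. \<forall>s\<in>perp e. \<forall>t\<in>perp e. B e s t = B' e s t)"

definition bivec_comb :: "complex \<Rightarrow> bivec \<Rightarrow> complex \<Rightarrow> bivec \<Rightarrow> bivec" where
  "bivec_comb c B d B' = (\<lambda>e s t. c * B e s t + d * B' e s t)"

definition induces :: "(sym_alg \<Rightarrow> sym_alg \<Rightarrow> sym_alg) \<Rightarrow> bivec \<Rightarrow> bool" where
  "induces br B \<longleftrightarrow>
     (\<forall>s\<in>Hspace 2. \<forall>t\<in>Hspace 2. homogeneous 2 (br (lin_form s) (lin_form t))) \<and>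
     bivec_eq B (\<lambda>e s t. eval (br (lin_form s) (lin_form t)) e)"

text \<open>Regular functions on the affine chart \<open>X a \<noteq> 0\<close> of \<open>PV\<close>, as functions of degree 0 on the
  cone over it; their differentials, using the basis of \<open>V\<close> dual to the monomials; and the bracket of
  functions defined by a bivector.\<close>

definition regular :: "quad \<Rightarrow> (laurent \<Rightarrow> complex) \<Rightarrow> bool" where
  "regular a f \<longleftrightarrow> (\<exists>k P. homogeneous k P \<and>
     (\<forall>v\<in>V. coord a v \<noteq> 0 \<longrightarrow> f v = eval P v / coord a v ^ k))"

definition differential :: "(laurent \<Rightarrow> complex) \<Rightarrow> laurent \<Rightarrow> laurent" where
  "differential f v = (\<Sum>a\<in>Delta 2. Poly_Mapping.single a
     (deriv (\<lambda>z. f (v + Poly_Mapping.single (minus_one_vec - a) z)) 0))"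

definition fun_bracket ::
  "bivec \<Rightarrow> (laurent \<Rightarrow> complex) \<Rightarrow> (laurent \<Rightarrow> complex) \<Rightarrow> laurent \<Rightarrow> complex" where
  "fun_bracket B f g v = B v (differential f v) (differential g v)"

definition is_bivector :: "bivec \<Rightarrow> bool" where
  "is_bivector B \<longleftrightarrow>
     (\<forall>e\<in>V - {0}. \<forall>s\<in>perp e. \<forall>t\<in>perp e. \<forall>u\<in>perp e. \<forall>c.
        B e (const c * s + t) u = c * B e s u + B e t u \<and> B e s t = - B e t s) \<and>
     (\<forall>a f g. regular a f \<longrightarrow> regular a g \<longrightarrow> regular a (fun_bracket B f g))"

definition poisson :: "bivec \<Rightarrow> bool" where
  "poisson B \<longleftrightarrow> is_bivector B \<and>
     (\<forall>a f g h. regular a f \<longrightarrow> regular a g \<longrightarrow> regular a h \<longrightarrow>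
        (\<forall>v\<in>V. coord a v \<noteq> 0 \<longrightarrow>
           fun_bracket B f (fun_bracket B g h) v + fun_bracket B g (fun_bracket B h f) v
           + fun_bracket B h (fun_bracket B f g) v = 0))"

definition compatible :: "bivec \<Rightarrow> bivec \<Rightarrow> bool" where
  "compatible B B' \<longleftrightarrow> (\<forall>c d. poisson (bivec_comb c B d B'))"

definition Pi_F :: "laurent \<Rightarrow> bivec" where
  "Pi_F F e s t = serre_pairing (m4 F s e t - m4 s F e t) e"


section \<open>The explicit brackets\<close>

definition rho :: "exps \<Rightarrow> exps \<Rightarrow> exps \<Rightarrow> exps \<Rightarrow> exps \<Rightarrow> int" where
  "rho a b c a' b' = (if
      a' $ 0 \<le> a $ 0 - 1 \<and> a' $ 1 > a $ 1 - 1 \<and> a' $ 1 \<le> a $ 1 + b $ 1 - 1 \<and>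
      a $ 2 + b $ 2 < a' $ 2 + 1 \<and> c $ 2 + a $ 2 + b $ 2 \<ge> a' $ 2 + 1 \<and>
      a' $ 0 + b' $ 0 = a $ 0 + b $ 0 + c $ 0 - 1 \<and> a' $ 1 + b' $ 1 = a $ 1 + b $ 1 + c $ 1 - 1
    then 1 else 0)"

definition bracket_coeff :: "exps \<Rightarrow> exps \<Rightarrow> exps \<Rightarrow> exps \<Rightarrow> exps \<Rightarrow> int" where
  "bracket_coeff a b c a' b' = (\<Sum>\<sigma> | \<sigma> permutes {0, 1, 2 :: nat}.
     - sign \<sigma> * rho ([a, b, c] ! \<sigma> 0) ([a, b, c] ! \<sigma> 1) ([a, b, c] ! \<sigma> 2) a' b')"

definition generator_bracket :: "exps \<Rightarrow> quad \<Rightarrow> quad \<Rightarrow> sym_alg" where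
  "generator_bracket c a b = (\<Sum>a'\<in>UNIV. \<Sum>b'\<in>UNIV.
     of_int (bracket_coeff (Rep_quad a) (Rep_quad b) c (Rep_quad a') (Rep_quad b')) * X a' * X b')"

definition is_bracket :: "laurent \<Rightarrow> (sym_alg \<Rightarrow> sym_alg \<Rightarrow> sym_alg) \<Rightarrow> bool" where
  "is_bracket F br \<longleftrightarrow> skew_biderivation br \<and>
     (\<forall>a b. br (X a) (X b) =
        (\<Sum>c\<in>Delta 3. const (Poly_Mapping.lookup F c) * generator_bracket c a b))"


section \<open>Feigin--Odesskii brackets of plane cubics\<close>

definition laurent_eval :: "laurent \<Rightarrow> complex^3 \<Rightarrow> complex" where
  "laurent_eval f p = (\<Sum>e\<in>Poly_Mapping.keys f. Poly_Mapping.lookup f e * (\<Prod>i\<in>UNIV. p $ i powi (e $ i)))"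

definition laurent_pderiv :: "3 \<Rightarrow> laurent \<Rightarrow> laurent" where
  "laurent_pderiv i f = (\<Sum>e\<in>Poly_Mapping.keys f.
     Poly_Mapping.single (e - axis i 1) (of_int (e $ i) * Poly_Mapping.lookup f e))"

definition smooth_cubic :: "laurent \<Rightarrow> bool" where
  "smooth_cubic F \<longleftrightarrow> F \<in> Hspace 3 \<and> F \<noteq> 0 \<and>
     (\<forall>p. p \<noteq> 0 \<and> laurent_eval F p = 0 \<longrightarrow> (\<exists>i. laurent_eval (laurent_pderiv i F) p \<noteq> 0))"

text \<open>Let \<open>C\<close> be the curve \<open>F = 0\<close>.  On intersections of the open sets \<open>x\<^sub>i \<noteq> 0\<close> the sections of
  \<open>O(n)|C\<close> are those of \<open>O(n)\<close> modulo \<open>F\<close> times those of \<open>O(n-3)\<close>.  Hence the Cech complex of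
  \<open>O(n)|C\<close> is the complex of the \<open>cochains p n\<close> modulo the following congruence.\<close>

definition cong_mod :: "laurent \<Rightarrow> nat \<Rightarrow> int \<Rightarrow> cochain \<Rightarrow> cochain \<Rightarrow> bool" where
  "cong_mod F p n \<gamma> \<gamma>' \<longleftrightarrow> (\<exists>\<delta>\<in>cochains p (n - 3). \<forall>I. \<gamma> I - \<gamma>' I = F * \<delta> I)"

definition curve_cocycles :: "laurent \<Rightarrow> nat \<Rightarrow> int \<Rightarrow> cochain set" where
  "curve_cocycles F p n =
     {\<gamma> \<in> cochains p n. cong_mod F (p + 1) n (cech_diff \<gamma>) (\<lambda>I. 0)}"

text \<open>A trivialization of the canonical bundle of \<open>C\<close> amounts, by composition with the trace map, to
  a nonzero linear functional on the first cohomology of \<open>O\<^sub>C\<close>, here given on cocycles.\<close>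

definition trivialization :: "laurent \<Rightarrow> (cochain \<Rightarrow> complex) \<Rightarrow> bool" where
  "trivialization F \<tau> \<longleftrightarrow>
     (\<forall>\<gamma>\<in>curve_cocycles F 1 0. \<forall>\<gamma>'\<in>curve_cocycles F 1 0. \<forall>c.
        \<tau> (\<lambda>I. const c * \<gamma> I + \<gamma>' I) = c * \<tau> \<gamma> + \<tau> \<gamma>') \<and>
     (\<forall>\<gamma>\<in>curve_cocycles F 1 0. \<forall>h\<in>cochains 0 0. cong_mod F 1 0 \<gamma> (cech_diff h) \<longrightarrow> \<tau> \<gamma> = 0) \<and>
     (\<exists>\<gamma>\<in>curve_cocycles F 1 0. \<tau> \<gamma> \<noteq> 0)"

text \<open>Here \<open>\<phi>\<close> is a cocycle representing a class in the first cohomology of \<open>O(-2)|C\<close>, and \<open>m\<close> is one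
  of the representatives of the triple Massey product of \<open>s\<^sub>2\<close>, \<open>\<phi>\<close> and \<open>s\<^sub>1\<close>, a 0-cocycle of
  \<open>O(2)|C\<close> that is determined modulo the span of \<open>s\<^sub>1\<close> and \<open>s\<^sub>2\<close>.\<close>

definition massey :: "laurent \<Rightarrow> laurent \<Rightarrow> cochain \<Rightarrow> laurent \<Rightarrow> cochain \<Rightarrow> bool" where
  "massey F s1 \<phi> s2 m \<longleftrightarrow> (\<exists>h1\<in>cochains 0 0. \<exists>h2\<in>cochains 0 0.
     cong_mod F 1 0 (cech_diff h1) (cup (incl s1) \<phi>) \<and>
     cong_mod F 1 0 (cech_diff h2) (cup \<phi> (incl s2)) \<and>
     m = (\<lambda>I. cup (incl s1) h2 I - cup h1 (incl s2) I))"

text \<open>The class of \<open>\<phi>\<close> corresponds to the vector \<open>e \<in> V\<close> by Serre duality on \<open>C\<close> and the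
  isomorphism of \<open>Hspace 2\<close> with the sections of \<open>O(2)|C\<close> by restriction.\<close>

definition FO_value ::
  "laurent \<Rightarrow> (cochain \<Rightarrow> complex) \<Rightarrow> laurent \<Rightarrow> laurent \<Rightarrow> laurent \<Rightarrow> complex \<Rightarrow> bool" where
  "FO_value F \<tau> e s1 s2 z \<longleftrightarrow> (\<exists>\<phi>\<in>curve_cocycles F 1 (- 2). \<exists>m.
     (\<forall>s\<in>Hspace 2. \<tau> (cup (incl s) \<phi>) = serre_pairing s e) \<and>
     massey F s1 \<phi> s2 m \<and> z = \<tau> (cup m \<phi>))"

definition is_FO_bracket :: "laurent \<Rightarrow> bivec \<Rightarrow> bool" where
  "is_FO_bracket F B \<longleftrightarrow> (\<exists>\<tau>. trivialization F \<tau> \<and>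
     (\<forall>e\<in>V - {0}. \<forall>s1\<in>perp e. \<forall>s2\<in>perp e. \<forall>z.
        FO_value F \<tau> e s1 s2 z \<longleftrightarrow> z = B e s1 s2))"

end

theory Submission
  imports Defs
begin

text \<open>
  Let \<open>s, t\<close> be quadratic forms, \<open>F\<close> a cubic form and \<open>e \<in> V\<close>, and let \<open>Q\<close> be the homotopy.

  \<^emph>\<open>The explicit formula.\<close> A bracketing that contributes to one of the two products \<open>m4\<close> multiplies
  \<open>e\<close> by \<open>s\<close>, \<open>t\<close> and \<open>F\<close> in some order and applies \<open>Q\<close> after the first and the second
  multiplication: a bracketing that begins with a product of two sections vanishes, since \<open>Q\<close> kills
  it.  All six orders occur, and they make up an antisymmetrization (\<open>Pi_F_zigzag\<close>).  On monomials
  \<open>Q\<close> only looks at the signs of the exponents, and \<open>rho\<close> is exactly the indicator of the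
  monomials that survive (\<open>flag_rho\<close>, \<open>Pi_F_bracket_form\<close>).

  \<^emph>\<open>The Feigin--Odesskii bracket.\<close> A 1-cocycle \<open>\<gamma>\<close> of \<open>O\<^sub>C\<close> satisfies \<open>d \<gamma> = F \<delta>\<close>, and its
  trace is the coefficient of \<open>1/(x\<^sub>0 x\<^sub>1 x\<^sub>2)\<close> in \<open>\<delta>\<close>.  Since \<open>Q\<close> contracts the Cech complex, it
  produces the cocycle \<open>\<phi> = Q (F e)\<close> of \<open>e\<close> and all the null-homotopies of the Massey product.  The
  representative of the Massey product obtained in this way is congruent modulo \<open>F\<close> to a quadratic
  form, and this quadratic form is the same combination of terms as in \<open>m4\<close> (\<open>std_value\<close>).  Any other
  choice of \<open>\<phi>\<close> and of the null-homotopies changes the quadratic form by a combination of \<open>s\<close>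
  and \<open>t\<close>, to which \<open>e\<close> is orthogonal (\<open>massey_value_unique\<close>).

  \<^emph>\<open>The Jacobi identity.\<close> The bivector does not change when the bracket on the cone is modified by
  \<open>X b * \<lambda> a - X a * \<lambda> b\<close> with linear forms \<open>\<lambda> a\<close>, by Euler's relation.  The bracket of the statement
  violates the Jacobi identity in general, but for a suitable \<open>\<lambda>\<close> the modified one satisfies it: for
  the \<open>\<lambda>\<close> that makes it equivariant under the special linear group, acting on \<open>F\<close> as well.  Write \<open>(u v)\<close> for the
  linear coordinate belonging to a product of two linear forms.  Then three times the modified bracket
  of \<open>(u u)\<close> and \<open>(v v)\<close> is \<open>- 6 det(u,v,f) ((u v) (f f) + (u f) (v f))\<close> when \<open>F = f\<^sup>3\<close>.  The Jacobi
  identity of the modified bracket is a polynomial identity in the six coordinates and the ten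
  coefficients of \<open>F\<close> (\<open>jacobiator_zero\<close>).  It passes to functions of degree 0 on the cone
  (\<open>chart_bracket_jacobi\<close>).  As it holds for every \<open>F\<close> and the bivector depends linearly on \<open>F\<close>,
  compatibility follows.
\<close>

section \<open>Laurent polynomials\<close>

abbreviation "lookup \<equiv> Poly_Mapping.lookup"
abbreviation "keys \<equiv> Poly_Mapping.keys"

lemma UNIV_3_from_0: "(UNIV :: 3 set) = {0, 1, 2}"
  using Cartesian_Space.UNIV_3 by auto

lemma three_less: "(0::3) < 1" "(0::3) < 2" "(1::3) < 2"
  by (simp_all add: less_bit1_def bit1.Rep_0 bit1.Rep_1 bit1.Rep_numeral)

lemma three_order [simp]:
  "(0::3) < 1" "(0::3) < 2" "(1::3) < 2" "\<not> (1::3) < 0" "\<not> (2::3) < 0" "\<not> (2::3) < 1"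
  "(0::3) \<le> 1" "(0::3) \<le> 2" "(1::3) \<le> 2" "\<not> (1::3) \<le> 0" "\<not> (2::3) \<le> 0" "\<not> (2::3) \<le> 1"
  using three_less less_asym by (auto simp only: not_le intro: less_imp_le)

lemma all_3: "(\<forall>i::3. P i) \<longleftrightarrow> P 0 \<and> P 1 \<and> P 2"
proof -
  have "(\<forall>i::3. P i) \<longleftrightarrow> (\<forall>i\<in>UNIV. P i)" by blast
  also have "\<dots> \<longleftrightarrow> P 0 \<and> P 1 \<and> P 2" unfolding UNIV_3_from_0 by blast
  finally show ?thesis .
qed

lemma sum_3:
  fixes f :: "3 \<Rightarrow> 'a :: comm_monoid_add"
  shows "(\<Sum>i\<in>UNIV. f i) = f 0 + f 1 + f 2"
  unfolding UNIV_3_from_0 by (simp add: add.assoc)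

lemma lookup_restrict: "lookup (restrict_exps P f) e = (if P e then lookup f e else 0)"
proof -
  have "lookup (restrict_exps P f) e = (\<Sum>a\<in>{a \<in> keys f. P a}. lookup f a when a = e)"
    by (simp add: restrict_exps_def lookup_sum lookup_single)
  also have "\<dots> = (\<Sum>a\<in>{a \<in> keys f. P a}. if e = a then lookup f a else 0)"
    by (rule sum.cong) (auto simp: when_def)
  also have "\<dots> = (if P e then lookup f e else 0)"
    by (subst sum.delta') (auto simp: in_keys_iff)
  finally show ?thesis .
qed

lemma lookup_const_mult:
  fixes f :: "'a :: comm_monoid_add \<Rightarrow>\<^sub>0 complex"
  shows "lookup (const c * f) e = c * lookup f e"
  unfolding const_def mult_map_scale_conv_mult[symmetric]
  by (simp add: Poly_Mapping.map.rep_eq when_def)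

lemma restrict_add: "restrict_exps P (f + g) = restrict_exps P f + restrict_exps P g"
  by (rule poly_mapping_eqI) (simp add: lookup_restrict lookup_add)
lemma restrict_diff: "restrict_exps P (f - g) = restrict_exps P f - restrict_exps P g"
  by (rule poly_mapping_eqI) (simp add: lookup_restrict lookup_minus)
lemma restrict_uminus: "restrict_exps P (- f) = - restrict_exps P f"
  by (rule poly_mapping_eqI) (simp add: lookup_restrict)
lemma restrict_zero [simp]: "restrict_exps P 0 = 0"
  by (rule poly_mapping_eqI) (simp add: lookup_restrict)
lemma restrict_const: "restrict_exps P (const c * f) = const c * restrict_exps P f"
  by (rule poly_mapping_eqI) (simp add: lookup_restrict lookup_const_mult)
lemma restrict_id: "(\<And>e. e \<in> keys f \<Longrightarrow> P e) \<Longrightarrow> restrict_exps P f = f"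
  by (rule poly_mapping_eqI) (auto simp: lookup_restrict in_keys_iff)
lemma restrict_0I: "(\<And>e. e \<in> keys f \<Longrightarrow> \<not> P e) \<Longrightarrow> restrict_exps P f = 0"
  by (rule poly_mapping_eqI) (auto simp: lookup_restrict in_keys_iff)
lemma keys_restrict: "keys (restrict_exps P f) = {e \<in> keys f. P e}"
  by (auto simp: in_keys_iff lookup_restrict split: if_splits)

lemma poly_mapping_sum_single:
  assumes "finite A" "keys f \<subseteq> A"
  shows "f = (\<Sum>a\<in>A. Poly_Mapping.single a (lookup f a))"
proof (rule poly_mapping_eqI)
  fix e
  have "(\<Sum>a\<in>A. lookup f a when a = e) = (\<Sum>a\<in>A. if e = a then lookup f a else 0)"
    by (rule sum.cong) (auto simp: when_def)
  also have "\<dots> = lookup f e" using assms by (auto simp: sum.delta' in_keys_iff)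
  finally show "lookup f e = lookup (\<Sum>a\<in>A. Poly_Mapping.single a (lookup f a)) e"
    by (simp add: lookup_sum lookup_single)
qed

lemma lookup_mult_sum:
  fixes f g :: "'a :: ab_group_add \<Rightarrow>\<^sub>0 complex"
  assumes "finite A" "keys f \<subseteq> A"
  shows "lookup (f * g) k = (\<Sum>a\<in>A. lookup f a * lookup g (k - a))"
proof -
  have "lookup (Poly_Mapping.single a c * g) k = c * lookup g (k - a)" for a c
  proof -
    have "lookup (Poly_Mapping.single a c * g) k = (\<Sum>b\<in>keys g. c * lookup g b when a + b = k)"
      by (subst poly_mapping_sum_single[of "keys g" g])
        (simp_all add: sum_distrib_left lookup_sum mult_single lookup_single)
    also have "\<dots> = (\<Sum>b\<in>keys g. if k - a = b then c * lookup g b else 0)"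
      by (rule sum.cong) (auto simp: when_def)
    also have "\<dots> = c * lookup g (k - a)" by (auto simp: sum.delta' in_keys_iff)
    finally show ?thesis .
  qed
  then show ?thesis
    by (subst poly_mapping_sum_single[OF assms]) (simp add: sum_distrib_right lookup_sum)
qed

lemma lookup_mult: "lookup (f * g) k = (\<Sum>a\<in>keys f. lookup f a * lookup g (k - a))" for f g :: laurent
  by (rule lookup_mult_sum) auto

text \<open>For a total order on the exponents that is compatible with addition, the product of the two
  leading terms cannot cancel.  Such an order is inherited from the finitely supported
  integer functions.\<close>

lemma laurent_no_zero_divisors:
  fixes f g :: laurent
  assumes "f \<noteq> 0" "g \<noteq> 0"
  shows "f * g \<noteq> 0"
proof -
  define \<phi> :: "exps \<Rightarrow> (nat \<Rightarrow>\<^sub>0 int)" where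
    "\<phi> e = Poly_Mapping.single 0 (e $ 0) + Poly_Mapping.single 1 (e $ 1) + Poly_Mapping.single 2 (e $ 2)" for e
  have add: "\<phi> (a + b) = \<phi> a + \<phi> b" for a b
    by (simp add: \<phi>_def single_add algebra_simps)
  have inj: "a = b" if "\<phi> a = \<phi> b" for a b
  proof -
    have "lookup (\<phi> a) i = lookup (\<phi> b) i" for i using that by simp
    from this[of 0] this[of 1] this[of 2] have "a $ 0 = b $ 0" "a $ 1 = b $ 1" "a $ 2 = b $ 2"
      by (simp_all add: \<phi>_def lookup_add lookup_single)
    then show ?thesis by (simp add: vec_eq_iff all_3)
  qed
  have top: "\<exists>a\<in>keys h. \<forall>b\<in>keys h. \<phi> b \<le> \<phi> a" if "h \<noteq> 0" for h :: laurent
  proof -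
    have "finite (\<phi> ` keys h)" "\<phi> ` keys h \<noteq> {}" using that by auto
    from Max_in[OF this] Max_ge[OF this(1)] show ?thesis by fastforce
  qed
  obtain a where a: "a \<in> keys f" "\<And>a'. a' \<in> keys f \<Longrightarrow> \<phi> a' \<le> \<phi> a" using top[OF assms(1)] by blast
  obtain b where b: "b \<in> keys g" "\<And>b'. b' \<in> keys g \<Longrightarrow> \<phi> b' \<le> \<phi> b" using top[OF assms(2)] by blast
  have "lookup f a' * lookup g (a + b - a') = (if a = a' then lookup f a * lookup g b else 0)" if "a' \<in> keys f" for a'
  proof (cases "a' = a")
    case False
    have "a + b - a' \<notin> keys g"
    proof
      assume "a + b - a' \<in> keys g"
      then have 1: "\<phi> (a + b - a') \<le> \<phi> b" by (rule b)
      have "\<phi> a' + \<phi> (a + b - a') = \<phi> a + \<phi> b" by (simp flip: add)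
      moreover have "\<phi> a' < \<phi> a" using a(2)[OF that] inj False by (metis order_le_less)
      ultimately show False using 1 by (metis add_less_le_mono less_irrefl)
    qed
    then show ?thesis using False by (auto simp: in_keys_iff)
  qed auto
  then have "lookup (f * g) (a + b) = (\<Sum>a'\<in>keys f. if a = a' then lookup f a * lookup g b else 0)"
    by (simp add: lookup_mult_sum[of "keys f" f])
  also have "\<dots> = lookup f a * lookup g b" using a by (simp add: sum.delta')
  also have "\<dots> \<noteq> 0" using a b by (simp add: in_keys_iff)
  finally show ?thesis by auto
qed

section \<open>Cochains in components\<close>

lemma increasing_cases:
  "increasing (I :: 3 list) \<longleftrightarrow> I \<in> {[0], [1], [2], [0,1], [0,2], [1,2], [0,1,2]}"
proof
  assume I: "increasing I"
  then have "card (set I) = length I" by (metis distinct_card strict_sorted_iff)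
  moreover have "card (set I) \<le> 3" using card_mono[of "UNIV :: 3 set" "set I"] by simp
  ultimately have "length I \<le> 3" by simp
  then consider "length I = 0" | "length I = 1" | "length I = 2" | "length I = 3" by linarith
  then show "I \<in> {[0], [1], [2], [0,1], [0,2], [1,2], [0,1,2]}"
  proof cases
    case 1 then show ?thesis using I by simp
  next
    case 2
    then obtain i where "I = [i]" by (auto simp: length_Suc_conv)
    moreover have "\<forall>i::3. i = 0 \<or> i = 1 \<or> i = 2" by (simp add: all_3)
    ultimately show ?thesis by auto
  next
    case 3
    then obtain i j where "I = [i, j]" by (auto simp: length_Suc_conv numeral_2_eq_2)
    moreover have "\<forall>i j::3. i < j \<longrightarrow> [i, j] \<in> {[0,1],[0,2],[1,2]}" by (simp add: all_3)
    ultimately show ?thesis using I by auto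
  next
    case 4
    then obtain i j k where "I = [i, j, k]" by (auto simp: length_Suc_conv numeral_3_eq_3)
    moreover have "\<forall>i j k::3. i < j \<and> j < k \<longrightarrow> [i, j, k] = [0,1,2]" by (simp add: all_3)
    ultimately show ?thesis using I by auto
  qed
qed auto

definition lead_index :: "3 \<Rightarrow> exps \<Rightarrow> bool" where
  "lead_index k e \<longleftrightarrow> (\<exists>i. e $ i \<ge> 0) \<and> k = Max {i. e $ i \<ge> 0}"

abbreviation lead_part :: "3 \<Rightarrow> laurent \<Rightarrow> laurent" where
  "lead_part k \<equiv> restrict_exps (lead_index k)"

lemma lead_index_alt: "lead_index k e \<longleftrightarrow> e $ k \<ge> 0 \<and> (\<forall>i. e $ i \<ge> 0 \<longrightarrow> i \<le> k)"
proof (cases "\<exists>i. e $ i \<ge> 0")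
  case True
  then have "k = Max {i. e $ i \<ge> 0} \<longleftrightarrow> k \<in> {i. e $ i \<ge> 0} \<and> (\<forall>i\<in>{i. e $ i \<ge> 0}. i \<le> k)"
    by (intro eq_Max_iff) auto
  with True show ?thesis by (auto simp: lead_index_def)
qed (auto simp: lead_index_def)

lemma lead_index_iff:
  "lead_index 0 e \<longleftrightarrow> e $ 0 \<ge> 0 \<and> e $ 1 < 0 \<and> e $ 2 < 0"
  "lead_index 1 e \<longleftrightarrow> e $ 1 \<ge> 0 \<and> e $ 2 < 0"
  "lead_index 2 e \<longleftrightarrow> e $ 2 \<ge> 0"
  unfolding lead_index_alt by (auto simp: all_3)

lemma alt_component_simps:
  "alt_component \<gamma> [0,0] = 0" "alt_component \<gamma> [1,1] = 0" "alt_component \<gamma> [2,2] = 0"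
  "alt_component \<gamma> [0,1] = \<gamma> [0,1]" "alt_component \<gamma> [0,2] = \<gamma> [0,2]" "alt_component \<gamma> [1,2] = \<gamma> [1,2]"
  "alt_component \<gamma> [1,0] = - \<gamma> [0,1]" "alt_component \<gamma> [2,0] = - \<gamma> [0,2]" "alt_component \<gamma> [2,1] = - \<gamma> [1,2]"
  "alt_component \<gamma> [0,0,1] = 0" "alt_component \<gamma> [0,0,2] = 0" "alt_component \<gamma> [0,1,2] = \<gamma> [0,1,2]"
  "alt_component \<gamma> [1,0,1] = 0" "alt_component \<gamma> [1,1,2] = 0" "alt_component \<gamma> [1,0,2] = - \<gamma> [0,1,2]"
  "alt_component \<gamma> [2,0,2] = 0" "alt_component \<gamma> [2,1,2] = 0" "alt_component \<gamma> [2,0,1] = \<gamma> [0,1,2]"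
  "alt_component \<gamma> [k,0,1,2] = 0"
proof -
  have inv2: "card {(r, s). r < s \<and> s < length [i,j] \<and> [i,j] ! r > [i,j] ! s} = (if i > j then 1 else 0)" for i j :: 3
  proof -
    have "{(r, s). r < s \<and> s < length [i,j] \<and> [i,j] ! r > [i,j] ! s} = (if i > j then {(0,1)} else {})"
      by (auto simp: less_Suc_eq)
    then show ?thesis by simp
  qed
  have inv3: "{(r, s). r < s \<and> s < length [i,j,k] \<and> [i,j,k] ! r > [i,j,k] ! s} =
    (if i > j then {(0,1)} else {}) \<union> (if i > k then {(0,2)} else {}) \<union> (if j > k then {(1,2)} else {})" for i j k :: 3
    by (auto simp: less_Suc_eq numeral_2_eq_2)
  show "alt_component \<gamma> [0,0] = 0" "alt_component \<gamma> [1,1] = 0" "alt_component \<gamma> [2,2] = 0"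
  "alt_component \<gamma> [0,1] = \<gamma> [0,1]" "alt_component \<gamma> [0,2] = \<gamma> [0,2]" "alt_component \<gamma> [1,2] = \<gamma> [1,2]"
  "alt_component \<gamma> [1,0] = - \<gamma> [0,1]" "alt_component \<gamma> [2,0] = - \<gamma> [0,2]" "alt_component \<gamma> [2,1] = - \<gamma> [1,2]"
    unfolding alt_component_def inv2 by simp_all
  show  "alt_component \<gamma> [0,0,1] = 0" "alt_component \<gamma> [0,0,2] = 0" "alt_component \<gamma> [0,1,2] = \<gamma> [0,1,2]"
  "alt_component \<gamma> [1,0,1] = 0" "alt_component \<gamma> [1,1,2] = 0" "alt_component \<gamma> [1,0,2] = - \<gamma> [0,1,2]"
  "alt_component \<gamma> [2,0,2] = 0" "alt_component \<gamma> [2,1,2] = 0" "alt_component \<gamma> [2,0,1] = \<gamma> [0,1,2]"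
    unfolding alt_component_def inv3 by simp_all
  have "\<forall>k. \<not> distinct [k,0,1,2::3]" by (simp add: all_3)
  then show "alt_component \<gamma> [k,0,1,2] = 0" unfolding alt_component_def by auto
qed

lemma homotopy_components:
  "homotopy \<gamma> [0] = - lead_part 1 (\<gamma> [0,1]) - lead_part 2 (\<gamma> [0,2])"
  "homotopy \<gamma> [1] = lead_part 0 (\<gamma> [0,1]) - lead_part 2 (\<gamma> [1,2])"
  "homotopy \<gamma> [2] = lead_part 0 (\<gamma> [0,2]) + lead_part 1 (\<gamma> [1,2])"
  "homotopy \<gamma> [0,1] = lead_part 2 (\<gamma> [0,1,2])"
  "homotopy \<gamma> [0,2] = - lead_part 1 (\<gamma> [0,1,2])"
  "homotopy \<gamma> [1,2] = lead_part 0 (\<gamma> [0,1,2])"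
  "homotopy \<gamma> [0,1,2] = 0"
  unfolding homotopy_def lead_index_def[symmetric] by (simp_all add: sum_3 alt_component_simps restrict_uminus)

lemma homotopy_not_increasing: "\<not> increasing I \<Longrightarrow> homotopy \<gamma> I = 0"
  by (auto simp: homotopy_def)

lemma cech_diff_components:
  "cech_diff \<gamma> [i] = 0"
  "i < j \<Longrightarrow> cech_diff \<gamma> [i,j] = \<gamma> [j] - \<gamma> [i]"
  "cech_diff \<gamma> [0,1,2] = \<gamma> [1,2] - \<gamma> [0,2] + \<gamma> [0,1]"
  by (simp_all add: cech_diff_def numeral_2_eq_2 numeral_3_eq_3)

lemma cech_diff_not_increasing: "\<not> increasing I \<Longrightarrow> cech_diff \<gamma> I = 0"
  by (auto simp: cech_diff_def)

lemma cochain_eqI: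
  assumes "\<And>I. \<not> increasing I \<Longrightarrow> \<gamma> I = 0" "\<And>I. \<not> increasing I \<Longrightarrow> \<gamma>' I = 0"
    and "\<gamma> [0] = \<gamma>' [0]" "\<gamma> [1] = \<gamma>' [1]" "\<gamma> [2] = \<gamma>' [2]"
    and "\<gamma> [0,1] = \<gamma>' [0,1]" "\<gamma> [0,2] = \<gamma>' [0,2]" "\<gamma> [1,2] = \<gamma>' [1,2]" "\<gamma> [0,1,2] = \<gamma>' [0,1,2]"
  shows "\<gamma> = \<gamma>'"
proof
  fix I show "\<gamma> I = \<gamma>' I"
  proof (cases "increasing I")
    case True then have "I \<in> {[0], [1], [2], [0,1], [0,2], [1,2], [0,1,2]}" by (simp only: increasing_cases)
    then show ?thesis using assms by auto
  qed (use assms in auto)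
qed

section \<open>The contraction of the Cech complex\<close>

text \<open>Sections of \<open>O(n)\<close> over the intersection of the sets \<open>x\<^sub>i \<noteq> 0\<close> with \<open>i\<close> in the list \<open>I\<close>.\<close>

definition is_section :: "3 list \<Rightarrow> int \<Rightarrow> laurent \<Rightarrow> bool" where
  "is_section I n f \<longleftrightarrow> (\<forall>e\<in>keys f. (\<Sum>i\<in>UNIV. e $ i) = n \<and> (\<forall>i. i \<notin> set I \<longrightarrow> e $ i \<ge> 0))"

lemma is_section_0 [simp]: "is_section I n 0"
  by (simp add: is_section_def)
lemma is_section_add: "is_section I n f \<Longrightarrow> is_section I n g \<Longrightarrow> is_section I n (f + g)"
  using keys_add[of f g] unfolding is_section_def by blast
lemma is_section_uminus: "is_section I n f \<Longrightarrow> is_section I n (- f)"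
  by (simp add: is_section_def in_keys_iff)
lemma is_section_diff: "is_section I n f \<Longrightarrow> is_section I n g \<Longrightarrow> is_section I n (f - g)"
  using is_section_add[OF _ is_section_uminus, of I n f g] by simp

text \<open>The homotopy removes the index \<open>k\<close> from the domain of definition.  It yields sections again
  because it only keeps monomials that are regular along \<open>x\<^sub>k = 0\<close>.\<close>

lemma is_section_lead_part:
  assumes "is_section J n f" "set J \<subseteq> insert k (set I)"
  shows "is_section I n (lead_part k f)"
  unfolding is_section_def
proof
  fix e assume "e \<in> keys (lead_part k f)"
  then have "e \<in> keys f" "e $ k \<ge> 0" unfolding keys_restrict lead_index_alt by auto
  then show "(\<Sum>i\<in>UNIV. e $ i) = n \<and> (\<forall>i. i \<notin> set I \<longrightarrow> e $ i \<ge> 0)"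
    using assms unfolding is_section_def by blast
qed
lemma is_section_mono: "is_section I n f \<Longrightarrow> set I \<subseteq> set J \<Longrightarrow> is_section J n f"
  unfolding is_section_def by blast
lemma is_section_mult:
  assumes "is_section I n f" "is_section I m g"
  shows "is_section I (n + m) (f * g)"
  unfolding is_section_def
proof
  fix e assume "e \<in> keys (f * g)"
  then obtain a b where "e = a + b" "a \<in> keys f" "b \<in> keys g" using keys_mult[of f g] by blast
  then show "(\<Sum>i\<in>UNIV. e $ i) = n + m \<and> (\<forall>i. i \<notin> set I \<longrightarrow> e $ i \<ge> 0)"
    using assms by (auto simp: is_section_def sum.distrib)
qed
lemma is_section_Hspace: "n \<ge> 0 \<Longrightarrow> f \<in> Hspace n \<longleftrightarrow> is_section [] n f"
  by (auto simp: Hspace_def Delta_def is_section_def)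
lemma is_section_mult_Hspace:
  "f \<in> Hspace n \<Longrightarrow> n \<ge> 0 \<Longrightarrow> is_section I m g \<Longrightarrow> is_section I (n + m) (f * g)"
  by (rule is_section_mult) (auto simp: is_section_Hspace intro: is_section_mono)

lemma cochains_iff: "\<gamma> \<in> cochains p n \<longleftrightarrow>
  (\<forall>I. \<not> (increasing I \<and> length I = p + 1) \<longrightarrow> \<gamma> I = 0) \<and> (\<forall>I. is_section I n (\<gamma> I))"
  by (simp add: cochains_def is_section_def)

lemma increasing_length:
  "increasing (I :: 3 list) \<and> length I = Suc 0 \<longleftrightarrow> I \<in> {[0], [1], [2]}"
  "increasing (I :: 3 list) \<and> length I = Suc (Suc 0) \<longleftrightarrow> I \<in> {[0,1], [0,2], [1,2]}"
  "increasing (I :: 3 list) \<and> length I = Suc (Suc (Suc 0)) \<longleftrightarrow> I = [0,1,2]"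
  unfolding increasing_cases by auto

lemma cochains_0_iff: "\<gamma> \<in> cochains 0 n \<longleftrightarrow> (\<forall>I. I \<notin> {[0], [1], [2]} \<longrightarrow> \<gamma> I = 0) \<and>
   is_section [0] n (\<gamma> [0]) \<and> is_section [1] n (\<gamma> [1]) \<and> is_section [2] n (\<gamma> [2])"
  unfolding cochains_iff add_0 One_nat_def increasing_length
  by (metis insertCI insertE empty_iff is_section_0)

lemma cochains_1_iff: "\<gamma> \<in> cochains 1 n \<longleftrightarrow> (\<forall>I. I \<notin> {[0,1], [0,2], [1,2]} \<longrightarrow> \<gamma> I = 0) \<and>
   is_section [0,1] n (\<gamma> [0,1]) \<and> is_section [0,2] n (\<gamma> [0,2]) \<and> is_section [1,2] n (\<gamma> [1,2])"
  unfolding cochains_iff One_nat_def add_Suc add_0 increasing_length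
  by (metis insertCI insertE empty_iff is_section_0)

lemma cochains_2_iff: "\<gamma> \<in> cochains 2 n \<longleftrightarrow> (\<forall>I. I \<noteq> [0,1,2] \<longrightarrow> \<gamma> I = 0) \<and>
   is_section [0,1,2] n (\<gamma> [0,1,2])"
  unfolding cochains_iff One_nat_def add_Suc add_0 increasing_length numeral_2_eq_2
  by (metis insertCI insertE empty_iff is_section_0)

lemma cech_diff_add: "cech_diff (\<lambda>I. \<gamma> I + \<gamma>' I) I = cech_diff \<gamma> I + cech_diff \<gamma>' I"
  by (simp add: cech_diff_def distrib_left sum.distrib)
lemma cech_diff_diff: "cech_diff (\<lambda>I. \<gamma> I - \<gamma>' I) I = cech_diff \<gamma> I - cech_diff \<gamma>' I"
  by (simp add: cech_diff_def right_diff_distrib sum_subtractf)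
lemma cech_diff_mult: "cech_diff (\<lambda>I. f * \<gamma> I) I = f * cech_diff \<gamma> I"
  by (simp add: cech_diff_def sum_distrib_left mult.left_commute)
lemmas cech_diff_linear = cech_diff_add cech_diff_diff cech_diff_mult

lemma cochains_add: "\<gamma> \<in> cochains p n \<Longrightarrow> \<gamma>' \<in> cochains p n \<Longrightarrow> (\<lambda>I. \<gamma> I + \<gamma>' I) \<in> cochains p n"
  by (simp add: cochains_iff is_section_add)
lemma cochains_diff: "\<gamma> \<in> cochains p n \<Longrightarrow> \<gamma>' \<in> cochains p n \<Longrightarrow> (\<lambda>I. \<gamma> I - \<gamma>' I) \<in> cochains p n"
  by (simp add: cochains_iff is_section_diff)
lemma cochains_mult: "f \<in> Hspace m \<Longrightarrow> m \<ge> 0 \<Longrightarrow> \<gamma> \<in> cochains p n \<Longrightarrow> k = m + n \<Longrightarrow> (\<lambda>I. f * \<gamma> I) \<in> cochains p k"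
  by (simp add: cochains_iff is_section_mult_Hspace)

lemma cech_diff_outside:
  assumes "\<gamma> \<in> cochains p n" "length I \<noteq> p + 2"
  shows "cech_diff \<gamma> I = 0"
proof -
  have "\<gamma> (take j I @ drop (Suc j) I) = 0" if "j < length I" for j
  proof -
    have "length (take j I @ drop (Suc j) I) \<noteq> p + 1" using assms(2) that by auto
    then show ?thesis using assms(1) by (simp add: cochains_iff)
  qed
  then show ?thesis by (simp add: cech_diff_def)
qed

lemma cech_diff_0: "\<gamma> \<in> cochains 0 n \<Longrightarrow> cech_diff \<gamma> \<in> cochains 1 n"
  using cech_diff_outside[of \<gamma> 0 n] cech_diff_not_increasing[of _ \<gamma>] increasing_length(2)
  unfolding cochains_1_iff
  by (auto simp: cochains_0_iff cech_diff_components intro!: is_section_diff intro: is_section_mono)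

lemma cech_diff_1: "\<gamma> \<in> cochains 1 n \<Longrightarrow> cech_diff \<gamma> \<in> cochains 2 n"
  using cech_diff_outside[of \<gamma> 1 n] cech_diff_not_increasing[of _ \<gamma>] increasing_length(3)
  unfolding cochains_2_iff
  by (auto simp: cochains_1_iff cech_diff_components numeral_3_eq_3 simp del: One_nat_def intro!: is_section_diff is_section_add intro: is_section_mono)

lemma cech_diff_cech_diff:
  assumes "\<gamma> \<in> cochains 0 n"
  shows "cech_diff (cech_diff \<gamma>) I = 0"
proof -
  have "cech_diff (cech_diff \<gamma>) \<in> cochains 2 n" using assms by (intro cech_diff_1 cech_diff_0)
  then show ?thesis by (cases "I = [0,1,2]") (simp_all add: cochains_2_iff cech_diff_components)
qed

lemma lead_part_sum:
  assumes "\<And>e. e \<in> keys f \<Longrightarrow> \<exists>i. e $ i \<ge> 0"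
  shows "lead_part 0 f + lead_part 1 f + lead_part 2 f = f"
proof (rule poly_mapping_eqI)
  fix e
  show "lookup (lead_part 0 f + lead_part 1 f + lead_part 2 f) e = lookup f e"
  proof (cases "e \<in> keys f")
    case True
    with assms have "\<not> (\<forall>i. e $ i < 0)" by (metis not_le)
    then show ?thesis unfolding lookup_add lookup_restrict lead_index_iff by (auto simp: all_3)
  qed (auto simp: lookup_add lookup_restrict in_keys_iff)
qed

lemma neg_part_eq_0_iff: "neg_part f = 0 \<longleftrightarrow> (\<forall>e\<in>keys f. \<exists>i. e $ i \<ge> 0)"
proof
  assume 0: "neg_part f = 0"
  show "\<forall>e\<in>keys f. \<exists>i. e $ i \<ge> 0"
  proof
    fix e assume "e \<in> keys f"
    moreover have "lookup (neg_part f) e = 0" using 0 by simp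
    ultimately show "\<exists>i. e $ i \<ge> 0" by (auto simp: neg_part_def lookup_restrict in_keys_iff not_less split: if_splits)
  qed
next
  assume "\<forall>e\<in>keys f. \<exists>i. e $ i \<ge> 0"
  then show "neg_part f = 0" unfolding neg_part_def by (intro restrict_0I) (metis not_less)
qed

text \<open>The first cohomology of every \<open>O(n)\<close> vanishes: a monomial of a 1-cochain has a nonnegative
  exponent, and on the monomials with \<open>lead_index k\<close> the homotopy is the contraction of the
  simplex to its vertex \<open>k\<close>.\<close>

lemma homotopy_1:
  assumes \<gamma>: "\<gamma> \<in> cochains 1 n" and closed: "\<And>I. cech_diff \<gamma> I = 0"
  shows "homotopy \<gamma> \<in> cochains 0 n" "cech_diff (homotopy \<gamma>) = \<gamma>"
proof -
  have comp: "\<gamma> [0,2] = \<gamma> [0,1] + \<gamma> [1,2]"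
    using closed[of "[0,1,2]"] by (simp add: cech_diff_components algebra_simps)
  have ok: "is_section [0,1] n (\<gamma> [0,1])" "is_section [0,2] n (\<gamma> [0,2])" "is_section [1,2] n (\<gamma> [1,2])"
    using \<gamma> by (auto simp: cochains_1_iff simp del: One_nat_def)
  have "homotopy \<gamma> I = 0" if "I \<notin> {[0],[1],[2]}" for I
  proof (cases "increasing I")
    case True
    with that have "I \<in> {[0,1],[0,2],[1,2],[0,1,2]}" unfolding increasing_cases by auto
    moreover have "\<gamma> [0,1,2] = 0" using \<gamma> by (simp add: cochains_1_iff del: One_nat_def)
    ultimately show ?thesis by (auto simp: homotopy_components)
  qed (rule homotopy_not_increasing)
  moreover have "is_section [0] n (homotopy \<gamma> [0])" "is_section [1] n (homotopy \<gamma> [1])" "is_section [2] n (homotopy \<gamma> [2])"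
    unfolding homotopy_components
    by (intro is_section_add is_section_diff is_section_uminus; (rule is_section_lead_part, rule ok, simp))+
  ultimately show Q: "homotopy \<gamma> \<in> cochains 0 n" unfolding cochains_0_iff by auto
  have parts: "lead_part 0 (\<gamma> [0,1]) + lead_part 1 (\<gamma> [0,1]) + lead_part 2 (\<gamma> [0,1]) = \<gamma> [0,1]"
    "lead_part 0 (\<gamma> [0,2]) + lead_part 1 (\<gamma> [0,2]) + lead_part 2 (\<gamma> [0,2]) = \<gamma> [0,2]"
    "lead_part 0 (\<gamma> [1,2]) + lead_part 1 (\<gamma> [1,2]) + lead_part 2 (\<gamma> [1,2]) = \<gamma> [1,2]"
    using ok by (intro lead_part_sum; fastforce simp: is_section_def all_3)+
  show "cech_diff (homotopy \<gamma>) = \<gamma>"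
  proof
    fix I
    have d: "cech_diff (homotopy \<gamma>) \<in> cochains 1 n" using Q by (rule cech_diff_0)
    show "cech_diff (homotopy \<gamma>) I = \<gamma> I"
    proof (cases "I \<in> {[0,1],[0,2],[1,2]}")
      case False then show ?thesis using d \<gamma> unfolding cochains_1_iff by auto
    next
      case True
      have "cech_diff (homotopy \<gamma>) [0,1] = \<gamma> [0,1]"
        by (subst parts(1)[symmetric]) (simp add: cech_diff_components homotopy_components comp restrict_add)
      moreover have "cech_diff (homotopy \<gamma>) [0,2] = \<gamma> [0,2]"
        by (subst parts(2)[symmetric]) (simp add: cech_diff_components homotopy_components comp restrict_add)
      moreover have "cech_diff (homotopy \<gamma>) [1,2] = \<gamma> [1,2]"
        by (subst parts(3)[symmetric]) (simp add: cech_diff_components homotopy_components comp restrict_add)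
      ultimately show ?thesis using True by auto
    qed
  qed
qed

text \<open>In degree 2 the contraction only fails on the monomials all of whose exponents are negative,
  which form a basis of the second cohomology.\<close>

lemma homotopy_2:
  assumes \<gamma>: "\<gamma> \<in> cochains 2 n" and neg: "neg_part (\<gamma> [0,1,2]) = 0"
  shows "homotopy \<gamma> \<in> cochains 1 n" "cech_diff (homotopy \<gamma>) = \<gamma>"
proof -
  have ok: "is_section [0,1,2] n (\<gamma> [0,1,2])"
    using \<gamma> by (auto simp: cochains_2_iff)
  have z: "\<gamma> [0,1] = 0" "\<gamma> [0,2] = 0" "\<gamma> [1,2] = 0" using \<gamma> by (auto simp: cochains_2_iff)
  have "homotopy \<gamma> I = 0" if "I \<notin> {[0,1],[0,2],[1,2]}" for I
  proof (cases "increasing I")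
    case True
    with that have "I \<in> {[0],[1],[2],[0,1,2]}" unfolding increasing_cases by auto
    then show ?thesis by (auto simp: homotopy_components z)
  qed (rule homotopy_not_increasing)
  moreover have "is_section [0,1] n (homotopy \<gamma> [0,1]) \<and> is_section [0,2] n (homotopy \<gamma> [0,2]) \<and> is_section [1,2] n (homotopy \<gamma> [1,2])"
    unfolding homotopy_components
    by (intro conjI is_section_uminus; (rule is_section_lead_part, rule ok, simp))
  ultimately show Q: "homotopy \<gamma> \<in> cochains 1 n" unfolding cochains_1_iff by auto
  have d: "cech_diff (homotopy \<gamma>) \<in> cochains 2 n" using Q by (rule cech_diff_1)
  have "cech_diff (homotopy \<gamma>) [0,1,2] = \<gamma> [0,1,2]"
    unfolding cech_diff_components homotopy_components
    using lead_part_sum[of "\<gamma> [0,1,2]"] neg by (simp add: neg_part_eq_0_iff)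
  then show "cech_diff (homotopy \<gamma>) = \<gamma>"
    using d \<gamma> unfolding cochains_2_iff by (intro ext) metis
qed

text \<open>The local sections of a 0-cocycle agree, so they have no pole along any of the three lines.\<close>

lemma closed_0_cochain:
  assumes "\<gamma> \<in> cochains 0 n" "\<And>I. cech_diff \<gamma> I = 0"
  shows "\<gamma> [0] = \<gamma> [2]" "\<gamma> [1] = \<gamma> [2]" "is_section [] n (\<gamma> [2])"
proof -
  show e: "\<gamma> [0] = \<gamma> [2]" "\<gamma> [1] = \<gamma> [2]"
    using assms(2)[of "[0,2]"] assms(2)[of "[1,2]"] by (simp_all add: cech_diff_components)
  show "is_section [] n (\<gamma> [2])"
    using assms(1) unfolding cochains_0_iff e by (auto simp: is_section_def all_3)
qed

lemma closed_0_cochain_neg: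
  assumes "\<gamma> \<in> cochains 0 n" "\<And>I. cech_diff \<gamma> I = 0" "n < 0"
  shows "\<gamma> [2] = 0"
proof -
  have "keys (\<gamma> [2]) = {}"
  proof (rule ccontr)
    assume "keys (\<gamma> [2]) \<noteq> {}"
    then obtain e where "e \<in> keys (\<gamma> [2])" by blast
    then have "(\<Sum>i\<in>UNIV. e $ i) = n" "\<forall>i. e $ i \<ge> 0" using closed_0_cochain[OF assms(1,2)] by (auto simp: is_section_def)
    then show False using \<open>n < 0\<close> by (metis sum_nonneg not_less)
  qed
  then show ?thesis by simp
qed

section \<open>Products with global sections\<close>

lemma Hspace_nonneg: "f \<in> Hspace n \<Longrightarrow> n \<ge> 0 \<Longrightarrow> e \<in> keys f \<Longrightarrow> e $ i \<ge> 0"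
  by (auto simp: Hspace_def Delta_def)
lemma Hspace_neg: "f \<in> Hspace n \<Longrightarrow> n < 0 \<Longrightarrow> e \<in> keys f \<Longrightarrow> e $ i < 0"
  by (auto simp: Hspace_def Delta_def)

lemma nonneg_part_Hspace: "f \<in> Hspace n \<Longrightarrow> n \<ge> 0 \<Longrightarrow> nonneg_part f = f"
  unfolding nonneg_part_def by (rule restrict_id) (auto dest: Hspace_nonneg)
lemma neg_part_Hspace: "f \<in> Hspace n \<Longrightarrow> n \<ge> 0 \<Longrightarrow> neg_part f = 0"
  unfolding neg_part_def by (rule restrict_0I) (meson Hspace_nonneg not_less)
lemma nonneg_part_Hspace_neg: "f \<in> Hspace n \<Longrightarrow> n < 0 \<Longrightarrow> nonneg_part f = 0"
  unfolding nonneg_part_def by (rule restrict_0I) (meson Hspace_neg not_less)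
lemma neg_part_Hspace_neg: "f \<in> Hspace n \<Longrightarrow> n < 0 \<Longrightarrow> neg_part f = f"
  unfolding neg_part_def by (rule restrict_id) (auto dest: Hspace_neg)

lemma incl_Hspace: "f \<in> Hspace n \<Longrightarrow> n \<ge> 0 \<Longrightarrow> incl f I = (if length I = 1 then f else 0)"
  by (simp add: incl_def nonneg_part_Hspace neg_part_Hspace)
lemma incl_Hspace_neg: "f \<in> Hspace n \<Longrightarrow> n < 0 \<Longrightarrow> incl f I = (if I = [0,1,2] then f else 0)"
  by (simp add: incl_def nonneg_part_Hspace_neg neg_part_Hspace_neg)

lemma cup_incl_left:
  assumes "s \<in> Hspace n" "n \<ge> 0" "\<gamma> [] = 0"
  shows "cup (incl s) \<gamma> = (\<lambda>I. s * \<gamma> I)"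
proof
  fix I :: "3 list"
  have "incl s (take (Suc j) I) * \<gamma> (drop j I) = (if j = 0 then s * \<gamma> I else 0)" if "j < length I" for j
    using that assms by (auto simp: incl_Hspace)
  then have "cup (incl s) \<gamma> I = (\<Sum>j<length I. if j = 0 then s * \<gamma> I else 0)"
    by (simp add: cup_def)
  then show "cup (incl s) \<gamma> I = s * \<gamma> I" using assms(3) by (cases "I = []") (auto simp: sum.delta')
qed

lemma cup_incl_right:
  assumes "s \<in> Hspace n" "n \<ge> 0" "\<gamma> [] = 0"
  shows "cup \<gamma> (incl s) = (\<lambda>I. s * \<gamma> I)"
proof
  fix I :: "3 list"
  have "\<gamma> (take (Suc j) I) * incl s (drop j I) = (if j = length I - 1 then s * \<gamma> I else 0)" if "j < length I" for j
    using that assms by (auto simp: incl_Hspace)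
  then have "cup \<gamma> (incl s) I = (\<Sum>j<length I. if j = length I - 1 then s * \<gamma> I else 0)"
    by (simp add: cup_def)
  then show "cup \<gamma> (incl s) I = s * \<gamma> I" using assms(3) by (cases "I = []") (auto simp: sum.delta')
qed

lemma homotopy_Nil [simp]: "homotopy \<gamma> [] = 0" by (simp add: homotopy_def)
lemma incl_Nil [simp]: "incl e [] = 0" by (simp add: incl_def)
lemma cochains_Nil: "\<gamma> \<in> cochains p n \<Longrightarrow> \<gamma> [] = 0" by (simp add: cochains_iff)

lemma cup_01:
  assumes "m \<in> cochains 0 a" "\<phi> \<in> cochains 1 b"
  shows "cup m \<phi> I = (if I = [0,1] then m [0] * \<phi> [0,1] else if I = [0,2] then m [0] * \<phi> [0,2]
     else if I = [1,2] then m [1] * \<phi> [1,2] else 0)"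
proof (cases I)
  case Nil then show ?thesis by (simp add: cup_def)
next
  case (Cons i J)
  have 1: "m (take (Suc j) I) * \<phi> (drop j I) = (if j = 0 then m [i] * \<phi> I else 0)" if "j < length I" for j
  proof (cases "j = 0")
    case False
    then have "length (take (Suc j) I) \<noteq> 1" using that Cons by auto
    then have "m (take (Suc j) I) = 0" using assms(1) by (simp add: cochains_iff)
    then show ?thesis using False by simp
  qed (simp add: Cons)
  have "cup m \<phi> I = (\<Sum>j<length I. if j = 0 then m [i] * \<phi> I else 0)"
    unfolding cup_def by (rule sum.cong) (use 1 in auto)
  also have "\<dots> = m [i] * \<phi> I" by (simp add: Cons sum.delta')
  finally show ?thesis using assms(2) Cons unfolding cochains_1_iff by auto
qed

lemma cup_01_cochains:
  assumes "m \<in> cochains 0 a" "\<phi> \<in> cochains 1 b"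
  shows "cup m \<phi> \<in> cochains 1 (a + b)"
proof -
  have m: "is_section [0] a (m [0])" "is_section [1] a (m [1])" using assms(1) unfolding cochains_0_iff by auto
  have p: "is_section [0,1] b (\<phi> [0,1])" "is_section [0,2] b (\<phi> [0,2])" "is_section [1,2] b (\<phi> [1,2])"
    using assms(2) unfolding cochains_1_iff by auto
  show ?thesis unfolding cochains_1_iff cup_01[OF assms]
    using is_section_mult[OF is_section_mono[OF m(1), of "[0,1]"] p(1)] is_section_mult[OF is_section_mono[OF m(1), of "[0,2]"] p(2)]
      is_section_mult[OF is_section_mono[OF m(2), of "[1,2]"] p(3)] by auto
qed

section \<open>The trace on a plane cubic\<close>

definition residue :: "cochain \<Rightarrow> complex" where
  "residue \<gamma> = lookup (\<gamma> [0,1,2]) minus_one_vec"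

text \<open>The connecting map from the first cohomology of \<open>O\<^sub>C\<close> to the second cohomology of \<open>O(-3)\<close>,
  which comes from multiplication by \<open>F\<close>, followed by \<open>residue\<close>.\<close>

definition curve_trace :: "laurent \<Rightarrow> cochain \<Rightarrow> complex" where
  "curve_trace F \<gamma> = residue (SOME \<delta>. \<delta> \<in> cochains 2 (- 3) \<and> (\<forall>I. cech_diff \<gamma> I = F * \<delta> I))"

text \<open>A component of a 1-cochain is regular along one of the three lines, so \<open>1/(x\<^sub>0 x\<^sub>1 x\<^sub>2)\<close> does not
  occur in it.\<close>

lemma residue_coboundary: "\<eta> \<in> cochains 1 n \<Longrightarrow> residue (cech_diff \<eta>) = 0"
proof -
  assume \<eta>: "\<eta> \<in> cochains 1 n"
  have "lookup f minus_one_vec = 0" if "is_section I n f" "i \<notin> set I" for I f i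
  proof (rule ccontr)
    assume "lookup f minus_one_vec \<noteq> 0"
    then have "minus_one_vec \<in> keys f" by (simp add: in_keys_iff)
    then show False using that by (auto simp: is_section_def minus_one_vec_def)
  qed
  from this[of "[0,1]" _ 2] this[of "[0,2]" _ 1] this[of "[1,2]" _ 0]
  show ?thesis using \<eta> unfolding cochains_1_iff
    by (simp add: residue_def cech_diff_components lookup_add lookup_minus)
qed

lemma mult_left_cancel_laurent: "F \<noteq> 0 \<Longrightarrow> F * f = F * g \<longleftrightarrow> f = (g :: laurent)"
  using laurent_no_zero_divisors[of F "f - g"] by (auto simp: right_diff_distrib)

lemma curve_trace_eq:
  assumes "F \<noteq> 0" "\<delta> \<in> cochains 2 (- 3)" "\<And>I. cech_diff \<gamma> I = F * \<delta> I"
  shows "curve_trace F \<gamma> = residue \<delta>"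
proof -
  have "(SOME \<delta>. \<delta> \<in> cochains 2 (- 3) \<and> (\<forall>I. cech_diff \<gamma> I = F * \<delta> I)) = \<delta>"
    using assms by (intro some_equality) (auto simp: mult_left_cancel_laurent fun_eq_iff)
  then show ?thesis by (simp add: curve_trace_def)
qed

lemma curve_cocycles_iff:
  "\<gamma> \<in> curve_cocycles F 1 n \<longleftrightarrow> \<gamma> \<in> cochains 1 n \<and> (\<exists>\<delta>\<in>cochains 2 (n - 3). \<forall>I. cech_diff \<gamma> I = F * \<delta> I)"
  by (simp add: curve_cocycles_def cong_mod_def numeral_2_eq_2)

lemma serre_pairing_lookup: "serre_pairing s e = lookup (s * e) minus_one_vec"
proof -
  have "serre_pairing s e = (\<Sum>a\<in>keys s. lookup s a * lookup e (minus_one_vec - a))"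
    unfolding serre_pairing_def
  proof (rule sum.cong)
    fix a
    have "a + x = minus_one_vec \<longleftrightarrow> minus_one_vec - a = x" for x by (auto simp: algebra_simps)
    then have "(\<Sum>\<alpha>\<in>keys e. lookup s a * lookup e \<alpha> * (if a + \<alpha> = minus_one_vec then 1 else 0)) =
       (\<Sum>\<alpha>\<in>keys e. if minus_one_vec - a = \<alpha> then lookup s a * lookup e \<alpha> else 0)"
      by (intro sum.cong) auto
    also have "\<dots> = lookup s a * lookup e (minus_one_vec - a)" by (auto simp: sum.delta' in_keys_iff)
    finally show "(\<Sum>\<alpha>\<in>keys e. lookup s a * lookup e \<alpha> * (if a + \<alpha> = minus_one_vec then 1 else 0)) =
       lookup s a * lookup e (minus_one_vec - a)" .
  qed simp
  then show ?thesis by (simp add: lookup_mult)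
qed

lemma serre_pairing_residue: "serre_pairing s (\<delta> [0,1,2]) = residue (\<lambda>I. s * \<delta> I)"
  by (simp add: residue_def serre_pairing_lookup)

lemma serre_pairing_diff: "serre_pairing (f - g) e = serre_pairing f e - serre_pairing g e"
  by (simp add: serre_pairing_lookup left_diff_distrib lookup_minus)
lemma serre_pairing_diff_right: "serre_pairing f (e - e') = serre_pairing f e - serre_pairing f e'"
  by (simp add: serre_pairing_lookup right_diff_distrib lookup_minus)
lemma serre_pairing_add: "serre_pairing (f + g) e = serre_pairing f e + serre_pairing g e"
  by (simp add: serre_pairing_lookup distrib_right lookup_add)
lemma serre_pairing_const: "serre_pairing (const c * f) e = c * serre_pairing f e"
  by (simp add: serre_pairing_lookup lookup_const_mult mult.assoc)
lemma serre_pairing_xmon: "serre_pairing (xmon a) e = lookup e (minus_one_vec - a)"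
  by (simp add: serre_pairing_lookup lookup_mult xmon_def)

text \<open>Half of Serre duality: a negative exponent of degree \<open>-5\<close> is paired with the quadratic monomial
  complementary to it.\<close>

lemma serre_pairing_perfect:
  assumes "is_section I (- 5) f" "\<And>s. s \<in> Hspace 2 \<Longrightarrow> serre_pairing s f = 0"
  shows "neg_part f = 0"
  unfolding neg_part_eq_0_iff
proof (rule ballI, rule ccontr)
  fix e assume e: "e \<in> keys f" and "\<nexists>i. e $ i \<ge> 0"
  then have neg: "\<And>i. e $ i < 0" by (meson not_less)
  have "(\<Sum>i\<in>UNIV. e $ i) = - 5" using e assms(1) by (auto simp: is_section_def)
  moreover have "e $ i \<le> - 1" for i using neg[of i] by simp
  ultimately have "minus_one_vec - e \<in> Delta 2"
    by (auto simp: Delta_def minus_one_vec_def sum_3)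
  then have "xmon (minus_one_vec - e) \<in> Hspace 2" by (simp add: xmon_def Hspace_def)
  from assms(2)[OF this] have "lookup f e = 0" by (simp add: serre_pairing_xmon)
  with e show False by (simp add: in_keys_iff)
qed

section \<open>Massey products\<close>

locale massey_setup =
  fixes F s t e :: laurent
  assumes F: "F \<in> Hspace 3" "F \<noteq> 0" and s: "s \<in> Hspace 2" and t: "t \<in> Hspace 2"
    and perp: "serre_pairing s e = 0" "serre_pairing t e = 0"
begin

text \<open>The data of a Massey product, with the congruences modulo \<open>F\<close> made explicit: \<open>\<delta>\<close> is the image
  of the cocycle \<open>\<phi>\<close> under the connecting map and represents \<open>e\<close>, while \<open>h1\<close> and \<open>h2\<close> are
  null-homotopies on the curve of \<open>s * \<phi>\<close> and \<open>t * \<phi>\<close>.\<close>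

definition massey_data ::
  "cochain \<Rightarrow> cochain \<Rightarrow> cochain \<Rightarrow> cochain \<Rightarrow> cochain \<Rightarrow> cochain \<Rightarrow> bool" where
  "massey_data \<phi> \<delta> h1 h2 \<psi>1 \<psi>2 \<longleftrightarrow>
     \<phi> \<in> cochains 1 (- 2) \<and> \<delta> \<in> cochains 2 (- 5) \<and> h1 \<in> cochains 0 0 \<and> h2 \<in> cochains 0 0 \<and>
     \<psi>1 \<in> cochains 1 (- 3) \<and> \<psi>2 \<in> cochains 1 (- 3) \<and>
     (\<forall>I. cech_diff \<phi> I = F * \<delta> I) \<and>
     (\<forall>u\<in>Hspace 2. residue (\<lambda>I. u * \<delta> I) = serre_pairing u e) \<and>
     (\<forall>I. cech_diff h1 I = s * \<phi> I - F * \<psi>1 I) \<and> (\<forall>I. cech_diff h2 I = t * \<phi> I - F * \<psi>2 I)"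

text \<open>Apply the differential to the equations for \<open>h1\<close> and \<open>h2\<close> and cancel \<open>F\<close>.\<close>

lemma massey_data_closed:
  assumes "massey_data \<phi> \<delta> h1 h2 \<psi>1 \<psi>2"
  shows "cech_diff \<psi>1 I = s * \<delta> I" "cech_diff \<psi>2 I = t * \<delta> I"
proof -
  have *: "cech_diff \<psi> I = u * \<delta> I"
    if "h \<in> cochains 0 0" "\<And>I. cech_diff h I = u * \<phi> I - F * \<psi> I" for h u \<psi>
  proof -
    have "cech_diff h = (\<lambda>I. u * \<phi> I - F * \<psi> I)" using that(2) by blast
    then have "cech_diff (\<lambda>I. u * \<phi> I - F * \<psi> I) I = 0" using cech_diff_cech_diff[OF that(1)] by metis
    then have "F * cech_diff \<psi> I = F * (u * \<delta> I)"
      using assms by (simp add: cech_diff_linear massey_data_def algebra_simps)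
    then show ?thesis using F(2) by (simp add: mult_left_cancel_laurent)
  qed
  have "h1 \<in> cochains 0 0" "\<And>I. cech_diff h1 I = s * \<phi> I - F * \<psi>1 I"
    "h2 \<in> cochains 0 0" "\<And>I. cech_diff h2 I = t * \<phi> I - F * \<psi>2 I"
    using assms unfolding massey_data_def by blast+
  then show "cech_diff \<psi>1 I = s * \<delta> I" "cech_diff \<psi>2 I = t * \<delta> I"
    using * by blast+
qed

text \<open>The representative \<open>s * h2 - t * h1\<close> of the Massey product is a cocycle only modulo \<open>F\<close>.  Its
  differential is \<open>F\<close> times a 1-cocycle of \<open>O(-1)\<close>, hence \<open>F\<close> times a coboundary, so a multiple of
  \<open>F\<close> turns the representative into a global section \<open>m'\<close> on the plane.\<close>

lemma massey_decomposition:
  assumes "massey_data \<phi> \<delta> h1 h2 \<psi>1 \<psi>2" and g: "g = homotopy (\<lambda>I. t * \<psi>1 I - s * \<psi>2 I)"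
    and m': "m' = s * h2 [2] - t * h1 [2] - F * g [2]"
  shows "g \<in> cochains 0 (- 1)" "cech_diff g I = t * \<psi>1 I - s * \<psi>2 I" "m' \<in> Hspace 2"
    "length I = 1 \<Longrightarrow> s * h2 I - t * h1 I = m' + F * g I"
proof -
  note D = assms(1)[unfolded massey_data_def]
  have c: "(\<lambda>I. t * \<psi>1 I - s * \<psi>2 I) \<in> cochains 1 (- 1)"
    using D s t by (intro cochains_diff) (auto intro: cochains_mult[of _ 2])
  have "cech_diff (\<lambda>I. t * \<psi>1 I - s * \<psi>2 I) I = 0" for I
    by (simp add: cech_diff_linear massey_data_closed[OF assms(1)])
  from homotopy_1[OF c this] show g': "g \<in> cochains 0 (- 1)" "cech_diff g I = t * \<psi>1 I - s * \<psi>2 I" for I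
    unfolding g by auto
  define k where "k = (\<lambda>I. (s * h2 I - t * h1 I) - F * g I)"
  have k: "k \<in> cochains 0 2" unfolding k_def
    using D s t F g' by (intro cochains_diff) (auto intro: cochains_mult[of _ 2] cochains_mult[of _ 3])
  have dk: "cech_diff k I = 0" for I
  proof -
    have dh: "cech_diff h1 I = s * \<phi> I - F * \<psi>1 I" "cech_diff h2 I = t * \<phi> I - F * \<psi>2 I" using D by blast+
    show ?thesis unfolding k_def cech_diff_linear g' dh by (simp add: algebra_simps)
  qed
  show "m' \<in> Hspace 2" using closed_0_cochain(3)[OF k dk] by (simp add: is_section_Hspace k_def m')
  assume "length I = 1"
  then have "I \<in> {[0],[1],[2]}" using all_3[of "\<lambda>i. i = 0 \<or> i = 1 \<or> i = 2"] by (auto simp: length_Suc_conv)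
  then have "k I = m'" using closed_0_cochain(1,2)[OF k dk] by (auto simp: k_def m')
  then show "s * h2 I - t * h1 I = m' + F * g I" by (auto simp: k_def algebra_simps)
qed

text \<open>With the decomposition \<open>m' + F * g\<close> of the representative, the differential of its product with
  \<open>\<phi>\<close> is \<open>F * (m' * \<delta> + d (g * \<phi>))\<close>, and a coboundary has no residue.\<close>

lemma trace_massey:
  assumes "massey_data \<phi> \<delta> h1 h2 \<psi>1 \<psi>2" and g: "g = homotopy (\<lambda>I. t * \<psi>1 I - s * \<psi>2 I)"
    and m': "m' = s * h2 [2] - t * h1 [2] - F * g [2]"
  shows "curve_trace F (cup (\<lambda>I. s * h2 I - t * h1 I) \<phi>) = serre_pairing m' e"
proof -
  note D = assms(1)[unfolded massey_data_def]
  note G = massey_decomposition[OF assms]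
  let ?m = "\<lambda>I. s * h2 I - t * h1 I"
  have m: "?m \<in> cochains 0 2" using D s t by (intro cochains_diff) (auto intro: cochains_mult[of _ 2])
  have \<phi>: "\<phi> \<in> cochains 1 (- 2)" using D by blast
  have split: "cup ?m \<phi> = (\<lambda>I. m' * \<phi> I + F * cup g \<phi> I)"
  proof
    fix I show "cup ?m \<phi> I = m' * \<phi> I + F * cup g \<phi> I"
      unfolding cup_01[OF m \<phi>] cup_01[OF G(1) \<phi>] using G(4)[of "[0]"] G(4)[of "[1]"] \<phi>
      by (auto simp: cochains_1_iff algebra_simps simp del: One_nat_def)
  qed
  have c: "cup g \<phi> \<in> cochains 1 (- 3)" using cup_01_cochains[OF G(1) \<phi>] by simp
  have "curve_trace F (cup ?m \<phi>) = residue (\<lambda>I. m' * \<delta> I + cech_diff (cup g \<phi>) I)"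
  proof (rule curve_trace_eq)
    show "(\<lambda>I. m' * \<delta> I + cech_diff (cup g \<phi>) I) \<in> cochains 2 (- 3)"
      using D by (intro cochains_add cech_diff_1 c cochains_mult[OF G(3)]) auto
    show "cech_diff (cup ?m \<phi>) I = F * (m' * \<delta> I + cech_diff (cup g \<phi>) I)" for I
      using D unfolding split cech_diff_linear by (simp add: algebra_simps)
  qed (rule F)
  also have "\<dots> = residue (\<lambda>I. m' * \<delta> I) + residue (cech_diff (cup g \<phi>))"
    by (simp add: residue_def lookup_add)
  also have "\<dots> = serre_pairing m' e"
    using residue_coboundary[OF c] D G(3) by simp
  finally show ?thesis .
qed

text \<open>By Serre duality two cocycles representing \<open>e\<close> differ by \<open>F * \<eta> + d k\<close>.  This difference
  propagates to the null-homotopies, the remaining freedom there being constants \<open>c1\<close> and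
  \<open>c2\<close> and multiples of \<open>F\<close>.  All of it cancels in \<open>m - m'\<close> except \<open>c2 * s - c1 * t\<close>, which is
  orthogonal to \<open>e\<close>.\<close>

lemma massey_value_unique:
  assumes "massey_data \<phi> \<delta> h1 h2 \<psi>1 \<psi>2" and g: "g = homotopy (\<lambda>I. t * \<psi>1 I - s * \<psi>2 I)"
    and m: "m = s * h2 [2] - t * h1 [2] - F * g [2]"
    and "massey_data \<phi>' \<delta>' h1' h2' \<psi>1' \<psi>2'" and g': "g' = homotopy (\<lambda>I. t * \<psi>1' I - s * \<psi>2' I)"
    and m': "m' = s * h2' [2] - t * h1' [2] - F * g' [2]"
  shows "serre_pairing m e = serre_pairing m' e"
proof -
  note D = assms(1)[unfolded massey_data_def] and D' = assms(4)[unfolded massey_data_def]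
  note G = massey_decomposition[OF assms(1-3)] and G' = massey_decomposition[OF assms(4-6)]
  note C = massey_data_closed[OF assms(1)] and C' = massey_data_closed[OF assms(4)]
  have \<Delta>: "(\<lambda>I. \<delta> I - \<delta>' I) \<in> cochains 2 (- 5)" using D D' by (intro cochains_diff) auto
  have "neg_part (\<delta> [0,1,2] - \<delta>' [0,1,2]) = 0"
  proof (rule serre_pairing_perfect)
    show "is_section [0,1,2] (- 5) (\<delta> [0,1,2] - \<delta>' [0,1,2])" using \<Delta> by (simp add: cochains_2_iff)
    fix u assume "u \<in> Hspace 2"
    then show "serre_pairing u (\<delta> [0,1,2] - \<delta>' [0,1,2]) = 0"
      using D D' by (simp add: serre_pairing_diff_right serre_pairing_residue)
  qed
  from homotopy_2[OF \<Delta> this] obtain \<eta> where \<eta>: "\<eta> \<in> cochains 1 (- 5)" "\<And>I. cech_diff \<eta> I = \<delta> I - \<delta>' I"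
    by simp
  have c\<phi>: "(\<lambda>I. (\<phi> I - \<phi>' I) - F * \<eta> I) \<in> cochains 1 (- 2)"
    using D D' \<eta> F by (intro cochains_diff) (auto intro: cochains_mult[of _ 3])
  have d0: "cech_diff (\<lambda>I. (\<phi> I - \<phi>' I) - F * \<eta> I) I = 0" for I
  proof -
    have d\<phi>: "cech_diff \<phi> I = F * \<delta> I" "cech_diff \<phi>' I = F * \<delta>' I" using D D' by blast+
    show ?thesis unfolding cech_diff_linear \<eta>(2) d\<phi> by (simp add: algebra_simps)
  qed
  obtain k where k: "k \<in> cochains 0 (- 2)" "\<And>I. cech_diff k I = \<phi> I - \<phi>' I - F * \<eta> I"
    using homotopy_1[OF c\<phi> d0] by simp
  have *: "\<exists>\<kappa> c. \<kappa> \<in> cochains 0 (- 3) \<and> (\<forall>I. cech_diff \<kappa> I = \<psi> I - \<psi>' I - u * \<eta> I) \<and>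
      h [2] - h' [2] = u * k [2] - F * \<kappa> [2] + const c"
    if u: "u \<in> Hspace 2" and h: "h \<in> cochains 0 0" "h' \<in> cochains 0 0" and \<psi>: "\<psi> \<in> cochains 1 (- 3)" "\<psi>' \<in> cochains 1 (- 3)"
      and dh: "\<forall>I. cech_diff h I = u * \<phi> I - F * \<psi> I" "\<forall>I. cech_diff h' I = u * \<phi>' I - F * \<psi>' I"
      and d\<psi>: "\<And>I. cech_diff \<psi> I = u * \<delta> I" "\<And>I. cech_diff \<psi>' I = u * \<delta>' I" for u h h' \<psi> \<psi>'
  proof -
    have c\<psi>: "(\<lambda>I. (\<psi> I - \<psi>' I) - u * \<eta> I) \<in> cochains 1 (- 3)"
      using \<psi> \<eta> u by (intro cochains_diff) (auto intro: cochains_mult[of _ 2])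
    have d0: "cech_diff (\<lambda>I. (\<psi> I - \<psi>' I) - u * \<eta> I) I = 0" for I
      unfolding cech_diff_linear \<eta>(2) d\<psi> by (simp add: algebra_simps)
    obtain \<kappa> where \<kappa>: "\<kappa> \<in> cochains 0 (- 3)" "\<And>I. cech_diff \<kappa> I = \<psi> I - \<psi>' I - u * \<eta> I"
      using homotopy_1[OF c\<psi> d0] by simp
    \<comment> \<open>a global function, hence constant\<close>
    define r where "r = (\<lambda>I. ((h I - h' I) - u * k I) + F * \<kappa> I)"
    have r: "r \<in> cochains 0 0" unfolding r_def using h u k \<kappa> F
      by (intro cochains_diff cochains_add) (auto intro: cochains_mult[of _ 2] cochains_mult[of _ 3])
    have dr: "cech_diff r I = 0" for I
      unfolding r_def cech_diff_linear k(2) \<kappa>(2) dh[rule_format] by (simp add: algebra_simps)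
    have "is_section [] 0 (r [2])" by (rule closed_0_cochain(3)[OF r dr])
    then have "e = 0" if "e \<in> keys (r [2])" for e
      using that sum_nonneg_eq_0_iff[of UNIV "\<lambda>i. e $ i"] by (auto simp: is_section_def vec_eq_iff)
    then have "r [2] = const (lookup (r [2]) 0)"
      unfolding const_def by (intro poly_mapping_eqI) (auto simp: lookup_single when_def in_keys_iff)
    then have "h [2] - h' [2] = u * k [2] - F * \<kappa> [2] + const (lookup (r [2]) 0)"
      by (simp add: r_def algebra_simps)
    with \<kappa> show ?thesis by blast
  qed
  obtain \<kappa>1 c1 where 1: "\<kappa>1 \<in> cochains 0 (- 3)" "\<And>I. cech_diff \<kappa>1 I = \<psi>1 I - \<psi>1' I - s * \<eta> I"
      "h1 [2] - h1' [2] = s * k [2] - F * \<kappa>1 [2] + const c1"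
    using *[of s h1 h1' \<psi>1 \<psi>1'] s D D' C C' by blast
  obtain \<kappa>2 c2 where 2: "\<kappa>2 \<in> cochains 0 (- 3)" "\<And>I. cech_diff \<kappa>2 I = \<psi>2 I - \<psi>2' I - t * \<eta> I"
      "h2 [2] - h2' [2] = t * k [2] - F * \<kappa>2 [2] + const c2"
    using *[of t h2 h2' \<psi>2 \<psi>2'] t D D' C C' by blast
  \<comment> \<open>a global section of \<open>O(-1)\<close>, hence zero\<close>
  define l where "l = (\<lambda>I. (g I - g' I) - (t * \<kappa>1 I - s * \<kappa>2 I))"
  have l: "l \<in> cochains 0 (- 1)" unfolding l_def using G G' 1 2 s t
    by (intro cochains_diff) (auto intro: cochains_mult[of _ 2])
  have "cech_diff l I = 0" for I
    unfolding l_def cech_diff_linear G G' 1 2 by (simp add: algebra_simps)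
  from closed_0_cochain_neg[OF l this] have gg: "g [2] - g' [2] = t * \<kappa>1 [2] - s * \<kappa>2 [2]" by (simp add: l_def)
  have mm: "m - m' = s * (h2 [2] - h2' [2]) - t * (h1 [2] - h1' [2]) - F * (g [2] - g' [2])"
    by (simp add: m m' algebra_simps)
  have "m - m' = const c2 * s - const c1 * t"
    unfolding mm gg 1(3) 2(3) by (simp add: algebra_simps)
  then have "serre_pairing m e - serre_pairing m' e = 0"
    unfolding serre_pairing_diff[symmetric] by (simp add: serre_pairing_diff serre_pairing_const perp)
  then show ?thesis by simp
qed

end

section \<open>The bivector as an antisymmetrization\<close>

definition top_cochain :: "laurent \<Rightarrow> cochain" where
  "top_cochain e I = (if I = [0,1,2] then e else 0)"

definition zigzag :: "laurent \<Rightarrow> laurent \<Rightarrow> laurent \<Rightarrow> laurent \<Rightarrow> laurent" where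
  "zigzag e x y z = proj (\<lambda>I. z * homotopy (\<lambda>I. y * homotopy (\<lambda>I. x * top_cochain e I) I) I)"

lemma top_cochain: "e \<in> Hspace n \<Longrightarrow> n < 0 \<Longrightarrow> incl e = top_cochain e"
  by (rule ext) (simp add: incl_Hspace_neg top_cochain_def)
lemma top_cochain_cochains: "e \<in> Hspace n \<Longrightarrow> top_cochain e \<in> cochains 2 n"
  by (auto simp: cochains_2_iff top_cochain_def is_section_def Hspace_def Delta_def all_3
      dest!: subsetD)

text \<open>The product of two classes of degree 0 has degree 0, and there is nothing below to map to.\<close>

lemma homotopy_incl_incl:
  assumes "x \<in> Hspace a" "a \<ge> 0" "y \<in> Hspace b" "b \<ge> 0"
  shows "homotopy (cup (incl x) (incl y)) = (\<lambda>I. 0)"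
proof -
  have "cup (incl x) (incl y) I = 0" if "length I \<noteq> 1" for I
    using that assms by (simp add: cup_incl_left incl_Hspace)
  then show ?thesis
    by (intro cochain_eqI) (simp_all add: homotopy_not_increasing homotopy_components)
qed

lemma proj_0: "proj (\<lambda>I. 0) = 0" by (simp add: proj_def nonneg_part_def neg_part_def)
lemma homotopy_0: "homotopy (\<lambda>I. 0) = (\<lambda>I. 0)"
  by (intro cochain_eqI) (simp_all add: homotopy_not_increasing homotopy_components)

lemma cup_zero_left: "cup (\<lambda>I. 0) \<gamma> = (\<lambda>I. 0)" by (rule ext) (simp add: cup_def)

text \<open>Of the four bracketings the first one begins with the product of two sections and vanishes.  In
  the other three, each section is multiplied onto the cochain that grows out of \<open>e\<close>, and
  the side on which this happens is irrelevant.\<close>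

lemma m4_eq:
  assumes xy: "x \<in> Hspace a" "a \<ge> 0" "y \<in> Hspace b" "b \<ge> 0" and w: "w \<in> Hspace c" "c \<ge> 0" and e: "e \<in> Hspace n" "n < 0"
  shows "m4 x y e w = zigzag e y x w - zigzag e y w x + zigzag e w y x"
proof -
  have T: "top_cochain e [] = 0" by (simp add: top_cochain_def)
  show ?thesis unfolding m4_def zigzag_def homotopy_incl_incl[OF xy] cup_zero_left homotopy_0 proj_0
    by (simp add: top_cochain[OF e] T
      cup_incl_left[OF xy(1,2)] cup_incl_left[OF xy(3,4)] cup_incl_right[OF w])
qed

lemma Pi_F_zigzag:
  assumes "F \<in> Hspace 3" "s \<in> Hspace 2" "t \<in> Hspace 2" "e \<in> V"
  shows "Pi_F F e s t = serre_pairing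
    (zigzag e s F t - zigzag e s t F + zigzag e t s F - zigzag e F s t + zigzag e F t s - zigzag e t F s) e"
  using assms by (simp add: Pi_F_def m4_eq[of F 3 s 2 t 2 e "-5"] m4_eq[of s 2 F 3 t 2 e "-5"] algebra_simps)

section \<open>The Feigin--Odesskii bracket\<close>

lemma homotopy_diff: "homotopy (\<lambda>I. \<gamma> I - \<gamma>' I) I = homotopy \<gamma> I - homotopy \<gamma>' I"
proof -
  have "alt_component (\<lambda>I. \<gamma> I - \<gamma>' I) J = alt_component \<gamma> J - alt_component \<gamma>' J" for J
    by (simp add: alt_component_def right_diff_distrib)
  then show ?thesis by (simp add: homotopy_def restrict_diff sum_subtractf)
qed

lemma proj_diff: "proj (\<lambda>I. \<gamma> I - \<gamma>' I) = proj \<gamma> - proj \<gamma>'"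
  by (simp add: proj_def nonneg_part_def neg_part_def restrict_diff)

text \<open>Three negative exponents add up to at most \<open>-3\<close>, with equality only for \<open>1/(x\<^sub>0 x\<^sub>1 x\<^sub>2)\<close>.\<close>

lemma neg_part_0_degree:
  assumes "is_section I n f" "n > - 3 \<or> n = - 3 \<and> lookup f minus_one_vec = 0"
  shows "neg_part f = 0"
  unfolding neg_part_eq_0_iff
proof (rule ballI, rule ccontr)
  fix a assume a: "a \<in> keys f" and "\<nexists>i. a $ i \<ge> 0"
  then have "a $ i \<le> - 1" for i by (metis not_le zle_diff1_eq diff_0)
  moreover have "(\<Sum>i\<in>UNIV. a $ i) = n" using a assms(1) by (auto simp: is_section_def)
  ultimately have n: "n \<le> - 3" "n = - 3 \<Longrightarrow> a = minus_one_vec"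
    by (auto simp: sum_3 minus_one_vec_def vec_eq_iff all_3 intro: order_antisym)
       (smt (verit))+
  then show False using assms(2) a by (auto simp: in_keys_iff)
qed

text \<open>The functional is nonzero because \<open>F/(x\<^sub>0 x\<^sub>1 x\<^sub>2)\<close>, a 2-cochain of degree 0, is a coboundary
  on the plane: a primitive of it is a 1-cocycle on the curve with trace 1.\<close>

lemma trivialization_curve_trace:
  assumes F: "F \<in> Hspace 3" "F \<noteq> 0"
  shows "trivialization F (curve_trace F)"
  unfolding trivialization_def
proof (intro conjI ballI allI impI)
  fix \<gamma> \<gamma>' c
  assume "\<gamma> \<in> curve_cocycles F 1 0" "\<gamma>' \<in> curve_cocycles F 1 0"
  then obtain \<delta> \<delta>' where d: "\<delta> \<in> cochains 2 (- 3)" "\<And>I. cech_diff \<gamma> I = F * \<delta> I"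
    "\<delta>' \<in> cochains 2 (- 3)" "\<And>I. cech_diff \<gamma>' I = F * \<delta>' I" by (auto simp: curve_cocycles_iff simp del: One_nat_def)
  have c0: "const c \<in> Hspace 0"
    by (auto simp: Hspace_def Delta_def const_def)
  have "curve_trace F (\<lambda>I. const c * \<gamma> I + \<gamma>' I) = residue (\<lambda>I. const c * \<delta> I + \<delta>' I)"
    using d F c0 by (intro curve_trace_eq)
      (auto simp: cech_diff_linear algebra_simps intro!: cochains_add intro: cochains_mult[of _ 0])
  also have "\<dots> = c * residue \<delta> + residue \<delta>'"
    by (simp add: residue_def lookup_add lookup_const_mult)
  also have "\<dots> = c * curve_trace F \<gamma> + curve_trace F \<gamma>'"
    using curve_trace_eq[OF F(2) d(1,2)] curve_trace_eq[OF F(2) d(3,4)] by simp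
  finally show "curve_trace F (\<lambda>I. const c * \<gamma> I + \<gamma>' I) = c * curve_trace F \<gamma> + curve_trace F \<gamma>'" .
next
  fix \<gamma> h
  assume "\<gamma> \<in> curve_cocycles F 1 0" and h: "h \<in> cochains 0 0" and "cong_mod F 1 0 \<gamma> (cech_diff h)"
  then obtain \<eta> where \<eta>: "\<eta> \<in> cochains 1 (- 3)" and eq: "\<And>I. \<gamma> I - cech_diff h I = F * \<eta> I"
    by (auto simp: cong_mod_def)
  have \<gamma>: "\<gamma> = (\<lambda>I. cech_diff h I + F * \<eta> I)" using eq by (auto simp: algebra_simps)
  have "curve_trace F \<gamma> = residue (cech_diff \<eta>)"
    by (rule curve_trace_eq[OF F(2) cech_diff_1[OF \<eta>]])
      (simp add: \<gamma> cech_diff_linear cech_diff_cech_diff[OF h])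
  then show "curve_trace F \<gamma> = 0" using residue_coboundary[OF \<eta>] by simp
next
  define \<delta> where "\<delta> = top_cochain (xmon minus_one_vec)"
  have "xmon minus_one_vec \<in> Hspace (- 3)"
    by (auto simp: Hspace_def Delta_def xmon_def minus_one_vec_def)
  then have \<delta>: "\<delta> \<in> cochains 2 (- 3)" unfolding \<delta>_def by (rule top_cochain_cochains)
  have FD: "(\<lambda>I. F * \<delta> I) \<in> cochains 2 0" using F \<delta> by (auto intro: cochains_mult[of _ 3])
  have "neg_part (F * \<delta> [0,1,2]) = 0"
    using FD by (intro neg_part_0_degree[of "[0,1,2]" 0]) (simp_all add: cochains_2_iff)
  from homotopy_2[OF FD this] have h: "homotopy (\<lambda>I. F * \<delta> I) \<in> cochains 1 0"
    "cech_diff (homotopy (\<lambda>I. F * \<delta> I)) = (\<lambda>I. F * \<delta> I)" .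
  have "curve_trace F (homotopy (\<lambda>I. F * \<delta> I)) = residue \<delta>"
    using curve_trace_eq[OF F(2) \<delta>] h(2) by metis
  moreover have "residue \<delta> = 1" by (simp add: residue_def \<delta>_def top_cochain_def xmon_def)
  ultimately show "\<exists>\<gamma>\<in>curve_cocycles F 1 0. curve_trace F \<gamma> \<noteq> 0"
    using h \<delta> by (intro bexI[of _ "homotopy (\<lambda>I. F * \<delta> I)"]) (auto simp: curve_cocycles_iff simp del: One_nat_def)
qed

context massey_setup begin

text \<open>The Massey data that the homotopy produces from the cochain \<open>e\<close>; here \<open>u\<close> is \<open>s\<close> or \<open>t\<close>.\<close>

definition std_\<phi> where "std_\<phi> = homotopy (\<lambda>I. F * top_cochain e I)"
definition std_\<psi> where "std_\<psi> u = homotopy (\<lambda>I. u * top_cochain e I)"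
definition std_h where "std_h u = homotopy (\<lambda>I. u * std_\<phi> I - F * std_\<psi> u I)"

lemma std_massey_data:
  assumes e: "e \<in> V"
  shows "massey_data std_\<phi> (top_cochain e) (std_h s) (std_h t) (std_\<psi> s) (std_\<psi> t)"
proof -
  have E: "top_cochain e \<in> cochains 2 (- 5)" by (rule top_cochain_cochains[OF e])
  have FE: "(\<lambda>I. F * top_cochain e I) \<in> cochains 2 (- 2)" using F E by (auto intro: cochains_mult[of _ 3])
  have nF: "neg_part (F * top_cochain e [0,1,2]) = 0"
    using FE by (intro neg_part_0_degree[of "[0,1,2]" "- 2"]) (simp_all add: cochains_2_iff)
  note \<phi> = homotopy_2[OF FE nF, folded std_\<phi>_def]
  have *: "std_\<psi> u \<in> cochains 1 (- 3) \<and> (\<forall>I. cech_diff (std_\<psi> u) I = u * top_cochain e I) \<and> std_h u \<in> cochains 0 0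
     \<and> (\<forall>I. cech_diff (std_h u) I = u * std_\<phi> I - F * std_\<psi> u I)"
    if u: "u \<in> Hspace 2" and p: "serre_pairing u e = 0" for u
  proof -
    have uE: "(\<lambda>I. u * top_cochain e I) \<in> cochains 2 (- 3)" using u E by (auto intro: cochains_mult[of _ 2])
    have nu: "neg_part (u * top_cochain e [0,1,2]) = 0"
      using uE p by (intro neg_part_0_degree[of "[0,1,2]" "- 3"])
        (simp_all add: cochains_2_iff serre_pairing_lookup top_cochain_def)
    note \<psi> = homotopy_2[OF uE nu, folded std_\<psi>_def]
    have c: "(\<lambda>I. u * std_\<phi> I - F * std_\<psi> u I) \<in> cochains 1 0"
      using u F \<phi>(1) \<psi>(1) by (intro cochains_diff) (auto intro: cochains_mult[of _ 2] cochains_mult[of _ 3])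
    have d: "cech_diff (\<lambda>I. u * std_\<phi> I - F * std_\<psi> u I) I = 0" for I
      unfolding cech_diff_linear \<phi>(2) \<psi>(2) by (simp add: algebra_simps)
    show ?thesis using homotopy_1[OF c d, folded std_h_def] \<psi> by simp
  qed
  show ?thesis unfolding massey_data_def
    using *[OF s perp(1)] *[OF t perp(2)] \<phi> E
    by (simp add: residue_def serre_pairing_lookup top_cochain_def)
qed

text \<open>By linearity of the homotopy, the quadratic form \<open>m'\<close> that belongs to the standard data expands
  into six terms, which are the six zigzags of \<open>Pi_F_zigzag\<close>.\<close>

lemma std_value:
  assumes e: "e \<in> V"
  shows "Pi_F F e s t = serre_pairing (s * std_h t [2] - t * std_h s [2]
     - F * homotopy (\<lambda>I. t * std_\<psi> s I - s * std_\<psi> t I) [2]) e"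
proof -
  let ?g = "homotopy (\<lambda>I. t * std_\<psi> s I - s * std_\<psi> t I)"
  let ?k = "\<lambda>I. (s * std_h t I - t * std_h s I) - F * ?g I"
  note D = std_massey_data[OF e] and G = massey_decomposition[OF std_massey_data[OF e] refl refl]
  note D' = D[unfolded massey_data_def]
  have "zigzag e s F t - zigzag e s t F + zigzag e t s F - zigzag e F s t + zigzag e F t s - zigzag e t F s = proj ?k"
    unfolding zigzag_def std_h_def std_\<phi>_def std_\<psi>_def homotopy_diff right_diff_distrib proj_diff
    by (simp add: algebra_simps)
  also have "\<dots> = ?k [2]"
  proof -
    have "?k [0,1,2] = 0" using D' G(1) by (simp add: cochains_0_iff)
    then show ?thesis using nonneg_part_Hspace[OF G(3)] by (simp add: proj_def neg_part_def)
  qed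
  finally show ?thesis using Pi_F_zigzag[OF F(1) s t e] by simp
qed

lemma FO_value_iff:
  assumes e: "e \<in> V"
  shows "FO_value F (curve_trace F) e s t z \<longleftrightarrow> z = Pi_F F e s t"
proof
  have tr: "curve_trace F (cup (incl u) \<phi>) = residue (\<lambda>I. u * \<delta> I)"
    if "u \<in> Hspace 2" "\<phi> \<in> cochains 1 (- 2)" "\<delta> \<in> cochains 2 (- 5)" "\<And>I. cech_diff \<phi> I = F * \<delta> I" for u \<phi> \<delta>
    using that F by (intro curve_trace_eq)
      (auto simp: cup_incl_left[of u 2] cochains_Nil cech_diff_linear algebra_simps intro: cochains_mult[of _ 2])
  {
    assume "FO_value F (curve_trace F) e s t z"
    then obtain \<phi> m where \<phi>: "\<phi> \<in> curve_cocycles F 1 (- 2)"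
      and p: "\<And>u. u \<in> Hspace 2 \<Longrightarrow> curve_trace F (cup (incl u) \<phi>) = serre_pairing u e"
      and m: "massey F s \<phi> t m" and z: "z = curve_trace F (cup m \<phi>)"
      unfolding FO_value_def by blast
    from \<phi> obtain \<delta> where \<phi>: "\<phi> \<in> cochains 1 (- 2)" and \<delta>: "\<delta> \<in> cochains 2 (- 5)" "\<And>I. cech_diff \<phi> I = F * \<delta> I"
      by (auto simp: curve_cocycles_iff simp del: One_nat_def)
    have cup: "cup (incl s) \<phi> = (\<lambda>I. s * \<phi> I)" "cup \<phi> (incl t) = (\<lambda>I. t * \<phi> I)"
      by (simp_all add: cup_incl_left[OF s] cup_incl_right[OF t] cochains_Nil[OF \<phi>])
    from m obtain h1 h2 \<psi>1 \<psi>2 where h: "h1 \<in> cochains 0 0" "h2 \<in> cochains 0 0" "\<psi>1 \<in> cochains 1 (- 3)" "\<psi>2 \<in> cochains 1 (- 3)"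
      and dh: "\<And>I. cech_diff h1 I - s * \<phi> I = F * \<psi>1 I" "\<And>I. cech_diff h2 I - t * \<phi> I = F * \<psi>2 I"
      and m: "m = (\<lambda>I. cup (incl s) h2 I - cup h1 (incl t) I)"
      unfolding massey_def cong_mod_def cup by auto
    have m: "m = (\<lambda>I. s * h2 I - t * h1 I)"
      unfolding m using h by (simp add: cup_incl_left[OF s] cup_incl_right[OF t] cochains_Nil)
    have D: "massey_data \<phi> \<delta> h1 h2 (\<lambda>I. 0 - \<psi>1 I) (\<lambda>I. 0 - \<psi>2 I)"
      unfolding massey_data_def
    proof (intro conjI \<phi> \<delta>(1) h allI ballI)
      have "(\<lambda>I. 0) \<in> cochains 1 (- 3)" by (simp add: cochains_iff)
      then show "(\<lambda>I. 0 - \<psi>1 I) \<in> cochains 1 (- 3)" "(\<lambda>I. 0 - \<psi>2 I) \<in> cochains 1 (- 3)"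
        using h by (auto intro!: cochains_diff simp del: diff_0)
      show "cech_diff h1 I = s * \<phi> I - F * (0 - \<psi>1 I)" "cech_diff h2 I = t * \<phi> I - F * (0 - \<psi>2 I)" for I
        using dh[of I] by (simp_all add: algebra_simps)
      show "residue (\<lambda>I. u * \<delta> I) = serre_pairing u e" if "u \<in> Hspace 2" for u
        using tr[OF that \<phi> \<delta>] p[OF that] by simp
    qed (rule \<delta>)
    show "z = Pi_F F e s t"
      unfolding z m trace_massey[OF D refl refl] std_value[OF e]
      by (rule massey_value_unique[OF D refl refl std_massey_data[OF e] refl refl])
  }
  assume z: "z = Pi_F F e s t"
  note D = std_massey_data[OF e]
  note D' = D[unfolded massey_data_def]
  have \<phi>: "std_\<phi> \<in> cochains 1 (- 2)" using D' by blast
  have neg: "(\<lambda>I. 0 - \<psi> I) \<in> cochains 1 (- 3)" if "\<psi> \<in> cochains 1 (- 3)" for \<psi>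
  proof -
    have "(\<lambda>I. 0) \<in> cochains 1 (- 3)" by (simp add: cochains_iff)
    then show ?thesis using that by (rule cochains_diff)
  qed
  have Nil: "std_h s [] = 0" "std_h t [] = 0" "std_\<phi> [] = 0" by (simp_all add: std_h_def std_\<phi>_def)
  have "massey F s std_\<phi> t (\<lambda>I. s * std_h t I - t * std_h s I)"
    unfolding massey_def cong_mod_def
  proof (intro bexI conjI)
    show "(\<lambda>I. s * std_h t I - t * std_h s I) = (\<lambda>I. cup (incl s) (std_h t) I - cup (std_h s) (incl t) I)"
      by (simp add: cup_incl_left[OF s] cup_incl_right[OF t] Nil)
    show "\<forall>I. cech_diff (std_h s) I - cup (incl s) std_\<phi> I = F * (0 - std_\<psi> s I)"
      "\<forall>I. cech_diff (std_h t) I - cup std_\<phi> (incl t) I = F * (0 - std_\<psi> t I)"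
      using D' by (simp_all add: cup_incl_left[OF s] cup_incl_right[OF t] Nil)
    show "(\<lambda>I. 0 - std_\<psi> s I) \<in> cochains 1 (0 - 3)" "(\<lambda>I. 0 - std_\<psi> t I) \<in> cochains 1 (0 - 3)"
      using D' neg by simp_all
  qed (use D' in auto)
  moreover have "std_\<phi> \<in> curve_cocycles F 1 (- 2)"
    using D' by (auto simp: curve_cocycles_iff simp del: One_nat_def)
  moreover have "\<forall>u\<in>Hspace 2. curve_trace F (cup (incl u) std_\<phi>) = serre_pairing u e"
    using tr[OF _ \<phi>, of _ "top_cochain e"] D' by simp
  moreover have "z = curve_trace F (cup (\<lambda>I. s * std_h t I - t * std_h s I) std_\<phi>)"
    unfolding z std_value[OF e] trace_massey[OF D refl refl] ..
  ultimately show "FO_value F (curve_trace F) e s t z" unfolding FO_value_def by blast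
qed

end

lemma is_FO_bracket_Pi_F:
  assumes "F \<in> Hspace 3" "F \<noteq> 0"
  shows "is_FO_bracket F (Pi_F F)"
  unfolding is_FO_bracket_def
proof (intro exI conjI ballI allI)
  show "trivialization F (curve_trace F)" using assms by (rule trivialization_curve_trace)
  fix e s t z assume "e \<in> V - {0}" "s \<in> perp e" "t \<in> perp e"
  then interpret massey_setup F s t e by unfold_locales (use assms in \<open>auto simp: perp_def\<close>)
  show "FO_value F (curve_trace F) e s t z \<longleftrightarrow> z = Pi_F F e s t"
    using FO_value_iff \<open>e \<in> V - {0}\<close> by simp
qed

section \<open>The explicit formula\<close>

text \<open>The component \<open>[0,1,2]\<close> reaches the component \<open>[2]\<close> by removal of 0 and 1 in either order.  Only
  the order 0, 1 contributes: when 1 is removed first, the exponent of \<open>x\<^sub>1\<close> is nonnegative from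
  then on, and 0 is no longer the leading index.\<close>

lemma zigzag_eq:
  assumes "x \<in> Hspace i" "i \<ge> 0" "y \<in> Hspace j" "j \<ge> 0" "z \<in> Hspace k" "k \<ge> 0"
  shows "zigzag e x y z = nonneg_part (z * lead_part 1 (y * lead_part 0 (x * e)))"
proof -
  have "\<not> lead_index 0 q" if q: "q \<in> keys (y * lead_part 1 (x * e))" for q
  proof -
    obtain a b where "q = a + b" "a \<in> keys y" "b \<in> keys (lead_part 1 (x * e))"
      using subsetD[OF keys_mult q] by blast
    then have "a $ 1 \<ge> 0" "b $ 1 \<ge> 0" using Hspace_nonneg[OF assms(3,4)] unfolding keys_restrict lead_index_iff by auto
    then show ?thesis unfolding lead_index_iff using \<open>q = a + b\<close> by simp
  qed
  then have 0: "lead_part 0 (y * lead_part 1 (x * e)) = 0" by (rule restrict_0I)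
  show ?thesis
    unfolding zigzag_def proj_def homotopy_components
    by (simp add: top_cochain_def restrict_uminus 0 neg_part_def)
qed

lemma serre_pairing_V:
  assumes "e \<in> V"
  shows "serre_pairing g e = (\<Sum>r\<in>Delta 2. lookup g r * lookup e (minus_one_vec - r))"
proof -
  let ?f = "\<lambda>a. minus_one_vec - (a :: exps)"
  have D: "?f a \<in> Delta (- 5) \<longleftrightarrow> a \<in> Delta 2" for a
    by (auto simp: Delta_def minus_one_vec_def sum_3 all_3)
  have sub: "keys e \<subseteq> ?f ` Delta 2"
  proof
    fix q assume "q \<in> keys e"
    then have "?f q \<in> Delta 2" using assms D[of "?f q"] by (auto simp: Hspace_def)
    then show "q \<in> ?f ` Delta 2" by (intro image_eqI[of _ _ "?f q"]) auto
  qed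
  have "serre_pairing g e = lookup (e * g) minus_one_vec" by (simp add: serre_pairing_lookup mult.commute)
  also have "\<dots> = (\<Sum>q\<in>?f ` Delta 2. lookup e q * lookup g (?f q))"
    by (rule lookup_mult_sum[OF _ sub]) (simp add: finite_Delta_2)
  also have "\<dots> = (\<Sum>r\<in>Delta 2. lookup g r * lookup e (?f r))"
    by (subst sum.reindex) (auto simp: inj_on_def mult.commute)
  finally show ?thesis .
qed

text \<open>For given \<open>a\<close>, \<open>b\<close>, \<open>c\<close> and \<open>r\<close> only \<open>a' = a + b + c - (1,1,1) - r\<close> can contribute.  For this
  \<open>a'\<close> the inequalities in \<open>rho\<close> say that the leading index of the exponent is 0 after the
  multiplication by \<open>x\<^sup>a\<close>, then 1 after the one by \<open>x\<^sup>b\<close>, and then 2.\<close>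

lemma flag_rho:
  assumes "a \<in> Delta i" "b \<in> Delta j" "c \<in> Delta k" "i \<ge> 0" "j \<ge> 0" "k \<ge> 0" "i + j + k = 7"
    and r: "r \<in> Delta 2" and e: "e \<in> V"
  shows "(if lead_index 1 (r - c) \<and> lead_index 0 (r - c - b) then lookup e (r - c - b - a) else 0) =
    (\<Sum>a'\<in>Delta 2. of_int (rho a b c a' r) * lookup e (minus_one_vec - a'))"
proof -
  define p where "p = a + b + c + minus_one_vec - r"
  have p: "minus_one_vec - p = r - c - b - a" by (simp add: p_def algebra_simps)
  have deg: "a $ 0 + a $ 1 + a $ 2 = i" "b $ 0 + b $ 1 + b $ 2 = j" "c $ 0 + c $ 1 + c $ 2 = k" "r $ 0 + r $ 1 + r $ 2 = 2"
    and nn: "a $ 0 \<ge> 0" "a $ 1 \<ge> 0" "a $ 2 \<ge> 0" "b $ 0 \<ge> 0" "b $ 1 \<ge> 0" "b $ 2 \<ge> 0"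
     "c $ 0 \<ge> 0" "c $ 1 \<ge> 0" "c $ 2 \<ge> 0" "r $ 0 \<ge> 0" "r $ 1 \<ge> 0" "r $ 2 \<ge> 0"
    using assms by (auto simp: Delta_def sum_3)
  have pc: "p $ l = a $ l + b $ l + c $ l - 1 - r $ l" for l by (simp add: p_def minus_one_vec_def)
  have other: "rho a b c a' r = 0" if "a' \<in> Delta 2" "a' \<noteq> p" for a'
  proof (rule ccontr)
    assume "rho a b c a' r \<noteq> 0"
    then have "a' $ 0 + r $ 0 = a $ 0 + b $ 0 + c $ 0 - 1" "a' $ 1 + r $ 1 = a $ 1 + b $ 1 + c $ 1 - 1"
      by (auto simp: rho_def split: if_splits)
    moreover have "a' $ 0 + a' $ 1 + a' $ 2 = 2" using that by (simp add: Delta_def sum_3)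
    ultimately have "a' = p" using deg assms(7) by (simp add: vec_eq_iff all_3 pc)
    with that show False by simp
  qed
  have at_p: "rho a b c p r = (if lead_index 1 (r - c) \<and> lead_index 0 (r - c - b) then 1 else 0)"
    unfolding lead_index_iff rho_def using nn by (auto simp: pc)
  show ?thesis
  proof (cases "p \<in> Delta 2")
    case True
    have "(\<Sum>a'\<in>Delta 2. of_int (rho a b c a' r) * lookup e (minus_one_vec - a')) =
      (\<Sum>a'\<in>Delta 2. if a' = p then of_int (rho a b c p r) * lookup e (minus_one_vec - p) else 0)"
      by (rule sum.cong) (auto simp: other)
    then show ?thesis using True finite_Delta_2 by (simp add: sum.delta at_p p)
  next
    case False
    have "minus_one_vec - p \<notin> Delta (- 5)"
      using False by (auto simp: Delta_def minus_one_vec_def sum_3 all_3)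
    then have "lookup e (r - c - b - a) = 0" using e unfolding p[symmetric] by (auto simp: Hspace_def in_keys_iff)
    moreover have "(\<Sum>a'\<in>Delta 2. of_int (rho a b c a' r) * lookup e (minus_one_vec - a')) = 0"
      using False by (intro sum.neutral) (metis other mult_zero_left of_int_0)
    ultimately show ?thesis by simp
  qed
qed

text \<open>Both the linear functional and the zigzag depend linearly on \<open>e\<close>, which produces the quadratic
  form in the coordinates of \<open>e\<close>.\<close>

lemma serre_pairing_zigzag:
  assumes x: "x \<in> Hspace i" "i \<ge> 0" and y: "y \<in> Hspace j" "j \<ge> 0" and z: "z \<in> Hspace k" "k \<ge> 0"
    and "i + j + k = 7" and e: "e \<in> V"
  shows "serre_pairing (zigzag e x y z) e = (\<Sum>a\<in>keys x. \<Sum>b\<in>keys y. \<Sum>c\<in>keys z. lookup x a * lookup y b * lookup z c *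
    (\<Sum>a'\<in>Delta 2. \<Sum>b'\<in>Delta 2. of_int (rho a b c a' b') * lookup e (minus_one_vec - a') * lookup e (minus_one_vec - b')))"
proof -
  have Dx: "a \<in> Delta i" if "a \<in> keys x" for a using that x by (auto simp: Hspace_def)
  have Dy: "a \<in> Delta j" if "a \<in> keys y" for a using that y by (auto simp: Hspace_def)
  have Dz: "a \<in> Delta k" if "a \<in> keys z" for a using that z by (auto simp: Hspace_def)
  have "lookup (zigzag e x y z) r = (\<Sum>c\<in>keys z. \<Sum>b\<in>keys y. \<Sum>a\<in>keys x. lookup x a * lookup y b * lookup z c *
      (if lead_index 1 (r - c) \<and> lead_index 0 (r - c - b) then lookup e (r - c - b - a) else 0))" if "r \<in> Delta 2" for r
  proof -
    have "\<forall>i. r $ i \<ge> 0" using that by (simp add: Delta_def)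
    then have "lookup (zigzag e x y z) r = (\<Sum>c\<in>keys z. lookup z c * (if lead_index 1 (r - c) then
       (\<Sum>b\<in>keys y. lookup y b * (if lead_index 0 (r - c - b) then (\<Sum>a\<in>keys x. lookup x a * lookup e (r - c - b - a)) else 0)) else 0))"
      unfolding zigzag_eq[OF x y z] nonneg_part_def lookup_restrict
      by (simp add: lookup_mult lookup_restrict cong: if_cong)
    also have "\<dots> = (\<Sum>c\<in>keys z. \<Sum>b\<in>keys y. \<Sum>a\<in>keys x. lookup x a * lookup y b * lookup z c *
      (if lead_index 1 (r - c) \<and> lead_index 0 (r - c - b) then lookup e (r - c - b - a) else 0))"
    proof (intro sum.cong refl)
      fix c
      have "lookup z c * (lookup y b * (if lead_index 0 (r - c - b) then (\<Sum>a\<in>keys x. lookup x a * lookup e (r - c - b - a)) else 0)) =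
          (\<Sum>a\<in>keys x. lookup x a * lookup y b * lookup z c * (if lead_index 0 (r - c - b) then lookup e (r - c - b - a) else 0))" for b
        by (cases "lead_index 0 (r - c - b)") (simp_all add: sum_distrib_left mult.assoc mult.left_commute)
      then show "lookup z c * (if lead_index 1 (r - c) then
         (\<Sum>b\<in>keys y. lookup y b * (if lead_index 0 (r - c - b) then (\<Sum>a\<in>keys x. lookup x a * lookup e (r - c - b - a)) else 0)) else 0) =
        (\<Sum>b\<in>keys y. \<Sum>a\<in>keys x. lookup x a * lookup y b * lookup z c *
          (if lead_index 1 (r - c) \<and> lead_index 0 (r - c - b) then lookup e (r - c - b - a) else 0))"
        by (cases "lead_index 1 (r - c)") (simp_all add: sum_distrib_left)
    qed
    finally show ?thesis .
  qed
  then have "serre_pairing (zigzag e x y z) e = (\<Sum>r\<in>Delta 2. (\<Sum>c\<in>keys z. \<Sum>b\<in>keys y. \<Sum>a\<in>keys x. lookup x a * lookup y b * lookup z c *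
      (\<Sum>a'\<in>Delta 2. of_int (rho a b c a' r) * lookup e (minus_one_vec - a'))) * lookup e (minus_one_vec - r))"
    unfolding serre_pairing_V[OF e]
    using flag_rho[OF Dx Dy Dz x(2) y(2) z(2) assms(7) _ e] by (intro sum.cong refl) simp
  also have "\<dots> = (\<Sum>r\<in>Delta 2. \<Sum>c\<in>keys z. \<Sum>b\<in>keys y. \<Sum>a\<in>keys x. \<Sum>a'\<in>Delta 2. lookup x a * lookup y b * lookup z c *
      (of_int (rho a b c a' r) * lookup e (minus_one_vec - a') * lookup e (minus_one_vec - r)))"
    by (simp add: sum_distrib_left sum_distrib_right mult_ac)
  also have "\<dots> = (\<Sum>c\<in>keys z. \<Sum>b\<in>keys y. \<Sum>a\<in>keys x. \<Sum>a'\<in>Delta 2. \<Sum>r\<in>Delta 2. lookup x a * lookup y b * lookup z c *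
      (of_int (rho a b c a' r) * lookup e (minus_one_vec - a') * lookup e (minus_one_vec - r)))"
    apply (subst sum.swap, rule sum.cong[OF refl])
    apply (subst sum.swap, rule sum.cong[OF refl])
    apply (subst sum.swap, rule sum.cong[OF refl])
    by (rule sum.swap)
  also have "\<dots> = (\<Sum>c\<in>keys z. \<Sum>a\<in>keys x. \<Sum>b\<in>keys y. lookup x a * lookup y b * lookup z c *
    (\<Sum>a'\<in>Delta 2. \<Sum>r\<in>Delta 2. of_int (rho a b c a' r) * lookup e (minus_one_vec - a') * lookup e (minus_one_vec - r)))"
    unfolding sum_distrib_left by (intro sum.cong[OF refl] sum.swap)
  also have "\<dots> = (\<Sum>a\<in>keys x. \<Sum>b\<in>keys y. \<Sum>c\<in>keys z. lookup x a * lookup y b * lookup z c *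
    (\<Sum>a'\<in>Delta 2. \<Sum>r\<in>Delta 2. of_int (rho a b c a' r) * lookup e (minus_one_vec - a') * lookup e (minus_one_vec - r)))"
    by (subst sum.swap, rule sum.cong[OF refl], rule sum.swap)
  finally show ?thesis .
qed

lemma sum_rotate3:
  "(\<Sum>c\<in>C. \<Sum>a\<in>A. \<Sum>b\<in>B. f a b c) = (\<Sum>a\<in>A. \<Sum>b\<in>B. \<Sum>c\<in>C. f a b c)"
  by (subst sum.swap, rule sum.cong[OF refl], rule sum.swap)

lemma sum_reverse3:
  "(\<Sum>c\<in>C. \<Sum>b\<in>B. \<Sum>a\<in>A. f a b c) = (\<Sum>a\<in>A. \<Sum>b\<in>B. \<Sum>c\<in>C. f a b c)"
proof -
  have "(\<Sum>c\<in>C. \<Sum>b\<in>B. \<Sum>a\<in>A. f a b c) = (\<Sum>c\<in>C. \<Sum>a\<in>A. \<Sum>b\<in>B. f a b c)"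
    by (intro sum.cong refl sum.swap)
  from this sum_rotate3 show ?thesis by (rule trans)
qed

lemma bracket_coeff_eq:
  "bracket_coeff a b c p q = rho a c b p q + rho b a c p q + rho c b a p q
     - rho a b c p q - rho b c a p q - rho c a b p q"
proof -
  have f: "finite {1::nat, 2}" "0 \<notin> {1::nat, 2}" "finite {2::nat}" "1 \<notin> {2::nat}" by auto
  have n: "[a,b,c] ! 0 = a" "[a,b,c] ! 1 = b" "[a,b,c] ! 2 = c" by simp_all
  have d: "(1::nat) \<noteq> 2" "(0::nat) \<noteq> 1" "(0::nat) \<noteq> 2" "(2::nat) \<noteq> 1" "(1::nat) \<noteq> 0" "(2::nat) \<noteq> 0" by simp_all
  show ?thesis
    unfolding bracket_coeff_def
    unfolding sum_over_permutations_insert[OF f(1,2)]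
    unfolding sum_over_permutations_insert[OF f(3,4)]
    unfolding permutes_sing
    by (simp add: sign_swap_id permutation_swap_id sign_compose sign_id transpose_def n d del: One_nat_def nth_Cons_0 nth_Cons_numeral)
qed

text \<open>The value at \<open>v\<close> of the bracket of two coordinates.\<close>

definition bracket_form :: "laurent \<Rightarrow> quad \<Rightarrow> quad \<Rightarrow> laurent \<Rightarrow> complex" where
  "bracket_form F a b v = (\<Sum>c\<in>Delta 3. lookup F c * (\<Sum>a'\<in>UNIV. \<Sum>b'\<in>UNIV.
     of_int (bracket_coeff (Rep_quad a) (Rep_quad b) c (Rep_quad a') (Rep_quad b')) * coord a' v * coord b' v))"

lemma coord_lookup: "coord a v = lookup v (minus_one_vec - Rep_quad a)"
  by (simp add: coord_def serre_pairing_xmon)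

lemma sum_quad: "(\<Sum>a\<in>UNIV. f (Rep_quad a)) = (\<Sum>a\<in>Delta 2. f a)"
proof -
  have "bij_betw Rep_quad UNIV (Delta 2)"
    unfolding bij_betw_def using type_definition.Rep_range[OF type_definition_quad]
    by (auto simp: inj_on_def Rep_quad_inject)
  then show ?thesis by (rule sum.reindex_bij_betw)
qed

definition vec3 :: "int \<Rightarrow> int \<Rightarrow> int \<Rightarrow> exps" where
  "vec3 i j k = (\<chi> l. if l = 0 then i else if l = 1 then j else k)"

lemma vec3_nth [simp]: "vec3 i j k $ 0 = i" "vec3 i j k $ 1 = j" "vec3 i j k $ 2 = k"
  by (simp_all add: vec3_def)

lemma vec3_eq_iff [simp]: "vec3 i j k = vec3 i' j' k' \<longleftrightarrow> i = i' \<and> j = j' \<and> k = k'"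
  by (auto simp: vec_eq_iff all_3)

lemma vec3_eta: "e = vec3 (e $ 0) (e $ 1) (e $ 2)"
  by (simp add: vec_eq_iff all_3)

lemma vec3_in_Delta: "n \<ge> 0 \<Longrightarrow> vec3 i j k \<in> Delta n \<longleftrightarrow> i + j + k = n \<and> i \<ge> 0 \<and> j \<ge> 0 \<and> k \<ge> 0"
  by (simp add: Delta_def sum_3 all_3)

lemma Delta_2: "Delta 2 = {vec3 2 0 0, vec3 1 1 0, vec3 1 0 1, vec3 0 2 0, vec3 0 1 1, vec3 0 0 2}"
proof -
  have "i + j + k = 2 \<and> i \<ge> 0 \<and> j \<ge> 0 \<and> k \<ge> 0 \<Longrightarrow>
    vec3 i j k \<in> {vec3 2 0 0, vec3 1 1 0, vec3 1 0 1, vec3 0 2 0, vec3 0 1 1, vec3 0 0 2}" for i j k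
    by simp presburger
  then have "e \<in> Delta 2 \<Longrightarrow> e \<in> {vec3 2 0 0, vec3 1 1 0, vec3 1 0 1, vec3 0 2 0, vec3 0 1 1, vec3 0 0 2}" for e
    using vec3_in_Delta[of 2] vec3_eta[of e] by (metis zero_le_numeral)
  then show ?thesis by (auto simp: vec3_in_Delta)
qed

lemma Delta_3: "Delta 3 = {vec3 3 0 0, vec3 2 1 0, vec3 2 0 1, vec3 1 2 0, vec3 1 1 1, vec3 1 0 2,
  vec3 0 3 0, vec3 0 2 1, vec3 0 1 2, vec3 0 0 3}"
proof -
  have "i + j + k = 3 \<and> i \<ge> 0 \<and> j \<ge> 0 \<and> k \<ge> 0 \<Longrightarrow>
    vec3 i j k \<in> {vec3 3 0 0, vec3 2 1 0, vec3 2 0 1, vec3 1 2 0, vec3 1 1 1, vec3 1 0 2,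
  vec3 0 3 0, vec3 0 2 1, vec3 0 1 2, vec3 0 0 3}" for i j k
    by simp presburger
  then have "e \<in> Delta 3 \<Longrightarrow> e \<in> {vec3 3 0 0, vec3 2 1 0, vec3 2 0 1, vec3 1 2 0, vec3 1 1 1, vec3 1 0 2,
  vec3 0 3 0, vec3 0 2 1, vec3 0 1 2, vec3 0 0 3}" for e
    using vec3_in_Delta[of 3] vec3_eta[of e] by (metis zero_le_numeral)
  then show ?thesis by (auto simp: vec3_in_Delta)
qed

lemma finite_Delta_3: "finite (Delta 3)"
  by (simp add: Delta_3)

lemma sum_keys_Delta:
  assumes "f \<in> Hspace n" "finite (Delta n)"
  shows "(\<Sum>a\<in>keys f. lookup f a * g a) = (\<Sum>a\<in>Delta n. lookup f a * g a)"
  using assms by (intro sum.mono_neutral_left) (auto simp: Hspace_def in_keys_iff)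

lemma Pi_F_bracket_form:
  assumes F: "F \<in> Hspace 3" and s: "s \<in> Hspace 2" and t: "t \<in> Hspace 2" and e: "e \<in> V"
  shows "Pi_F F e s t = (\<Sum>a\<in>UNIV. \<Sum>b\<in>UNIV. lookup s (Rep_quad a) * lookup t (Rep_quad b) * bracket_form F a b e)"
proof -
  define K where "K a b c = (\<Sum>a'\<in>Delta 2. \<Sum>b'\<in>Delta 2. of_int (rho a b c a' b') * lookup e (minus_one_vec - a') * lookup e (minus_one_vec - b'))" for a b c
  define S where "S f = (\<Sum>a\<in>keys s. \<Sum>b\<in>keys t. \<Sum>c\<in>keys F. lookup s a * lookup t b * lookup F c * f a b c)" for f :: "exps \<Rightarrow> exps \<Rightarrow> exps \<Rightarrow> complex"
  have 1: "serre_pairing (zigzag e s t F) e = S (\<lambda>a b c. K a b c)"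
    using serre_pairing_zigzag[OF s _ t _ F _ _ e] by (simp add: S_def K_def)
  have 2: "serre_pairing (zigzag e s F t) e = S (\<lambda>a b c. K a c b)"
    using serre_pairing_zigzag[OF s _ F _ t _ _ e] unfolding S_def K_def
    by (simp add: mult_ac) (intro sum.cong[OF refl] sum.swap)
  have 3: "serre_pairing (zigzag e t s F) e = S (\<lambda>a b c. K b a c)"
    using serre_pairing_zigzag[OF t _ s _ F _ _ e] unfolding S_def K_def
    by (simp add: mult_ac) (rule sum.swap)
  have 4: "serre_pairing (zigzag e F s t) e = S (\<lambda>a b c. K c a b)"
    using serre_pairing_zigzag[OF F _ s _ t _ _ e] unfolding S_def K_def
    by (simp add: mult_ac) (rule sum_rotate3)
  have 5: "serre_pairing (zigzag e F t s) e = S (\<lambda>a b c. K c b a)"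
    using serre_pairing_zigzag[OF F _ t _ s _ _ e] unfolding S_def K_def
    by (simp add: mult_ac) (rule sum_reverse3)
  have 6: "serre_pairing (zigzag e t F s) e = S (\<lambda>a b c. K b c a)"
    using serre_pairing_zigzag[OF t _ F _ s _ _ e] unfolding S_def K_def
    by (simp add: mult_ac) (rule sum_rotate3[symmetric])
  have "Pi_F F e s t = S (\<lambda>a b c. K a c b + K b a c + K c b a - K a b c - K b c a - K c a b)"
    unfolding Pi_F_zigzag[OF F s t e] serre_pairing_add serre_pairing_diff 1 2 3 4 5 6
    by (simp add: S_def sum.distrib sum_subtractf algebra_simps)
  also have "\<dots> = S (\<lambda>a b c. \<Sum>a'\<in>Delta 2. \<Sum>b'\<in>Delta 2. of_int (bracket_coeff a b c a' b') * lookup e (minus_one_vec - a') * lookup e (minus_one_vec - b'))"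
    by (simp add: K_def bracket_coeff_eq sum.distrib sum_subtractf algebra_simps)
  also have "\<dots> = (\<Sum>a\<in>keys s. lookup s a * (\<Sum>b\<in>keys t. lookup t b * (\<Sum>c\<in>keys F. lookup F c *
    (\<Sum>a'\<in>Delta 2. \<Sum>b'\<in>Delta 2. of_int (bracket_coeff a b c a' b') * lookup e (minus_one_vec - a') * lookup e (minus_one_vec - b')))))"
    unfolding S_def by (simp add: sum_distrib_left mult_ac)
  also have "\<dots> = (\<Sum>a\<in>UNIV. lookup s (Rep_quad a) * (\<Sum>b\<in>UNIV. lookup t (Rep_quad b) * bracket_form F a b e))"
    unfolding bracket_form_def coord_lookup
    by (simp add: sum_keys_Delta[OF s finite_Delta_2] sum_keys_Delta[OF t finite_Delta_2]
        sum_keys_Delta[OF F finite_Delta_3] sum_quad[symmetric])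
  finally show ?thesis by (simp add: sum_distrib_left mult_ac)
qed

section \<open>Polynomials and biderivations\<close>

lemma poly_mapping_single_induct [case_names single add]:
  assumes single: "\<And>m c. Q (Poly_Mapping.single m c)" and add: "\<And>p q. Q p \<Longrightarrow> Q q \<Longrightarrow> Q (p + q)"
  shows "Q (p :: 'a \<Rightarrow>\<^sub>0 'b :: comm_monoid_add)"
proof (induction p rule: update_induct)
  case const
  have "Q (Poly_Mapping.single undefined 0)" by (rule single)
  then show ?case by simp
next
  case (update f a b)
  have "Poly_Mapping.update a b f = f + Poly_Mapping.single a b"
    using update by (intro poly_mapping_eqI) (auto simp: lookup_update lookup_add lookup_single in_keys_iff when_def)
  then show ?case using add single update by metis
qed

lemma const_simps: "const 0 = 0" "const 1 = 1" "const (c + d) = const c + const d" "const (c * d) = const c * const d"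
  "const (- c) = - const c" "const (of_nat n) = of_nat n" "const (of_int k) = of_int k"
  for c d :: complex
  by (simp_all add: const_def single_add mult_single single_uminus)

lemma single_eq_const: "Poly_Mapping.single m c = const c * Poly_Mapping.single m 1" for m :: "'a :: comm_monoid_add"
  by (simp add: const_def mult_single)

lemma sym_alg_induct [case_names const X add mult]:
  assumes const: "\<And>c. Q (const c)" and X: "\<And>a. Q (X a)"
    and add: "\<And>p q. Q p \<Longrightarrow> Q q \<Longrightarrow> Q (p + q)" and mult: "\<And>p q. Q p \<Longrightarrow> Q q \<Longrightarrow> Q (p * q)"
  shows "Q (p :: sym_alg)"
proof (induction p rule: poly_mapping_single_induct)
  case (single m c)
  have "Q (Poly_Mapping.single m 1)"
  proof (induction m rule: poly_mapping_single_induct)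
    case (single a n)
    show ?case
    proof (induction n)
      case 0
      have "Q (const 1)" by (rule const)
      then show ?case by (simp add: const_simps)
    next
      case (Suc n)
      have "X a * Poly_Mapping.single (Poly_Mapping.single a n) 1 = Poly_Mapping.single (Poly_Mapping.single a (Suc n)) 1"
        by (simp add: X_def mult_single flip: single_add)
      then show ?case using mult[OF X Suc] by metis
    qed
  next
    case (add m m')
    have "Poly_Mapping.single (m + m') (1::complex) = Poly_Mapping.single m 1 * Poly_Mapping.single m' 1" by (simp add: mult_single)
    then show ?case using mult[OF add] by metis
  qed
  then show ?case by (subst single_eq_const) (intro mult const)
qed (rule add)

definition monomial_value :: "laurent \<Rightarrow> (quad \<Rightarrow>\<^sub>0 nat) \<Rightarrow> complex" where
  "monomial_value v m = (\<Prod>a\<in>UNIV. coord a v ^ lookup m a)"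

lemma eval_single: "eval (Poly_Mapping.single m c) v = c * monomial_value v m"
  by (simp add: eval_def monomial_value_def)

lemma eval_add: "eval (P + Q) v = eval P v + eval Q v"
  unfolding eval_def by (rule setsum_keys_plus_distrib) (simp_all add: distrib_right)

lemma eval_mult: "eval (P * Q) v = eval P v * eval Q v"
proof (induction P rule: poly_mapping_single_induct)
  case (single m c)
  show ?case
  proof (induction Q rule: poly_mapping_single_induct)
    case (single m' c')
    show ?case by (simp add: mult_single eval_single monomial_value_def lookup_add power_add prod.distrib)
  qed (simp add: distrib_left eval_add)
qed (simp add: distrib_right eval_add)

lemma eval_const: "eval (const c) v = c"
  by (simp add: const_def eval_single monomial_value_def)
lemma eval_0: "eval 0 v = 0" by (simp add: eval_def)
lemma eval_1: "eval 1 v = 1" using eval_const[of 1 v] by (simp add: const_simps)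
lemma eval_uminus: "eval (- P) v = - eval P v"
  using eval_add[of P "- P" v] by (simp add: eval_0 eq_neg_iff_add_eq_0 add.commute)
lemma eval_diff: "eval (P - Q) v = eval P v - eval Q v"
  using eval_add[of P "- Q" v] by (simp add: eval_uminus)
lemma eval_sum: "eval (sum f A) v = (\<Sum>a\<in>A. eval (f a) v)"
  by (induction A rule: infinite_finite_induct) (simp_all add: eval_add eval_0)
lemma eval_X: "eval (X a) v = coord a v"
proof -
  have "monomial_value v (Poly_Mapping.single a 1) = (\<Prod>b\<in>UNIV. if b = a then coord a v else 1)"
    unfolding monomial_value_def by (rule prod.cong) (auto simp: lookup_single when_def)
  then show ?thesis by (simp add: X_def eval_single)
qed
lemma eval_of_nat: "eval (of_nat n) v = of_nat n"
  using eval_const[of "of_nat n" v] by (simp add: const_simps)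
lemma eval_of_int: "eval (of_int n) v = of_int n"
  using eval_const[of "of_int n" v] by (simp add: const_simps)
lemma eval_power: "eval (P ^ n) v = eval P v ^ n"
  by (induction n) (simp_all add: eval_1 eval_mult)
lemmas eval_simps = eval_add eval_mult eval_const eval_0 eval_1 eval_uminus eval_diff eval_sum eval_X eval_of_nat eval_of_int eval_power

text \<open>The subtraction of exponents is truncated, but where it truncates the coefficient is 0.\<close>

definition partial :: "quad \<Rightarrow> sym_alg \<Rightarrow> sym_alg" where
  "partial a P = (\<Sum>m\<in>keys P. Poly_Mapping.single (m - Poly_Mapping.single a 1) (of_nat (lookup m a) * lookup P m))"

lemma partial_single: "partial a (Poly_Mapping.single m c) = Poly_Mapping.single (m - Poly_Mapping.single a 1) (of_nat (lookup m a) * c)"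
  by (simp add: partial_def)
lemma partial_add: "partial a (P + Q) = partial a P + partial a Q"
  unfolding partial_def by (rule setsum_keys_plus_distrib) (simp_all add: distrib_left single_add)

lemma partial_mult: "partial a (P * Q) = partial a P * Q + P * partial a Q"
proof (induction P rule: poly_mapping_single_induct)
  case (single m c)
  show ?case
  proof (induction Q rule: poly_mapping_single_induct)
    case (single m' c')
    have 1: "Poly_Mapping.single (m + m' - Poly_Mapping.single a 1) (of_nat (lookup m a) * (c * c')) =
      Poly_Mapping.single (m - Poly_Mapping.single a 1 + m') (of_nat (lookup m a) * (c * c'))" for m m' :: "quad \<Rightarrow>\<^sub>0 nat"
    proof (cases "lookup m a = 0")
      case False
      then have "m + m' - Poly_Mapping.single a 1 = m - Poly_Mapping.single a 1 + m'"
        by (intro poly_mapping_eqI) (auto simp: lookup_add lookup_minus lookup_single when_def)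
      then show ?thesis by simp
    qed simp
    show ?case using 1[of m m'] 1[of m' m]
      by (simp add: mult_single partial_single lookup_add distrib_left distrib_right single_add mult_ac add.commute)
  qed (simp add: distrib_left partial_add)
qed (simp add: distrib_right partial_add)

lemma partial_const: "partial a (const c) = 0" by (simp add: const_def partial_single)
lemma partial_0: "partial a 0 = 0" by (simp add: partial_def)
lemma partial_const_mult: "partial a (const c * P) = const c * partial a P" by (simp add: partial_mult partial_const)
lemma partial_uminus: "partial a (- P) = - partial a P"
  using partial_add[of a P "- P"] by (simp add: partial_0 eq_neg_iff_add_eq_0 add.commute)
lemma partial_diff: "partial a (P - Q) = partial a P - partial a Q"
  using partial_add[of a P "- Q"] by (simp add: partial_uminus)
lemma partial_sum: "partial a (sum f A) = (\<Sum>x\<in>A. partial a (f x))"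
  by (induction A rule: infinite_finite_induct) (simp_all add: partial_add partial_0)
lemma partial_X: "partial a (X b) = (if a = b then 1 else 0)"
  by (simp add: X_def partial_single lookup_single)
lemma partial_of_nat: "partial a (of_nat n) = 0" using partial_const[of a "of_nat n"] by (simp add: const_simps)
lemma partial_1: "partial a 1 = 0" using partial_const[of a 1] by (simp add: const_simps)
lemma partial_commute: "partial a (partial b P) = partial b (partial a P)"
  by (induction P rule: sym_alg_induct) (auto simp: partial_const partial_0 partial_1 partial_X partial_add partial_mult)

lemma derivation_eq:
  assumes add: "\<And>p q. d (p + q) = d p + d q" and scale: "\<And>c p. d (const c * p) = const c * d p"
    and leibniz: "\<And>p q. d (p * q) = p * d q + d p * q"
  shows "d P = (\<Sum>a\<in>UNIV. partial a P * d (X a))"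
proof (induction P rule: sym_alg_induct)
  case (const c)
  have "d 1 = 0" using leibniz[of 1 1] by simp
  then have "d (const c) = 0" using scale[of c 1] by simp
  then show ?case by (simp add: partial_const)
next
  case (X a)
  have "(\<Sum>b\<in>UNIV. partial b (X a) * d (X b)) = (\<Sum>b\<in>UNIV. if b = a then d (X a) else 0)"
    by (rule sum.cong) (auto simp: partial_X)
  then show ?case by simp
next
  case (add p q)
  then show ?case by (simp add: assms(1) partial_add distrib_right sum.distrib)
next
  case (mult p q)
  then show ?case by (simp add: leibniz partial_mult sum.distrib sum_distrib_left algebra_simps)
qed

definition biderivation_of :: "(quad \<Rightarrow> quad \<Rightarrow> sym_alg) \<Rightarrow> sym_alg \<Rightarrow> sym_alg \<Rightarrow> sym_alg" where
  "biderivation_of G P Q = (\<Sum>a\<in>UNIV. \<Sum>b\<in>UNIV. partial a P * partial b Q * G a b)"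

lemma biderivation_of_X: "biderivation_of G (X a) (X b) = G a b"
proof -
  have "partial a' (X a) * partial b' (X b) * G a' b' = (if b' = b then if a' = a then G a b else 0 else 0)" for a' b'
    by (simp add: partial_X)
  then show ?thesis by (simp add: biderivation_of_def)
qed

lemma skew_biderivation_of:
  assumes "\<And>a b. G a b = - G b a"
  shows "skew_biderivation (biderivation_of G)"
  unfolding skew_biderivation_def
proof (intro conjI allI)
  fix p q r c
  show "biderivation_of G (p + q) r = biderivation_of G p r + biderivation_of G q r"
    by (simp add: biderivation_of_def partial_add distrib_right sum.distrib)
  show "biderivation_of G (const c * p) q = const c * biderivation_of G p q"
    by (simp add: biderivation_of_def partial_const_mult sum_distrib_left mult.assoc)
  show "biderivation_of G (p * q) r = p * biderivation_of G q r + biderivation_of G p r * q"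
    by (simp add: biderivation_of_def partial_mult distrib_right distrib_left sum.distrib sum_distrib_left mult_ac)
  have "biderivation_of G p q = (\<Sum>b\<in>UNIV. \<Sum>a\<in>UNIV. - (partial b q * partial a p * G b a))"
    unfolding biderivation_of_def by (subst sum.swap, subst assms) (simp add: mult_ac)
  then show "biderivation_of G p q = - biderivation_of G q p"
    by (simp add: biderivation_of_def sum_negf)
qed

text \<open>In each argument separately a biderivation is a derivation, and a derivation is determined by
  its values on the coordinates.\<close>

lemma skew_biderivation_unique:
  assumes br: "skew_biderivation br"
  shows "br = biderivation_of (\<lambda>a b. br (X a) (X b))"
proof (intro ext)
  fix P Q
  note B = br[unfolded skew_biderivation_def]
  have left: "br P Q = (\<Sum>a\<in>UNIV. partial a P * br (X a) Q)" for P Q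
    using B by (intro derivation_eq[of "\<lambda>P. br P Q"]) blast+
  have "br (X a) Q = (\<Sum>b\<in>UNIV. partial b Q * br (X a) (X b))" for a
  proof -
    have "br (X a) Q = - br Q (X a)" using B by blast
    also have "\<dots> = (\<Sum>b\<in>UNIV. partial b Q * - br (X b) (X a))" by (simp add: left[of Q] sum_negf)
    also have "\<dots> = (\<Sum>b\<in>UNIV. partial b Q * br (X a) (X b))" using B by metis
    finally show ?thesis .
  qed
  then show "br P Q = biderivation_of (\<lambda>a b. br (X a) (X b)) P Q"
    unfolding left[of P Q] biderivation_of_def by (simp add: sum_distrib_left mult_ac)
qed

definition generator_matrix :: "laurent \<Rightarrow> quad \<Rightarrow> quad \<Rightarrow> sym_alg" where
  "generator_matrix F a b = (\<Sum>c\<in>Delta 3. const (lookup F c) * generator_bracket c a b)"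

lemma generator_matrix_skew: "generator_matrix F a b = - generator_matrix F b a"
proof -
  have "bracket_coeff a b c p q = - bracket_coeff b a c p q" for a b c p q
    by (simp add: bracket_coeff_eq)
  then have "generator_bracket c a b = - generator_bracket c b a" for c
    unfolding generator_bracket_def sum_negf[symmetric] by (intro sum.cong refl) (metis mult_minus_left of_int_minus)
  then show ?thesis unfolding generator_matrix_def sum_negf[symmetric] by (intro sum.cong refl) (metis mult_minus_right)
qed

lemma is_bracket_iff: "is_bracket F br \<longleftrightarrow> br = biderivation_of (generator_matrix F)"
proof
  assume "is_bracket F br"
  then have br: "skew_biderivation br" and "\<And>a b. br (X a) (X b) = generator_matrix F a b"
    by (auto simp: is_bracket_def generator_matrix_def)
  then have "(\<lambda>a b. br (X a) (X b)) = generator_matrix F" by blast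
  with skew_biderivation_unique[OF br] show "br = biderivation_of (generator_matrix F)" by simp
next
  assume "br = biderivation_of (generator_matrix F)"
  then show "is_bracket F br"
    using skew_biderivation_of[of "generator_matrix F", OF generator_matrix_skew]
    by (auto simp: is_bracket_def biderivation_of_X generator_matrix_def)
qed

lemma eval_generator_matrix: "eval (generator_matrix F a b) v = bracket_form F a b v"
  by (simp add: generator_matrix_def generator_bracket_def bracket_form_def eval_simps)

lemma partial_lin_form: "partial a (lin_form s) = const (lookup s (Rep_quad a))"
proof -
  have "partial a (lin_form s) = (\<Sum>b\<in>UNIV. if b = a then const (lookup s (Rep_quad a)) else 0)"
    unfolding lin_form_def partial_sum by (intro sum.cong refl) (auto simp: partial_const_mult partial_X)
  then show ?thesis by simp
qed

lemma eval_bracket_lin_forms: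
  assumes "F \<in> Hspace 3" "s \<in> Hspace 2" "t \<in> Hspace 2" "e \<in> V"
  shows "eval (biderivation_of (generator_matrix F) (lin_form s) (lin_form t)) e = Pi_F F e s t"
  using assms by (simp add: biderivation_of_def partial_lin_form eval_simps eval_generator_matrix Pi_F_bracket_form)

section \<open>Homogeneous polynomials\<close>

lemma homogeneous_0: "homogeneous k 0" by (simp add: homogeneous_def)
lemma homogeneous_add: "homogeneous k P \<Longrightarrow> homogeneous k Q \<Longrightarrow> homogeneous k (P + Q)"
  unfolding homogeneous_def using keys_add[of P Q] by blast
lemma homogeneous_sum: "(\<And>a. a \<in> A \<Longrightarrow> homogeneous k (f a)) \<Longrightarrow> homogeneous k (sum f A)"
  by (induction A rule: infinite_finite_induct) (auto intro: homogeneous_0 homogeneous_add)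
lemma homogeneous_mult:
  assumes "homogeneous k P" "homogeneous l Q"
  shows "homogeneous (k + l) (P * Q)"
  unfolding homogeneous_def
proof
  fix m assume m: "m \<in> keys (P * Q)"
  obtain p q where "m = p + q" "p \<in> keys P" "q \<in> keys Q" using subsetD[OF keys_mult m] by blast
  then show "(\<Sum>a\<in>UNIV. lookup m a) = k + l" using assms by (auto simp: homogeneous_def lookup_add sum.distrib)
qed
lemma homogeneous_const: "homogeneous 0 (const c)"
  by (auto simp: homogeneous_def const_def)
lemma homogeneous_const_mult: "homogeneous k P \<Longrightarrow> homogeneous k (const c * P)"
  using homogeneous_mult[OF homogeneous_const] by fastforce
lemma homogeneous_uminus: "homogeneous k P \<Longrightarrow> homogeneous k (- P)"
  by (simp add: homogeneous_def in_keys_iff)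
lemma homogeneous_diff: "homogeneous k P \<Longrightarrow> homogeneous k Q \<Longrightarrow> homogeneous k (P - Q)"
  using homogeneous_add[OF _ homogeneous_uminus] by fastforce
lemma homogeneous_X: "homogeneous 1 (X a)"
proof -
  have "(\<Sum>b\<in>UNIV. lookup (Poly_Mapping.single a (1::nat)) b) = (\<Sum>b\<in>UNIV. if b = a then 1 else 0)"
    by (rule sum.cong) (auto simp: lookup_single when_def)
  then show ?thesis by (simp add: homogeneous_def X_def)
qed

lemma homogeneous_generator_matrix: "homogeneous 2 (generator_matrix F a b)"
proof -
  have "homogeneous 2 (of_int n * X p * X q)" for n p q
    using homogeneous_mult[OF homogeneous_mult[OF homogeneous_const[of "of_int n"] homogeneous_X[of p]] homogeneous_X[of q]]
    by (simp add: const_simps numeral_2_eq_2)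
  then show ?thesis unfolding generator_matrix_def generator_bracket_def
    by (intro homogeneous_sum homogeneous_const_mult)
qed

lemma homogeneous_X_partial:
  assumes "homogeneous k P"
  shows "homogeneous k (X b * partial a P)"
  unfolding partial_def sum_distrib_left
proof (rule homogeneous_sum)
  fix m assume m: "m \<in> keys P"
  then have k: "(\<Sum>a\<in>UNIV. lookup m a) = k" using assms by (simp add: homogeneous_def)
  show "homogeneous k (X b * Poly_Mapping.single (m - Poly_Mapping.single a 1) (of_nat (lookup m a) * lookup P m))"
  proof (cases "lookup m a = 0")
    case False
    have sa: "(\<Sum>c\<in>UNIV. lookup (Poly_Mapping.single a (1::nat)) c) = 1" for a :: quad
      using homogeneous_X[of a] by (simp add: homogeneous_def X_def)
    have "m = (m - Poly_Mapping.single a 1) + Poly_Mapping.single a 1"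
      using False by (intro poly_mapping_eqI) (auto simp: lookup_add lookup_minus lookup_single when_def)
    then have "k = (\<Sum>c\<in>UNIV. lookup (m - Poly_Mapping.single a 1) c) + 1"
      using k sa[of a] by (metis (no_types, lifting) lookup_add sum.cong sum.distrib)
    then show ?thesis using sa[of b]
      by (auto simp: homogeneous_def X_def mult_single lookup_add sum.distrib split: if_splits)
  qed (simp add: homogeneous_0)
qed

lemma euler:
  assumes "homogeneous k P"
  shows "(\<Sum>a\<in>UNIV. X a * partial a P) = of_nat k * P"
proof -
  have "X a * partial a P = (\<Sum>m\<in>keys P. Poly_Mapping.single m (of_nat (lookup m a) * lookup P m))" for a
    unfolding partial_def sum_distrib_left
  proof (rule sum.cong)
    fix m
    show "X a * Poly_Mapping.single (m - Poly_Mapping.single a 1) (of_nat (lookup m a) * lookup P m) =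
      Poly_Mapping.single m (of_nat (lookup m a) * lookup P m)"
    proof (cases "lookup m a = 0")
      case False
      then have "Poly_Mapping.single a 1 + (m - Poly_Mapping.single a 1) = m"
        by (intro poly_mapping_eqI) (auto simp: lookup_add lookup_minus lookup_single when_def)
      then show ?thesis by (simp add: X_def mult_single)
    qed simp
  qed simp
  then have "(\<Sum>a\<in>UNIV. X a * partial a P) = (\<Sum>m\<in>keys P. \<Sum>a\<in>UNIV. Poly_Mapping.single m (of_nat (lookup m a) * lookup P m))"
    by (simp add: sum.swap[of _ "keys P"])
  also have "\<dots> = (\<Sum>m\<in>keys P. Poly_Mapping.single m (of_nat k * lookup P m))"
  proof (rule sum.cong)
    fix m assume "m \<in> keys P"
    then have k: "(\<Sum>a\<in>UNIV. lookup m a) = k" using assms by (simp add: homogeneous_def)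
    have "(\<Sum>a\<in>UNIV. Poly_Mapping.single m (of_nat (lookup m a) * lookup P m)) = Poly_Mapping.single m (\<Sum>a\<in>UNIV. of_nat (lookup m a) * lookup P m)"
      by (intro poly_mapping_eqI) (auto simp: lookup_sum lookup_single when_def)
    then show "(\<Sum>a\<in>UNIV. Poly_Mapping.single m (of_nat (lookup m a) * lookup P m)) = Poly_Mapping.single m (of_nat k * lookup P m)"
      by (simp flip: k sum_distrib_right of_nat_sum)
  qed simp
  also have "\<dots> = const (of_nat k) * (\<Sum>m\<in>keys P. Poly_Mapping.single m (lookup P m))"
    unfolding sum_distrib_left const_def mult_single by simp
  also have "(\<Sum>m\<in>keys P. Poly_Mapping.single m (lookup P m)) = P"
    by (rule poly_mapping_sum_single[symmetric]) simp_all
  finally show ?thesis by (simp add: const_simps)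
qed

section \<open>Brackets of the coordinates\<close>

definition qd :: "nat \<Rightarrow> quad" where
  "qd n = Abs_quad ([vec3 2 0 0, vec3 1 1 0, vec3 1 0 1, vec3 0 2 0, vec3 0 1 1, vec3 0 0 2] ! n)"

lemma Rep_qd:
  "Rep_quad (qd 0) = vec3 2 0 0" "Rep_quad (qd 1) = vec3 1 1 0" "Rep_quad (qd 2) = vec3 1 0 1"
  "Rep_quad (qd 3) = vec3 0 2 0" "Rep_quad (qd 4) = vec3 0 1 1" "Rep_quad (qd 5) = vec3 0 0 2"
  by (simp_all add: qd_def Abs_quad_inverse Delta_2)

lemma qd_distinct:
  "qd 0 \<noteq> qd 1" "qd 0 \<noteq> qd 2" "qd 0 \<noteq> qd 3" "qd 0 \<noteq> qd 4" "qd 0 \<noteq> qd 5"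
  "qd 1 \<noteq> qd 2" "qd 1 \<noteq> qd 3" "qd 1 \<noteq> qd 4" "qd 1 \<noteq> qd 5" "qd 2 \<noteq> qd 3" "qd 2 \<noteq> qd 4" "qd 2 \<noteq> qd 5"
  "qd 3 \<noteq> qd 4" "qd 3 \<noteq> qd 5" "qd 4 \<noteq> qd 5"
  by (simp_all only: Rep_quad_inject[symmetric] Rep_qd vec3_eq_iff) simp_all

lemma UNIV_quad: "UNIV = {qd 0, qd 1, qd 2, qd 3, qd 4, qd 5}"
proof -
  have "a \<in> {qd 0, qd 1, qd 2, qd 3, qd 4, qd 5}" for a
    using Rep_quad[of a] unfolding Delta_2 by (auto simp: Rep_qd[symmetric] Rep_quad_inject)
  then show ?thesis by blast
qed

lemma sum_UNIV_quad:
  fixes f :: "quad \<Rightarrow> 'a :: comm_monoid_add"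
  shows "(\<Sum>a\<in>UNIV. f a) = f (qd 0) + (f (qd 1) + (f (qd 2) + (f (qd 3) + (f (qd 4) + f (qd 5)))))"
  unfolding UNIV_quad by (simp add: qd_distinct del: One_nat_def)

lemma sum_Delta_3:
  fixes f :: "exps \<Rightarrow> 'a :: comm_monoid_add"
  shows "(\<Sum>c\<in>Delta 3. f c) = f (vec3 3 0 0) + (f (vec3 2 1 0) + (f (vec3 2 0 1) + (f (vec3 1 2 0) +
    (f (vec3 1 1 1) + (f (vec3 1 0 2) + (f (vec3 0 3 0) + (f (vec3 0 2 1) + (f (vec3 0 1 2) + f (vec3 0 0 3)))))))))"
  unfolding Delta_3 by simp

lemma rho_vec3: "rho (vec3 a0 a1 a2) (vec3 b0 b1 b2) (vec3 c0 c1 c2) (vec3 p0 p1 p2) (vec3 q0 q1 q2) =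
  (if p0 < a0 then if a1 \<le> p1 then if p1 < a1 + b1 then if a2 + b2 \<le> p2 then if p2 < a2 + b2 + c2
   then if p0 + q0 + 1 = a0 + b0 + c0 then if p1 + q1 + 1 = a1 + b1 + c1
   then 1 else 0 else 0 else 0 else 0 else 0 else 0 else 0)"
  by (auto simp: rho_def)

lemma generator_matrix_table:
  "generator_matrix F (qd 0) (qd 1) = const (lookup F (vec3 1 0 2)) * (- X (qd 0) * X (qd 2)) +
     const (lookup F (vec3 0 1 2)) * (- X (qd 1) * X (qd 2)) +
     const (lookup F (vec3 0 0 3)) * (- X (qd 0) * X (qd 5) - X (qd 2) * X (qd 2))"
  "generator_matrix F (qd 0) (qd 2) = const (lookup F (vec3 1 2 0)) * (X (qd 0) * X (qd 1)) +
     const (lookup F (vec3 1 1 1)) * (X (qd 0) * X (qd 2)) +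
     const (lookup F (vec3 0 3 0)) * (X (qd 0) * X (qd 3) + X (qd 1) * X (qd 1)) +
     const (lookup F (vec3 0 2 1)) * (X (qd 0) * X (qd 4) + X (qd 1) * X (qd 2)) +
     const (lookup F (vec3 0 1 2)) * (X (qd 0) * X (qd 5))"
  "generator_matrix F (qd 0) (qd 3) = const (lookup F (vec3 2 0 1)) * (- X (qd 0) * X (qd 1)) +
     const (lookup F (vec3 1 1 1)) * (- X (qd 1) * X (qd 1)) +
     const (lookup F (vec3 1 0 2)) * (- X (qd 0) * X (qd 4) - 2 * X (qd 1) * X (qd 2)) +
     const (lookup F (vec3 0 2 1)) * (- X (qd 1) * X (qd 3)) +
     const (lookup F (vec3 0 1 2)) * (- 2 * X (qd 1) * X (qd 4) - X (qd 2) * X (qd 3)) +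
     const (lookup F (vec3 0 0 3)) * (- 2 * X (qd 1) * X (qd 5) - 2 * X (qd 2) * X (qd 4))"
  "generator_matrix F (qd 0) (qd 4) = const (lookup F (vec3 2 0 1)) * (- X (qd 0) * X (qd 2)) +
     const (lookup F (vec3 1 2 0)) * (X (qd 1) * X (qd 1)) +
     const (lookup F (vec3 1 0 2)) * (- X (qd 0) * X (qd 5) - X (qd 2) * X (qd 2)) +
     const (lookup F (vec3 0 3 0)) * (2 * X (qd 1) * X (qd 3)) +
     const (lookup F (vec3 0 2 1)) * (X (qd 1) * X (qd 4)) +
     const (lookup F (vec3 0 1 2)) * (- X (qd 2) * X (qd 4)) +
     const (lookup F (vec3 0 0 3)) * (- 2 * X (qd 2) * X (qd 5))"
  "generator_matrix F (qd 0) (qd 5) = const (lookup F (vec3 2 1 0)) * (X (qd 0) * X (qd 2)) +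
     const (lookup F (vec3 1 2 0)) * (X (qd 0) * X (qd 4) + 2 * X (qd 1) * X (qd 2)) +
     const (lookup F (vec3 1 1 1)) * (X (qd 0) * X (qd 5) + X (qd 2) * X (qd 2)) +
     const (lookup F (vec3 0 3 0)) * (2 * X (qd 1) * X (qd 4) + 2 * X (qd 2) * X (qd 3)) +
     const (lookup F (vec3 0 2 1)) * (X (qd 1) * X (qd 5) + 2 * X (qd 2) * X (qd 4)) +
     const (lookup F (vec3 0 1 2)) * (X (qd 2) * X (qd 5))"
  "generator_matrix F (qd 1) (qd 2) = const (lookup F (vec3 3 0 0)) * (- X (qd 0) * X (qd 0)) +
     const (lookup F (vec3 2 1 0)) * (- X (qd 0) * X (qd 1)) +
     const (lookup F (vec3 2 0 1)) * (- X (qd 0) * X (qd 2)) +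
     const (lookup F (vec3 0 3 0)) * (X (qd 1) * X (qd 3)) +
     const (lookup F (vec3 0 2 1)) * (X (qd 1) * X (qd 4)) +
     const (lookup F (vec3 0 1 2)) * (X (qd 1) * X (qd 5)) +
     const (lookup F (vec3 0 0 3)) * (X (qd 2) * X (qd 5))"
  "generator_matrix F (qd 1) (qd 3) = const (lookup F (vec3 2 0 1)) * (- X (qd 0) * X (qd 3)) +
     const (lookup F (vec3 1 1 1)) * (- X (qd 1) * X (qd 3)) +
     const (lookup F (vec3 1 0 2)) * (- X (qd 1) * X (qd 4) - X (qd 2) * X (qd 3)) +
     const (lookup F (vec3 0 2 1)) * (- X (qd 3) * X (qd 3)) +
     const (lookup F (vec3 0 1 2)) * (- 2 * X (qd 3) * X (qd 4)) +
     const (lookup F (vec3 0 0 3)) * (- X (qd 3) * X (qd 5) - X (qd 4) * X (qd 4))"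
  "generator_matrix F (qd 1) (qd 4) = const (lookup F (vec3 3 0 0)) * (- X (qd 0) * X (qd 1)) +
     const (lookup F (vec3 2 1 0)) * (- X (qd 1) * X (qd 1)) +
     const (lookup F (vec3 2 0 1)) * (- X (qd 0) * X (qd 4) - X (qd 1) * X (qd 2)) +
     const (lookup F (vec3 1 1 1)) * (- X (qd 1) * X (qd 4)) +
     const (lookup F (vec3 1 0 2)) * (- X (qd 1) * X (qd 5) - X (qd 2) * X (qd 4)) +
     const (lookup F (vec3 0 3 0)) * (X (qd 3) * X (qd 3)) +
     const (lookup F (vec3 0 1 2)) * (- X (qd 4) * X (qd 4)) +
     const (lookup F (vec3 0 0 3)) * (- X (qd 4) * X (qd 5))"
  "generator_matrix F (qd 1) (qd 5) = const (lookup F (vec3 3 0 0)) * (- 2 * X (qd 0) * X (qd 2)) +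
     const (lookup F (vec3 2 1 0)) * (- X (qd 1) * X (qd 2)) +
     const (lookup F (vec3 2 0 1)) * (- X (qd 0) * X (qd 5) - X (qd 2) * X (qd 2)) +
     const (lookup F (vec3 1 2 0)) * (X (qd 1) * X (qd 4)) +
     const (lookup F (vec3 1 0 2)) * (- X (qd 2) * X (qd 5)) +
     const (lookup F (vec3 0 3 0)) * (2 * X (qd 3) * X (qd 4)) +
     const (lookup F (vec3 0 2 1)) * (X (qd 4) * X (qd 4))"
  "generator_matrix F (qd 2) (qd 3) = const (lookup F (vec3 3 0 0)) * (2 * X (qd 0) * X (qd 1)) +
     const (lookup F (vec3 2 1 0)) * (X (qd 0) * X (qd 3) + X (qd 1) * X (qd 1)) +
     const (lookup F (vec3 2 0 1)) * (X (qd 1) * X (qd 2)) +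
     const (lookup F (vec3 1 2 0)) * (X (qd 1) * X (qd 3)) +
     const (lookup F (vec3 1 0 2)) * (- X (qd 2) * X (qd 4)) +
     const (lookup F (vec3 0 2 1)) * (- X (qd 3) * X (qd 4)) +
     const (lookup F (vec3 0 1 2)) * (- X (qd 3) * X (qd 5) - X (qd 4) * X (qd 4)) +
     const (lookup F (vec3 0 0 3)) * (- 2 * X (qd 4) * X (qd 5))"
  "generator_matrix F (qd 2) (qd 4) = const (lookup F (vec3 3 0 0)) * (X (qd 0) * X (qd 2)) +
     const (lookup F (vec3 2 1 0)) * (X (qd 0) * X (qd 4)) +
     const (lookup F (vec3 1 2 0)) * (X (qd 1) * X (qd 4)) +
     const (lookup F (vec3 1 0 2)) * (- X (qd 2) * X (qd 5)) +
     const (lookup F (vec3 0 3 0)) * (X (qd 3) * X (qd 4)) +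
     const (lookup F (vec3 0 1 2)) * (- X (qd 4) * X (qd 5)) +
     const (lookup F (vec3 0 0 3)) * (- X (qd 5) * X (qd 5))"
  "generator_matrix F (qd 2) (qd 5) = const (lookup F (vec3 2 1 0)) * (X (qd 0) * X (qd 5)) +
     const (lookup F (vec3 1 2 0)) * (X (qd 1) * X (qd 5) + X (qd 2) * X (qd 4)) +
     const (lookup F (vec3 1 1 1)) * (X (qd 2) * X (qd 5)) +
     const (lookup F (vec3 0 3 0)) * (X (qd 3) * X (qd 5) + X (qd 4) * X (qd 4)) +
     const (lookup F (vec3 0 2 1)) * (X (qd 4) * X (qd 5))"
  "generator_matrix F (qd 3) (qd 4) = const (lookup F (vec3 3 0 0)) * (- X (qd 0) * X (qd 3) - X (qd 1) * X (qd 1)) +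
     const (lookup F (vec3 2 1 0)) * (- 2 * X (qd 1) * X (qd 3)) +
     const (lookup F (vec3 2 0 1)) * (- X (qd 1) * X (qd 4) - X (qd 2) * X (qd 3)) +
     const (lookup F (vec3 1 2 0)) * (- X (qd 3) * X (qd 3)) +
     const (lookup F (vec3 1 1 1)) * (- X (qd 3) * X (qd 4)) +
     const (lookup F (vec3 1 0 2)) * (- X (qd 3) * X (qd 5))"
  "generator_matrix F (qd 3) (qd 5) = const (lookup F (vec3 3 0 0)) * (- 2 * X (qd 0) * X (qd 4) - 2 * X (qd 1) * X (qd 2)) +
     const (lookup F (vec3 2 1 0)) * (- 2 * X (qd 1) * X (qd 4) - X (qd 2) * X (qd 3)) +
     const (lookup F (vec3 2 0 1)) * (- X (qd 1) * X (qd 5) - 2 * X (qd 2) * X (qd 4)) +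
     const (lookup F (vec3 1 2 0)) * (- X (qd 3) * X (qd 4)) +
     const (lookup F (vec3 1 1 1)) * (- X (qd 4) * X (qd 4)) +
     const (lookup F (vec3 1 0 2)) * (- X (qd 4) * X (qd 5))"
  "generator_matrix F (qd 4) (qd 5) = const (lookup F (vec3 3 0 0)) * (- X (qd 0) * X (qd 5) - X (qd 2) * X (qd 2)) +
     const (lookup F (vec3 2 1 0)) * (- X (qd 2) * X (qd 4)) +
     const (lookup F (vec3 2 0 1)) * (- X (qd 2) * X (qd 5))"
  unfolding generator_matrix_def generator_bracket_def sum_UNIV_quad sum_Delta_3 Rep_qd bracket_coeff_eq rho_vec3
  by (simp_all add: const_simps algebra_simps)

section \<open>A Poisson bracket on the cone\<close>

text \<open>Three times the linear vector field \<open>\<lambda>\<close> by which the bracket has to be modified.  It is found by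
  comparing coefficients with the equivariant bracket
  \<open>- 6 det(u,v,f) ((u v) (f f) + (u f) (v f))\<close>; the factor 3 clears denominators.\<close>

definition lift_correction :: "laurent \<Rightarrow> quad \<Rightarrow> sym_alg" where
  "lift_correction F a =
    (if a = qd 0 then const (lookup F (vec3 0 1 2)) * X (qd 2) - const (lookup F (vec3 0 2 1)) * X (qd 1)
       - const (2 * lookup F (vec3 1 1 1)) * X (qd 0)
     else if a = qd 1 then const (2 * lookup F (vec3 2 0 1)) * X (qd 0) + const (lookup F (vec3 1 0 2)) * X (qd 2)
       + const (lookup F (vec3 0 2 1)) * X (qd 3) + const (2 * lookup F (vec3 0 1 2)) * X (qd 4)
     else if a = qd 2 then const (lookup F (vec3 0 2 1)) * X (qd 4) + const (2 * lookup F (vec3 0 1 2)) * X (qd 5)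
       - const (2 * lookup F (vec3 2 1 0)) * X (qd 0) - const (lookup F (vec3 1 2 0)) * X (qd 1) - const (lookup F (vec3 1 1 1)) * X (qd 2)
     else if a = qd 3 then const (lookup F (vec3 2 0 1)) * X (qd 1) - const (lookup F (vec3 1 1 1)) * X (qd 3)
       - const (lookup F (vec3 1 0 2)) * X (qd 4)
     else if a = qd 4 then - const (2 * lookup F (vec3 2 1 0)) * X (qd 1) - const (lookup F (vec3 2 0 1)) * X (qd 2)
       - const (lookup F (vec3 1 2 0)) * X (qd 3) - const (2 * lookup F (vec3 1 1 1)) * X (qd 4) - const (2 * lookup F (vec3 1 0 2)) * X (qd 5)
     else const (lookup F (vec3 1 2 0)) * X (qd 4) - const (lookup F (vec3 2 1 0)) * X (qd 2))"

definition lift_matrix :: "laurent \<Rightarrow> quad \<Rightarrow> quad \<Rightarrow> sym_alg" where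
  "lift_matrix F a b = const 3 * generator_matrix F a b + X b * lift_correction F a - X a * lift_correction F b"

lemma lift_correction_qd:
  "lift_correction F (qd 0) = const (lookup F (vec3 0 1 2)) * X (qd 2) - const (lookup F (vec3 0 2 1)) * X (qd 1)
       - const (2 * lookup F (vec3 1 1 1)) * X (qd 0)"
  "lift_correction F (qd 1) = const (2 * lookup F (vec3 2 0 1)) * X (qd 0) + const (lookup F (vec3 1 0 2)) * X (qd 2)
       + const (lookup F (vec3 0 2 1)) * X (qd 3) + const (2 * lookup F (vec3 0 1 2)) * X (qd 4)"
  "lift_correction F (qd 2) = const (lookup F (vec3 0 2 1)) * X (qd 4) + const (2 * lookup F (vec3 0 1 2)) * X (qd 5)
       - const (2 * lookup F (vec3 2 1 0)) * X (qd 0) - const (lookup F (vec3 1 2 0)) * X (qd 1) - const (lookup F (vec3 1 1 1)) * X (qd 2)"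
  "lift_correction F (qd 3) = const (lookup F (vec3 2 0 1)) * X (qd 1) - const (lookup F (vec3 1 1 1)) * X (qd 3)
       - const (lookup F (vec3 1 0 2)) * X (qd 4)"
  "lift_correction F (qd 4) = - const (2 * lookup F (vec3 2 1 0)) * X (qd 1) - const (lookup F (vec3 2 0 1)) * X (qd 2)
       - const (lookup F (vec3 1 2 0)) * X (qd 3) - const (2 * lookup F (vec3 1 1 1)) * X (qd 4) - const (2 * lookup F (vec3 1 0 2)) * X (qd 5)"
  "lift_correction F (qd 5) = const (lookup F (vec3 1 2 0)) * X (qd 4) - const (lookup F (vec3 2 1 0)) * X (qd 2)"
  unfolding lift_correction_def using qd_distinct by presburger+

lemma generator_matrix_diag: "generator_matrix F a a = 0"
  by (simp add: generator_matrix_def generator_bracket_def bracket_coeff_eq)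

lemma lift_matrix_skew: "lift_matrix F a b = - lift_matrix F b a"
  by (subst lift_matrix_def, subst generator_matrix_skew) (simp add: lift_matrix_def)

lemma generator_matrix_table_flip:
  "generator_matrix F (qd 1) (qd 0) = - generator_matrix F (qd 0) (qd 1)"
  "generator_matrix F (qd 2) (qd 0) = - generator_matrix F (qd 0) (qd 2)"
  "generator_matrix F (qd 3) (qd 0) = - generator_matrix F (qd 0) (qd 3)"
  "generator_matrix F (qd 4) (qd 0) = - generator_matrix F (qd 0) (qd 4)"
  "generator_matrix F (qd 5) (qd 0) = - generator_matrix F (qd 0) (qd 5)"
  "generator_matrix F (qd 2) (qd 1) = - generator_matrix F (qd 1) (qd 2)"
  "generator_matrix F (qd 3) (qd 1) = - generator_matrix F (qd 1) (qd 3)"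
  "generator_matrix F (qd 4) (qd 1) = - generator_matrix F (qd 1) (qd 4)"
  "generator_matrix F (qd 5) (qd 1) = - generator_matrix F (qd 1) (qd 5)"
  "generator_matrix F (qd 3) (qd 2) = - generator_matrix F (qd 2) (qd 3)"
  "generator_matrix F (qd 4) (qd 2) = - generator_matrix F (qd 2) (qd 4)"
  "generator_matrix F (qd 5) (qd 2) = - generator_matrix F (qd 2) (qd 5)"
  "generator_matrix F (qd 4) (qd 3) = - generator_matrix F (qd 3) (qd 4)"
  "generator_matrix F (qd 5) (qd 3) = - generator_matrix F (qd 3) (qd 5)"
  "generator_matrix F (qd 5) (qd 4) = - generator_matrix F (qd 4) (qd 5)"
  by (rule generator_matrix_skew)+

text \<open>For the value \<open>w\<close> at \<open>v\<close> of the Hamiltonian vector field of the coordinate \<open>a\<close> this is the bracket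
  with \<open>X a\<close>, so that the Jacobiator becomes a sum of three directional derivatives.\<close>

definition directional :: "laurent \<Rightarrow> (quad \<Rightarrow> complex) \<Rightarrow> sym_alg \<Rightarrow> complex" where
  "directional v w P = (\<Sum>a\<in>UNIV. eval (partial a P) v * w a)"

lemma directional_const: "directional v w (const c) = 0" by (simp add: directional_def partial_const eval_0)
lemma directional_0: "directional v w 0 = 0" by (simp add: directional_def partial_0 eval_0)
lemma directional_add: "directional v w (P + Q) = directional v w P + directional v w Q"
  by (simp add: directional_def partial_add eval_add distrib_right sum.distrib)
lemma directional_diff: "directional v w (P - Q) = directional v w P - directional v w Q"
  by (simp add: directional_def partial_diff eval_diff left_diff_distrib sum_subtractf)
lemma directional_uminus: "directional v w (- P) = - directional v w P"
  by (simp add: directional_def partial_uminus eval_uminus sum_negf)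
lemma directional_mult: "directional v w (P * Q) = directional v w P * eval Q v + eval P v * directional v w Q"
  by (simp add: directional_def partial_mult eval_add eval_mult sum.distrib sum_distrib_left algebra_simps)
lemma directional_X: "directional v w (X a) = w a"
proof -
  have "eval (partial b (X a)) v * w b = (if b = a then w a else 0)" for b by (simp add: partial_X eval_simps)
  then show ?thesis by (simp add: directional_def)
qed
lemma eval_numeral: "eval (numeral n) v = numeral n"
  using eval_of_nat[of "numeral n" v] by simp
lemma directional_numeral: "directional v w (numeral n) = 0"
  using directional_const[of v w "of_nat (numeral n)"] unfolding const_simps by simp
lemmas directional_simps = directional_const directional_0 directional_add directional_diff directional_uminus directional_mult directional_X directional_numeral

definition jacobiator :: "laurent \<Rightarrow> laurent \<Rightarrow> quad \<Rightarrow> quad \<Rightarrow> quad \<Rightarrow> complex" where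
  "jacobiator F v a b c = directional v (\<lambda>d. eval (lift_matrix F a d) v) (lift_matrix F b c)
     + directional v (\<lambda>d. eval (lift_matrix F b d) v) (lift_matrix F c a)
     + directional v (\<lambda>d. eval (lift_matrix F c d) v) (lift_matrix F a b)"

text \<open>Polynomial identities, quadratic in the coefficients of \<open>F\<close> and cubic in the coordinates of \<open>v\<close>.\<close>

lemma jacobiator_table:
  "jacobiator F v (qd 0) (qd 1) (qd 2) = 0"
  "jacobiator F v (qd 0) (qd 1) (qd 3) = 0"
  "jacobiator F v (qd 0) (qd 1) (qd 4) = 0"
  "jacobiator F v (qd 0) (qd 1) (qd 5) = 0"
  "jacobiator F v (qd 0) (qd 2) (qd 3) = 0"
  "jacobiator F v (qd 0) (qd 2) (qd 4) = 0"
  "jacobiator F v (qd 0) (qd 2) (qd 5) = 0"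
  "jacobiator F v (qd 0) (qd 3) (qd 4) = 0"
  "jacobiator F v (qd 0) (qd 3) (qd 5) = 0"
  "jacobiator F v (qd 0) (qd 4) (qd 5) = 0"
  "jacobiator F v (qd 1) (qd 2) (qd 3) = 0"
  "jacobiator F v (qd 1) (qd 2) (qd 4) = 0"
  "jacobiator F v (qd 1) (qd 2) (qd 5) = 0"
  "jacobiator F v (qd 1) (qd 3) (qd 4) = 0"
  "jacobiator F v (qd 1) (qd 3) (qd 5) = 0"
  "jacobiator F v (qd 1) (qd 4) (qd 5) = 0"
  "jacobiator F v (qd 2) (qd 3) (qd 4) = 0"
  "jacobiator F v (qd 2) (qd 3) (qd 5) = 0"
  "jacobiator F v (qd 2) (qd 4) (qd 5) = 0"
  "jacobiator F v (qd 3) (qd 4) (qd 5) = 0"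
  unfolding jacobiator_def lift_matrix_def generator_matrix_table_flip generator_matrix_table generator_matrix_diag lift_correction_qd
    directional_simps eval_simps eval_numeral
  by algebra+

lemma jacobiator_rotate: "jacobiator F v a b c = 0 \<Longrightarrow> jacobiator F v b c a = 0"
  by (simp add: jacobiator_def add_ac)

lemma jacobiator_swap: "jacobiator F v a b c = 0 \<Longrightarrow> jacobiator F v b a c = 0"
proof -
  have "jacobiator F v b a c = - jacobiator F v a b c"
    unfolding jacobiator_def lift_matrix_skew[of F a c] lift_matrix_skew[of F c b] lift_matrix_skew[of F b a] directional_uminus
    by simp
  then show "jacobiator F v a b c = 0 \<Longrightarrow> jacobiator F v b a c = 0" by simp
qed

lemma jacobiator_repeat: "jacobiator F v a a c = 0"
proof -
  have "lift_matrix F a a = 0" by (simp add: lift_matrix_def generator_matrix_diag)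
  then show ?thesis unfolding jacobiator_def lift_matrix_skew[of F c a] directional_uminus by (simp add: directional_0)
qed

text \<open>The Jacobiator is alternating, so increasing triples of coordinates suffice.\<close>

lemma jacobiator_zero: "jacobiator F v a b c = 0"
proof -
  note rep = jacobiator_repeat jacobiator_repeat[THEN jacobiator_rotate] jacobiator_repeat[THEN jacobiator_rotate, THEN jacobiator_rotate]
  note even = jacobiator_table jacobiator_table[THEN jacobiator_rotate] jacobiator_table[THEN jacobiator_rotate, THEN jacobiator_rotate]
  note odd = even[THEN jacobiator_swap]
  have "\<forall>a\<in>UNIV. \<forall>b\<in>UNIV. \<forall>c\<in>UNIV. jacobiator F v a b c = 0"
    unfolding UNIV_quad by (simp add: rep even odd del: One_nat_def)
  then show ?thesis by blast
qed

section \<open>Regular functions on the charts\<close>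

text \<open>The numerator of the derivative of a fraction: on the chart \<open>X a \<noteq> 0\<close> the partial derivative of
  \<open>P / X a ^ k\<close> is \<open>chart_partial a i k P / X a ^ (k + 1)\<close>.\<close>

definition chart_partial :: "quad \<Rightarrow> quad \<Rightarrow> nat \<Rightarrow> sym_alg \<Rightarrow> sym_alg" where
  "chart_partial a i k P = X a * partial i P - (if i = a then of_nat k * P else 0)"

lemma chart_partial_add: "chart_partial a i k (P + Q) = chart_partial a i k P + chart_partial a i k Q"
  by (simp add: chart_partial_def partial_add algebra_simps)
lemma chart_partial_0: "chart_partial a i k 0 = 0"
  by (simp add: chart_partial_def partial_0)
lemma chart_partial_sum: "chart_partial a i k (sum f A) = (\<Sum>x\<in>A. chart_partial a i k (f x))"
  by (induction A rule: infinite_finite_induct) (simp_all add: chart_partial_add chart_partial_0)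
lemma chart_partial_const_mult: "chart_partial a i k (const c * P) = const c * chart_partial a i k P"
  by (simp add: chart_partial_def partial_const_mult right_diff_distrib mult.left_commute)
lemma chart_partial_mult: "chart_partial a i (k + l) (P * Q) = chart_partial a i k P * Q + P * chart_partial a i l Q"
  by (simp add: chart_partial_def partial_mult algebra_simps)
lemma chart_partial_weight_0: "chart_partial a i 0 P = X a * partial i P"
  by (simp add: chart_partial_def)
lemma chart_partial_commute: "chart_partial a i (k + 1) (chart_partial a j k P) = chart_partial a j (k + 1) (chart_partial a i k P)"
  by (simp add: chart_partial_def partial_diff partial_mult partial_X partial_of_nat partial_0 partial_commute[of i j] algebra_simps)
lemma homogeneous_chart_partial:
  assumes "homogeneous k P"
  shows "homogeneous k (chart_partial a i k P)"
  using homogeneous_X_partial[OF assms, of a i] homogeneous_const_mult[OF assms, of "of_nat k"] homogeneous_0[of k]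
  by (simp add: chart_partial_def homogeneous_diff const_simps)

text \<open>The fraction \<open>P / X a ^ k\<close> has degree 0, so the Euler field annihilates it.\<close>

lemma euler_chart_partial:
  assumes "homogeneous k P"
  shows "(\<Sum>i\<in>UNIV. X i * chart_partial a i k P) = 0"
proof -
  have "X i * chart_partial a i k P = X a * (X i * partial i P) - (if i = a then X a * (of_nat k * P) else 0)" for i
    by (simp add: chart_partial_def algebra_simps)
  then have "(\<Sum>i\<in>UNIV. X i * chart_partial a i k P) = X a * (\<Sum>i\<in>UNIV. X i * partial i P) - X a * (of_nat k * P)"
    by (simp add: sum_subtractf sum_distrib_left)
  then show ?thesis by (simp add: euler[OF assms])
qed

definition represents :: "quad \<Rightarrow> (laurent \<Rightarrow> complex) \<Rightarrow> nat \<Rightarrow> sym_alg \<Rightarrow> bool" where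
  "represents a f k P \<longleftrightarrow> (\<forall>v\<in>V. coord a v \<noteq> 0 \<longrightarrow> f v = eval P v / coord a v ^ k)"

lemma regular_iff: "regular a f \<longleftrightarrow> (\<exists>k P. homogeneous k P \<and> represents a f k P)"
  by (simp add: regular_def represents_def)

lemma coord_translate: "coord a (v + Poly_Mapping.single (minus_one_vec - Rep_quad i) z) = coord a v + (if a = i then z else 0)"
  by (simp add: coord_lookup lookup_add lookup_single when_def Rep_quad_inject)

lemma DERIV_eval:
  "((\<lambda>z. eval P (v + Poly_Mapping.single (minus_one_vec - Rep_quad i) z)) has_field_derivative eval (partial i P) v) (at 0)"
proof (induction P rule: sym_alg_induct)
  case (const c) then show ?case by (simp add: eval_simps partial_const)
next
  case (X a) then show ?case
    by (cases "a = i") (auto simp: eval_simps partial_X coord_translate intro!: derivative_eq_intros)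
next
  case (add p q) then show ?case by (simp add: eval_add partial_add DERIV_add)
next
  case (mult p q)
  from DERIV_mult[OF mult] show ?case by (simp add: eval_mult eval_add partial_mult algebra_simps)
qed

lemma V_translate: "v \<in> V \<Longrightarrow> v + Poly_Mapping.single (minus_one_vec - Rep_quad i) z \<in> V"
proof -
  assume v: "v \<in> V"
  have "minus_one_vec - Rep_quad i \<in> Delta (- 5)"
    using Rep_quad[of i] by (auto simp: Delta_def minus_one_vec_def sum_3 all_3)
  then have "keys (Poly_Mapping.single (minus_one_vec - Rep_quad i) z) \<subseteq> Delta (- 5)" by simp
  then show ?thesis using v keys_add[of v "Poly_Mapping.single (minus_one_vec - Rep_quad i) z"]
    by (auto simp: Hspace_def)
qed

lemma partial_power_X: "partial i (X a ^ k) = (if i = a then of_nat k * X a ^ (k - 1) else 0)"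
proof (induction k)
  case (Suc k) then show ?case by (cases k) (auto simp: partial_mult partial_X algebra_simps partial_1 partial_0)
qed (simp add: partial_1)

lemma lookup_differential: "lookup (differential f v) (Rep_quad i) =
  deriv (\<lambda>z. f (v + Poly_Mapping.single (minus_one_vec - Rep_quad i) z)) 0"
proof -
  let ?d = "\<lambda>a. deriv (\<lambda>z. f (v + Poly_Mapping.single (minus_one_vec - a) z)) 0"
  have "lookup (differential f v) (Rep_quad i) = (\<Sum>a\<in>Delta 2. if a = Rep_quad i then ?d (Rep_quad i) else 0)"
    unfolding differential_def lookup_sum lookup_single by (rule sum.cong) (auto simp: when_def)
  then show ?thesis using Rep_quad[of i] finite_Delta_2 by simp
qed

lemma differential_Hspace: "differential f v \<in> Hspace 2"
proof -
  have "e \<in> Delta 2" if "e \<in> keys (differential f v)" for e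
  proof (rule ccontr)
    assume "e \<notin> Delta 2"
    then have "lookup (differential f v) e = 0"
      unfolding differential_def lookup_sum lookup_single by (intro sum.neutral) (auto simp: when_def)
    with that show False by (simp add: in_keys_iff)
  qed
  then show ?thesis by (auto simp: Hspace_def)
qed

text \<open>A regular function is prescribed only on the chart, but the chart is open in \<open>V\<close>, so near 0 the
  translates of \<open>v\<close> stay in it.\<close>

lemma differential_represents:
  assumes f: "represents a f k P" and v: "v \<in> V" "coord a v \<noteq> 0"
  shows "lookup (differential f v) (Rep_quad i) = eval (chart_partial a i k P) v / coord a v ^ (k + 1)"
proof -
  let ?w = "\<lambda>z. v + Poly_Mapping.single (minus_one_vec - Rep_quad i) z"
  have w0: "?w 0 = v" by simp
  let ?N = "\<lambda>z. eval P (?w z)" and ?D = "\<lambda>z. eval (X a ^ k) (?w z)"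
  have D0: "?D 0 \<noteq> 0" using v by (simp add: eval_simps)
  have "((\<lambda>z. ?N z / ?D z) has_field_derivative
      (eval (partial i P) v * ?D 0 - ?N 0 * eval (partial i (X a ^ k)) v) / (?D 0 * ?D 0)) (at 0)"
    by (rule DERIV_divide[OF DERIV_eval DERIV_eval D0])
  moreover have "(eval (partial i P) v * ?D 0 - ?N 0 * eval (partial i (X a ^ k)) v) / (?D 0 * ?D 0)
      = eval (chart_partial a i k P) v / coord a v ^ (k + 1)"
    using v(2) unfolding partial_power_X by (cases k) (auto simp: eval_simps chart_partial_def field_simps)
  moreover have ev: "eventually (\<lambda>z. f (?w z) = ?N z / ?D z) (nhds 0)"
  proof -
    have "isCont (\<lambda>z. coord a (?w z)) 0" unfolding coord_translate by (cases "a = i") auto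
    then have "((\<lambda>z. coord a (?w z)) \<longlongrightarrow> coord a (?w 0)) (nhds 0)"
      unfolding isCont_def using tendsto_at_iff_tendsto_nhds[of "\<lambda>z. coord a (?w z)" 0] by blast
    then have "eventually (\<lambda>z. coord a (?w z) \<noteq> 0) (nhds 0)"
      by (rule tendsto_imp_eventually_ne) (use v(2) in simp)
    then show ?thesis
      by eventually_elim (use f V_translate[OF v(1)] in \<open>auto simp: represents_def eval_simps\<close>)
  qed
  ultimately have "((\<lambda>z. f (?w z)) has_field_derivative eval (chart_partial a i k P) v / coord a v ^ (k + 1)) (at 0)"
    using DERIV_cong_ev[OF refl ev refl] by simp
  then show ?thesis unfolding lookup_differential by (rule DERIV_imp_deriv)
qed

definition chart_bracket :: "(quad \<Rightarrow> quad \<Rightarrow> sym_alg) \<Rightarrow> quad \<Rightarrow> nat \<Rightarrow> sym_alg \<Rightarrow> nat \<Rightarrow> sym_alg \<Rightarrow> sym_alg" where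
  "chart_bracket G a k P l Q = (\<Sum>i\<in>UNIV. \<Sum>j\<in>UNIV. G i j * chart_partial a i k P * chart_partial a j l Q)"

lemma fun_bracket_represents:
  assumes F: "F \<in> Hspace 3" and f: "represents a f k P" and g: "represents a g l Q"
  shows "represents a (fun_bracket (Pi_F F) f g) (k + l + 2) (chart_bracket (generator_matrix F) a k P l Q)"
  unfolding represents_def
proof (intro ballI impI)
  fix v assume v: "v \<in> V" "coord a v \<noteq> 0"
  have "fun_bracket (Pi_F F) f g v = (\<Sum>i\<in>UNIV. \<Sum>j\<in>UNIV.
     eval (chart_partial a i k P) v / coord a v ^ (k + 1) * (eval (chart_partial a j l Q) v / coord a v ^ (l + 1)) * bracket_form F i j v)"
    unfolding fun_bracket_def Pi_F_bracket_form[OF F differential_Hspace differential_Hspace v(1)]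
      differential_represents[OF f v] differential_represents[OF g v] ..
  also have "\<dots> = (\<Sum>i\<in>UNIV. \<Sum>j\<in>UNIV. eval (generator_matrix F i j * chart_partial a i k P * chart_partial a j l Q) v / coord a v ^ (k + l + 2))"
    by (intro sum.cong refl) (simp add: eval_mult eval_generator_matrix power_add power2_eq_square field_simps)
  finally show "fun_bracket (Pi_F F) f g v = eval (chart_bracket (generator_matrix F) a k P l Q) v / coord a v ^ (k + l + 2)"
    by (simp add: chart_bracket_def eval_sum sum_divide_distrib)
qed

lemma homogeneous_chart_bracket:
  assumes "homogeneous k P" "homogeneous l Q"
  shows "homogeneous (k + l + 2) (chart_bracket (generator_matrix F) a k P l Q)"
proof -
  have "homogeneous (2 + k + l) (generator_matrix F i j * chart_partial a i k P * chart_partial a j l Q)" for i j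
    by (intro homogeneous_mult homogeneous_generator_matrix homogeneous_chart_partial assms)
  then show ?thesis unfolding chart_bracket_def by (intro homogeneous_sum) (simp add: add_ac)
qed

text \<open>The correction terms contain the Euler field as a factor in one of the two arguments.\<close>

lemma chart_bracket_lift:
  assumes "homogeneous k P" "homogeneous l Q"
  shows "chart_bracket (lift_matrix F) a k P l Q = const 3 * chart_bracket (generator_matrix F) a k P l Q"
proof -
  let ?p = "\<lambda>i. chart_partial a i k P" and ?q = "\<lambda>i. chart_partial a i l Q"
  have "lift_matrix F i j * ?p i * ?q j = const 3 * (generator_matrix F i j * ?p i * ?q j)
     + (lift_correction F i * ?p i) * (X j * ?q j) - (X i * ?p i) * (lift_correction F j * ?q j)" for i j
    by (simp add: lift_matrix_def algebra_simps)
  then have "chart_bracket (lift_matrix F) a k P l Q = const 3 * chart_bracket (generator_matrix F) a k P l Q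
     + (\<Sum>i\<in>UNIV. lift_correction F i * ?p i) * (\<Sum>j\<in>UNIV. X j * ?q j) - (\<Sum>i\<in>UNIV. X i * ?p i) * (\<Sum>j\<in>UNIV. lift_correction F j * ?q j)"
    unfolding chart_bracket_def sum_product by (simp add: sum.distrib sum_subtractf sum_distrib_left)
  then show ?thesis by (simp add: euler_chart_partial assms)
qed

text \<open>The Jacobi identity for functions at a point, where \<open>f\<close>, \<open>g\<close>, \<open>h\<close> stand for the first
  derivatives of three functions, \<open>F\<close>, \<open>G\<close>, \<open>H\<close> for the second ones, \<open>b\<close> for the bivector and
  \<open>x * d l\<close> for its derivatives.  The terms with second derivatives cancel in pairs by symmetry of the
  second derivatives and skewness of \<open>b\<close>; the others assemble to the Jacobiators of the coordinates.\<close>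

lemma jacobi_pointwise:
  fixes b :: "'n :: finite \<Rightarrow> 'n \<Rightarrow> complex" and x :: complex
  assumes skew: "\<And>i j. b i j = - b j i"
    and jac: "\<And>i j k. (\<Sum>l\<in>UNIV. b i l * d l j k + b j l * d l k i + b k l * d l i j) = 0"
    and sym: "\<And>i j. F i j = F j i" "\<And>i j. G i j = G j i" "\<And>i j. H i j = H j i"
  defines "E \<equiv> \<lambda>f g h G H. \<Sum>i\<in>UNIV. \<Sum>l\<in>UNIV. b i l * f i *
      (\<Sum>p\<in>UNIV. \<Sum>q\<in>UNIV. x * d l p q * g p * h q + b p q * G l p * h q + b p q * g p * H l q)"
  shows "E f g h G H + E g h f H F + E h f g F G = 0"
proof -
  define A where "A f g h = (\<Sum>i\<in>UNIV. \<Sum>p\<in>UNIV. \<Sum>q\<in>UNIV. f i * g p * h q * (\<Sum>l\<in>UNIV. b i l * d l p q))" for f g h :: "'n \<Rightarrow> complex"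
  define B where "B f G h = (\<Sum>i\<in>UNIV. \<Sum>l\<in>UNIV. \<Sum>p\<in>UNIV. \<Sum>q\<in>UNIV. b i l * f i * b p q * G l p * h q)" for f h and G :: "'n \<Rightarrow> 'n \<Rightarrow> complex"
  have E: "E f g h G H = x * A f g h + B f G h - B f H g" for f g h G H
  proof -
    have 1: "(\<Sum>i\<in>UNIV. \<Sum>l\<in>UNIV. \<Sum>p\<in>UNIV. \<Sum>q\<in>UNIV. b i l * f i * (x * d l p q * g p * h q)) = x * A f g h"
    proof -
      have "(\<Sum>l\<in>UNIV. \<Sum>p\<in>UNIV. \<Sum>q\<in>UNIV. b i l * f i * (x * d l p q * g p * h q)) =
        (\<Sum>p\<in>UNIV. \<Sum>q\<in>UNIV. \<Sum>l\<in>UNIV. b i l * f i * (x * d l p q * g p * h q))" for i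
        by (rule sum_rotate3)
      then show ?thesis unfolding A_def by (simp add: sum_distrib_left mult_ac)
    qed
    have 2: "(\<Sum>i\<in>UNIV. \<Sum>l\<in>UNIV. \<Sum>p\<in>UNIV. \<Sum>q\<in>UNIV. b i l * f i * (b p q * g p * H l q)) = - B f H g"
    proof -
      have "(\<Sum>p\<in>UNIV. \<Sum>q\<in>UNIV. b i l * f i * (b p q * g p * H l q)) = - (\<Sum>p\<in>UNIV. \<Sum>q\<in>UNIV. b i l * f i * b p q * H l p * g q)" for i l
        unfolding sum_negf[symmetric]
        by (subst sum.swap, intro sum.cong refl, subst skew) (simp add: mult_ac)
      then show ?thesis unfolding B_def by (simp add: sum_negf)
    qed
    have "E f g h G H = (\<Sum>i\<in>UNIV. \<Sum>l\<in>UNIV. \<Sum>p\<in>UNIV. \<Sum>q\<in>UNIV. b i l * f i * (x * d l p q * g p * h q)) +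
       (\<Sum>i\<in>UNIV. \<Sum>l\<in>UNIV. \<Sum>p\<in>UNIV. \<Sum>q\<in>UNIV. b i l * f i * (b p q * G l p * h q)) +
       (\<Sum>i\<in>UNIV. \<Sum>l\<in>UNIV. \<Sum>p\<in>UNIV. \<Sum>q\<in>UNIV. b i l * f i * (b p q * g p * H l q))"
      unfolding E_def by (simp add: sum_distrib_left distrib_left sum.distrib)
    also have "\<dots> = x * A f g h + B f G h - B f H g"
      unfolding 1 2 by (simp add: B_def mult.assoc)
    finally show ?thesis .
  qed
  have Bsym: "B f G h = B h G f" if "\<And>i j. G i j = G j i" for f h and G :: "'n \<Rightarrow> 'n \<Rightarrow> complex"
  proof -
    have "B h G f = (\<Sum>q\<in>UNIV. \<Sum>p\<in>UNIV. \<Sum>l\<in>UNIV. \<Sum>i\<in>UNIV. b i l * f i * b p q * G l p * h q)"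
      unfolding B_def
    proof (intro sum.cong refl)
      fix q p l i
      show "b q p * h q * b l i * G p l * f i = b i l * f i * b p q * G l p * h q"
        using skew[of q p] skew[of l i] that[of p l] by simp
    qed
    also have "\<dots> = (\<Sum>q\<in>UNIV. \<Sum>i\<in>UNIV. \<Sum>l\<in>UNIV. \<Sum>p\<in>UNIV. b i l * f i * b p q * G l p * h q)"
      by (intro sum.cong refl sum_reverse3)
    also have "\<dots> = (\<Sum>i\<in>UNIV. \<Sum>l\<in>UNIV. \<Sum>q\<in>UNIV. \<Sum>p\<in>UNIV. b i l * f i * b p q * G l p * h q)"
      by (rule sum_rotate3)
    also have "\<dots> = B f G h" unfolding B_def by (intro sum.cong refl sum.swap)
    finally show ?thesis by simp
  qed
  have "A f g h + A g h f + A h f g = (\<Sum>i\<in>UNIV. \<Sum>j\<in>UNIV. \<Sum>k\<in>UNIV. f i * g j * h k *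
      (\<Sum>l\<in>UNIV. b i l * d l j k + b j l * d l k i + b k l * d l i j))"
  proof -
    have "A g h f = (\<Sum>i\<in>UNIV. \<Sum>j\<in>UNIV. \<Sum>k\<in>UNIV. g j * h k * f i * (\<Sum>l\<in>UNIV. b j l * d l k i))"
      unfolding A_def by (rule sum_rotate3[symmetric])
    moreover have "A h f g = (\<Sum>i\<in>UNIV. \<Sum>j\<in>UNIV. \<Sum>k\<in>UNIV. h k * f i * g j * (\<Sum>l\<in>UNIV. b k l * d l i j))"
      unfolding A_def by (rule sum_rotate3)
    ultimately show ?thesis unfolding A_def by (simp add: sum.distrib distrib_left mult_ac)
  qed
  then have "A f g h + A g h f + A h f g = 0" by (simp add: jac)
  then have "x * A f g h + x * A g h f + x * A h f g = 0" by (metis distrib_left mult_zero_right)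
  then show ?thesis unfolding E using Bsym[where G = F and f = g and h = h, OF sym(1)] Bsym[where G = G and f = f and h = h, OF sym(2)]
      Bsym[where G = H and f = f and h = g, OF sym(3)] by (simp add: add.assoc)
qed

section \<open>The Jacobi identity\<close>

text \<open>Each of the two nested brackets is one third of the bracket for \<open>lift_matrix\<close>, to which
  \<open>jacobi_pointwise\<close> applies.\<close>

lemma chart_bracket_jacobi:
  fixes a :: quad
  assumes P: "homogeneous k P" and Q: "homogeneous l Q" and R: "homogeneous n R" and F: "F \<in> Hspace 3"
  defines "C \<equiv> chart_bracket (generator_matrix F) a"
  shows "eval (C k P (l + n + 2) (C l Q n R) + C l Q (n + k + 2) (C n R k P) + C n R (k + l + 2) (C k P l Q)) v = 0"
proof -
  let ?b = "\<lambda>i j. eval (lift_matrix F i j) v" and ?d = "\<lambda>i p q. eval (partial i (lift_matrix F p q)) v"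
  define E where "E f g h G H = (\<Sum>i\<in>UNIV. \<Sum>l\<in>UNIV. ?b i l * f i *
      (\<Sum>p\<in>UNIV. \<Sum>q\<in>UNIV. coord a v * ?d l p q * g p * h q + ?b p q * G l p * h q + ?b p q * g p * H l q))"
    for f g h G H
  define D where "D k P i = eval (chart_partial a i k P) v" for k P i
  define DD where "DD k P i j = eval (chart_partial a i (k + 1) (chart_partial a j k P)) v" for k P i j
  have main: "9 * eval (C k P (l + n + 2) (C l Q n R)) v = E (D k P) (D l Q) (D n R) (DD l Q) (DD n R)"
    if P: "homogeneous k P" and Q: "homogeneous l Q" and R: "homogeneous n R" for k l n P Q R
  proof -
    \<comment> \<open>the exponents of the denominators of the three factors of a summand: the entry of the lift is a
      polynomial, and each derivative raises the exponent by one\<close>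
    have m: "l + n + 2 = 0 + (l + 1) + (n + 1)" by simp
    have "const 9 * C k P (l + n + 2) (C l Q n R) = const 3 * chart_bracket (lift_matrix F) a k P (l + n + 2) (C l Q n R)"
      using chart_bracket_lift[OF P homogeneous_chart_bracket[OF Q R, of F a], of F a]
      by (simp add: C_def mult.assoc[symmetric] const_simps[symmetric])
    also have "\<dots> = (\<Sum>i\<in>UNIV. \<Sum>j\<in>UNIV. lift_matrix F i j * chart_partial a i k P *
        chart_partial a j (l + n + 2) (chart_bracket (lift_matrix F) a l Q n R))"
      unfolding chart_bracket_lift[OF Q R] chart_partial_const_mult C_def
      by (simp add: chart_bracket_def sum_distrib_left mult.assoc mult.left_commute)
    also have "\<dots> = (\<Sum>i\<in>UNIV. \<Sum>j\<in>UNIV. lift_matrix F i j * chart_partial a i k P * (\<Sum>p\<in>UNIV. \<Sum>q\<in>UNIV.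
        X a * partial j (lift_matrix F p q) * chart_partial a p l Q * chart_partial a q n R
        + lift_matrix F p q * chart_partial a j (l + 1) (chart_partial a p l Q) * chart_partial a q n R
        + lift_matrix F p q * chart_partial a p l Q * chart_partial a j (n + 1) (chart_partial a q n R)))"
      unfolding chart_bracket_def chart_partial_sum m chart_partial_mult
      by (simp add: chart_partial_weight_0 distrib_right mult.assoc)
    finally have "eval (const 9 * C k P (l + n + 2) (C l Q n R)) v = eval \<dots> v" by (rule arg_cong)
    then show ?thesis
      by (simp add: eval_sum eval_mult eval_add eval_const eval_X E_def D_def DD_def)
  qed
  have "E (D k P) (D l Q) (D n R) (DD l Q) (DD n R) + E (D l Q) (D n R) (D k P) (DD n R) (DD k P)
      + E (D n R) (D k P) (D l Q) (DD k P) (DD l Q) = 0"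
    unfolding E_def
  proof (rule jacobi_pointwise)
    show "eval (lift_matrix F i j) v = - eval (lift_matrix F j i) v" for i j
      by (subst lift_matrix_skew) (rule eval_uminus)
    show "(\<Sum>l\<in>UNIV. ?b i l * ?d l j k + ?b j l * ?d l k i + ?b k l * ?d l i j) = 0" for i j k
      using jacobiator_zero[of F v i j k] by (simp add: jacobiator_def directional_def sum.distrib mult.commute)
    show "DD k P i j = DD k P j i" "DD l Q i j = DD l Q j i" "DD n R i j = DD n R j i" for i j
      unfolding DD_def by (subst chart_partial_commute, rule refl)+
  qed
  then have "9 * (eval (C k P (l + n + 2) (C l Q n R)) v + eval (C l Q (n + k + 2) (C n R k P)) v
     + eval (C n R (k + l + 2) (C k P l Q)) v) = 0"
    unfolding distrib_left main[OF P Q R] main[OF Q R P] main[OF R P Q] .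
  then show ?thesis unfolding eval_add mult_eq_0_iff by simp
qed

lemma Pi_F_skew:
  assumes "F \<in> Hspace 3" "s \<in> Hspace 2" "t \<in> Hspace 2" "e \<in> V"
  shows "Pi_F F e s t = - Pi_F F e t s"
proof -
  have skew: "bracket_form F a b e = - bracket_form F b a e" for a b
    unfolding eval_generator_matrix[symmetric] by (subst generator_matrix_skew) (rule eval_uminus)
  have "Pi_F F e s t = (\<Sum>b\<in>UNIV. \<Sum>a\<in>UNIV. - (lookup t (Rep_quad b) * lookup s (Rep_quad a) * bracket_form F b a e))"
    unfolding Pi_F_bracket_form[OF assms] by (subst sum.swap, subst skew) (simp add: mult_ac)
  then show ?thesis unfolding Pi_F_bracket_form[OF assms(1,3,2,4)] by (simp add: sum_negf)
qed

lemma Hspace_comb: "f \<in> Hspace n \<Longrightarrow> g \<in> Hspace n \<Longrightarrow> const c * f + g \<in> Hspace n"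
  unfolding Hspace_def
proof clarify
  fix x assume fg: "keys f \<subseteq> Delta n" "keys g \<subseteq> Delta n" and "x \<in> keys (const c * f + g)"
  then have "lookup f x \<noteq> 0 \<or> lookup g x \<noteq> 0" by (auto simp: in_keys_iff lookup_add lookup_const_mult)
  then show "x \<in> Delta n" using fg by (auto simp: in_keys_iff)
qed

lemma is_bivector_Pi_F:
  assumes F: "F \<in> Hspace 3"
  shows "is_bivector (Pi_F F)"
  unfolding is_bivector_def
proof (intro conjI ballI allI impI)
  fix e s t u c
  assume "e \<in> V - {0}" "s \<in> perp e" "t \<in> perp e" "u \<in> perp e"
  then have e: "e \<in> V" and s: "s \<in> Hspace 2" and t: "t \<in> Hspace 2" and u: "u \<in> Hspace 2" by (auto simp: perp_def)
  show "Pi_F F e s t = - Pi_F F e t s" by (rule Pi_F_skew[OF F s t e])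
  show "Pi_F F e (const c * s + t) u = c * Pi_F F e s u + Pi_F F e t u"
    unfolding Pi_F_bracket_form[OF F Hspace_comb[OF s t] u e] Pi_F_bracket_form[OF F s u e] Pi_F_bracket_form[OF F t u e]
    by (simp add: lookup_add lookup_const_mult distrib_right sum.distrib sum_distrib_left mult.assoc)
next
  fix a f g assume "regular a f" "regular a g"
  then show "regular a (fun_bracket (Pi_F F) f g)"
    unfolding regular_iff using fun_bracket_represents[OF F] homogeneous_chart_bracket by meson
qed

lemma poisson_Pi_F:
  assumes F: "F \<in> Hspace 3"
  shows "poisson (Pi_F F)"
  unfolding poisson_def
proof (intro conjI allI impI ballI is_bivector_Pi_F[OF F])
  fix a f g h v
  assume "regular a f" "regular a g" "regular a h" and v: "v \<in> V" "coord a v \<noteq> 0"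
  then obtain k P l Q n R where f: "represents a f k P" and g: "represents a g l Q" and h: "represents a h n R"
    and hom: "homogeneous k P" "homogeneous l Q" "homogeneous n R" unfolding regular_iff by blast
  note fb = fun_bracket_represents[OF F]
  note * = fb[OF f fb[OF g h]] fb[OF g fb[OF h f]] fb[OF h fb[OF f g]]
  have e: "k + (l + n + 2) + 2 = k + l + n + 4" "l + (n + k + 2) + 2 = k + l + n + 4" "n + (k + l + 2) + 2 = k + l + n + 4"
    by simp_all
  show "fun_bracket (Pi_F F) f (fun_bracket (Pi_F F) g h) v + fun_bracket (Pi_F F) g (fun_bracket (Pi_F F) h f) v
     + fun_bracket (Pi_F F) h (fun_bracket (Pi_F F) f g) v = 0"
    using chart_bracket_jacobi[OF hom F, of a v] *[unfolded represents_def e, rule_format, OF v]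
    by (simp add: eval_add flip: add_divide_distrib)
qed

section \<open>The linear family\<close>

lemma m4_comb_1: "m4 (const c * x + const d * x') y z w = const c * m4 x y z w + const d * m4 x' y z w"
  and m4_comb_2: "m4 x (const c * y + const d * y') z w = const c * m4 x y z w + const d * m4 x y' z w"
proof -
  have incl: "incl (const c * x + const d * x') = (\<lambda>I. const c * incl x I + const d * incl x' I)" for x x'
    by (rule ext) (simp add: incl_def nonneg_part_def neg_part_def restrict_add restrict_const)
  have cup1: "cup (\<lambda>I. const c * \<alpha> I + const d * \<alpha>' I) \<beta> = (\<lambda>I. const c * cup \<alpha> \<beta> I + const d * cup \<alpha>' \<beta> I)" for \<alpha> \<alpha>' \<beta>
    by (rule ext) (simp add: cup_def distrib_right sum.distrib sum_distrib_left mult.assoc)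
  have cup2: "cup \<beta> (\<lambda>I. const c * \<alpha> I + const d * \<alpha>' I) = (\<lambda>I. const c * cup \<beta> \<alpha> I + const d * cup \<beta> \<alpha>' I)" for \<alpha> \<alpha>' \<beta>
    by (rule ext) (simp add: cup_def distrib_left sum.distrib sum_distrib_left mult.left_commute)
  have alt: "alt_component (\<lambda>I. const c * \<alpha> I + const d * \<alpha>' I) J = const c * alt_component \<alpha> J + const d * alt_component \<alpha>' J" for \<alpha> \<alpha>' J
    by (simp add: alt_component_def distrib_left mult.left_commute)
  have hom: "homotopy (\<lambda>I. const c * \<alpha> I + const d * \<alpha>' I) = (\<lambda>I. const c * homotopy \<alpha> I + const d * homotopy \<alpha>' I)" for \<alpha> \<alpha>'
    by (rule ext) (simp add: homotopy_def alt restrict_add restrict_const sum.distrib sum_distrib_left)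
  have proj: "proj (\<lambda>I. const c * \<alpha> I + const d * \<alpha>' I) = const c * proj \<alpha> + const d * proj \<alpha>'" for \<alpha> \<alpha>'
    by (simp add: proj_def nonneg_part_def neg_part_def restrict_add restrict_const algebra_simps)
  show "m4 (const c * x + const d * x') y z w = const c * m4 x y z w + const d * m4 x' y z w"
    unfolding m4_def incl cup1 cup2 hom proj by (simp add: algebra_simps)
  show "m4 x (const c * y + const d * y') z w = const c * m4 x y z w + const d * m4 x y' z w"
    unfolding m4_def incl cup1 cup2 hom proj by (simp add: algebra_simps)
qed

lemma Pi_F_comb: "Pi_F (const c * F + const d * G) = bivec_comb c (Pi_F F) d (Pi_F G)"
  unfolding bivec_comb_def Pi_F_def m4_comb_1 m4_comb_2
  by (intro ext) (simp add: serre_pairing_add serre_pairing_diff serre_pairing_const algebra_simps)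

lemma induces_Pi_F:
  assumes F: "F \<in> Hspace 3"
  shows "induces (biderivation_of (generator_matrix F)) (Pi_F F)"
proof -
  have "homogeneous 2 (biderivation_of (generator_matrix F) (lin_form s) (lin_form t))" for s t
    unfolding biderivation_of_def partial_lin_form
    by (intro homogeneous_sum) (simp add: mult.assoc homogeneous_const_mult homogeneous_generator_matrix)
  then show ?thesis using eval_bracket_lin_forms[OF F] by (auto simp: induces_def bivec_eq_def perp_def)
qed

theorem theorem3p2:
  shows "(\<forall>F\<in>Hspace 3.
            (\<exists>!br. is_bracket F br) \<and>
            (\<forall>br. is_bracket F br \<longrightarrow> induces br (Pi_F F)) \<and>
            poisson (Pi_F F)) \<and>
         (\<forall>F\<in>Hspace 3. \<forall>G\<in>Hspace 3.
            compatible (Pi_F F) (Pi_F G) \<and>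
            (\<forall>c d. bivec_eq (Pi_F (const c * F + const d * G)) (bivec_comb c (Pi_F F) d (Pi_F G)))) \<and>
         (\<forall>F. smooth_cubic F \<longrightarrow> is_FO_bracket F (Pi_F F))"
proof (intro conjI ballI allI impI)
  fix F assume F: "F \<in> Hspace 3"
  show "\<exists>!br. is_bracket F br" unfolding is_bracket_iff by blast
  show "poisson (Pi_F F)" by (rule poisson_Pi_F[OF F])
  show "induces br (Pi_F F)" if "is_bracket F br" for br
    using that induces_Pi_F[OF F] by (simp add: is_bracket_iff)
next
  fix F G c d assume F: "F \<in> Hspace 3" and G: "G \<in> Hspace 3"
  have "const d' * G \<in> Hspace 3" for d' using Hspace_comb[OF G, of 0 d'] by (simp add: Hspace_def)
  then have "const c' * F + const d' * G \<in> Hspace 3" for c' d' using Hspace_comb[OF F] by blast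
  then show "compatible (Pi_F F) (Pi_F G)"
    unfolding compatible_def Pi_F_comb[symmetric] using poisson_Pi_F by blast
  show "bivec_eq (Pi_F (const c * F + const d * G)) (bivec_comb c (Pi_F F) d (Pi_F G))"
    by (simp add: bivec_eq_def Pi_F_comb)
next
  fix F assume "smooth_cubic F"
  then show "is_FO_bracket F (Pi_F F)" by (intro is_FO_bracket_Pi_F) (auto simp: smooth_cubic_def)
qed

end
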